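(* Let $V(x)=\|x\|^2$ on $\mathbb{Z}^d$. Then $\alpha^*(V)\le\pi\big((1+\rho_0)^{1/d}-1\big)^{-2}\approx\pi(1.44504^{1/d}-1)^{-2}$, where $\rho_0\approx0.44504$ is the unique solution $r\in[0,1]$ of $\frac{r}{(1-r)^2}-r=1$. Moreover, for every $\alpha>\alpha^*(V)$ there exists a family of random permutations $(\zeta_\Lambda,\ \Lambda\subseteq\mathbb{Z}^d)$ on a common probability space with $\zeta_\Lambda\in S_\Lambda$, $\zeta_\Lambda\sim G_\Lambda$ for finite $\Lambda$, $\zeta_\Lambda(x)\to\zeta_{\mathbb{Z}^d}(x)$ a.s. for all $x$, and whose limit law $\mu$ (the law of $\zeta_{\mathbb{Z}^d}$) is an ergodic Gibbs measure, such that for each $v\in\mathbb{Z}^d$: (i) for every finite $\Lambda$, $G_\Lambda\tau_v=G_{\Lambda|\tau_v}$; in particular $\tau_v\zeta_\Lambda$ has law $G_{\Lambda|\tau_v}$; (ii) $\lim_{\Lambda\nearrow\mathbb{Z}^d}\tau_v\zeta_\Lambda(x)=\tau_v\zeta_{\mathbb{Z}^d}(x)$ almost surely for all $x\in\mathbb{Z}^d$, and consequently $G_{\Lambda|\tau_v}\to\mu\tau_v$ weakly; (iii) $\mu\tau_v$ is an ergodic (with respect to spatial translations) Gibbs measure at temperature $\alpha$ with mean jump $v$.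
   Context: $S$ is the set of bijections of $\mathbb{Z}^d$ (product topology); $(\sigma\sigma')(x)=\sigma(\sigma'(x))$; $\tau_v(x)=x+v$; for a measure $\mu$ and $\tau\in S$, $\mu\tau$ is the law of $\tau\sigma$ with $\sigma\sim\mu$. For $\xi\in S$ and finite $\Lambda$, $S_{\Lambda|\xi}=\{\sigma:\sigma(x)=\xi(x),x\notin\Lambda\}$, $S_\Lambda=S_{\Lambda|\mathrm I}$ ($S_{\mathbb{Z}^d}=S$), $H_\Lambda(\sigma)=\sum_{x\in\Lambda}V(\sigma(x)-x)$, $G_{\Lambda|\xi}(\sigma)=Z^{-1}_{\Lambda|\xi}e^{-\alpha H_\Lambda(\sigma)}$ on $S_{\Lambda|\xi}$, $G_\Lambda=G_{\Lambda|\mathrm I}$. Gibbs measure at temperature $\alpha$: for all finite $\Lambda$ and $\mu$-a.e. $\xi$, $\mu(\cdot\mid\sigma=\xi\text{ off }\Lambda)=G_{\Lambda|\xi}$. Finite cycles $\gamma$ (length $|\gamma|\ge2$, support $\{\gamma\}$) form the set $\Gamma$; $w(\gamma)=\exp\{-\alpha\sum_{x\in\{\gamma\}}V(\gamma(x)-x)\}$, $\beta(V,\alpha)=\sum_{\gamma\in\Gamma,\vec0\in\{\gamma\}}|\gamma|w(\gamma)$, $\alpha^*(V)=\inf\{\alpha:\beta(V,\alpha)<1\}$. *)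

theory Defs
  imports "HOL-Probability.Probability"
begin

type_synonym 'd zd = "int ^ 'd"

text \<open>The space S of bijections of Z^d, with the product (evaluation) sigma algebra,
  i.e. the Borel sigma algebra of the product topology (Z^d is countable).\<close>
definition Sspace :: "(('d::finite) zd \<Rightarrow> 'd zd) measure" where
  "Sspace = restrict_space (Pi\<^sub>M UNIV (\<lambda>_. count_space UNIV)) {\<sigma>. bij \<sigma>}"

definition tau :: "('d::finite) zd \<Rightarrow> 'd zd \<Rightarrow> 'd zd" where
  "tau v = (\<lambda>x. x + v)"

definition rmul :: "(('d::finite) zd \<Rightarrow> 'd zd) measure \<Rightarrow> ('d zd \<Rightarrow> 'd zd) \<Rightarrow> ('d zd \<Rightarrow> 'd zd) measure" where
  "rmul \<mu> t = distr \<mu> Sspace (\<lambda>\<sigma>. t \<circ> \<sigma>)"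

definition Scond :: "('d::finite) zd set \<Rightarrow> ('d zd \<Rightarrow> 'd zd) \<Rightarrow> ('d zd \<Rightarrow> 'd zd) set" where
  "Scond \<Lambda> \<xi> = {\<sigma>. bij \<sigma> \<and> (\<forall>x. x \<notin> \<Lambda> \<longrightarrow> \<sigma> x = \<xi> x)}"

definition Ham :: "(('d::finite) zd \<Rightarrow> real) \<Rightarrow> 'd zd set \<Rightarrow> ('d zd \<Rightarrow> 'd zd) \<Rightarrow> real" where
  "Ham V \<Lambda> \<sigma> = (\<Sum>x\<in>\<Lambda>. V (\<sigma> x - x))"

definition Zpart :: "(('d::finite) zd \<Rightarrow> real) \<Rightarrow> real \<Rightarrow> 'd zd set \<Rightarrow> ('d zd \<Rightarrow> 'd zd) \<Rightarrow> real" where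
  "Zpart V \<alpha> \<Lambda> \<xi> = (\<Sum>\<sigma>\<in>Scond \<Lambda> \<xi>. exp (- \<alpha> * Ham V \<Lambda> \<sigma>))"

definition Gibbs_fin :: "(('d::finite) zd \<Rightarrow> real) \<Rightarrow> real \<Rightarrow> 'd zd set \<Rightarrow> ('d zd \<Rightarrow> 'd zd) \<Rightarrow> ('d zd \<Rightarrow> 'd zd) measure" where
  "Gibbs_fin V \<alpha> \<Lambda> \<xi> =
     distr (point_measure (Scond \<Lambda> \<xi>) (\<lambda>\<sigma>. ennreal (exp (- \<alpha> * Ham V \<Lambda> \<sigma>) / Zpart V \<alpha> \<Lambda> \<xi>)))
       Sspace (\<lambda>\<sigma>. \<sigma>)"

definition Foff :: "('d::finite) zd set \<Rightarrow> ('d zd \<Rightarrow> 'd zd) measure" where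
  "Foff \<Lambda> = sigma (space Sspace) {{\<sigma>\<in>space Sspace. \<sigma> x = y} | x y. x \<notin> \<Lambda>}"

text \<open>Gibbs measure at temperature alpha (DLR condition): for every finite Lambda,
  G_{Lambda|xi}(A) is a version of the conditional probability mu(A | F_{Lambda^c})(xi).\<close>
definition is_Gibbs :: "(('d::finite) zd \<Rightarrow> real) \<Rightarrow> real \<Rightarrow> ('d zd \<Rightarrow> 'd zd) measure \<Rightarrow> bool" where
  "is_Gibbs V \<alpha> \<mu> \<longleftrightarrow> prob_space \<mu> \<and> sets \<mu> = sets Sspace \<and>
     (\<forall>\<Lambda>. finite \<Lambda> \<longrightarrow>
        (\<forall>A\<in>sets Sspace. \<forall>B\<in>sets (Foff \<Lambda>).
           emeasure \<mu> (A \<inter> B) = (\<integral>\<^sup>+\<xi>. emeasure (Gibbs_fin V \<alpha> \<Lambda> \<xi>) A * indicator B \<xi> \<partial>\<mu>)))"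

definition shift :: "('d::finite) zd \<Rightarrow> ('d zd \<Rightarrow> 'd zd) \<Rightarrow> ('d zd \<Rightarrow> 'd zd)" where
  "shift u \<sigma> = tau u \<circ> \<sigma> \<circ> tau (- u)"

definition ergodic :: "(('d::finite) zd \<Rightarrow> 'd zd) measure \<Rightarrow> bool" where
  "ergodic \<mu> \<longleftrightarrow> prob_space \<mu> \<and> sets \<mu> = sets Sspace \<and>
     (\<forall>u. distr \<mu> Sspace (shift u) = \<mu>) \<and>
     (\<forall>A\<in>sets Sspace. (\<forall>u. shift u -` A \<inter> space Sspace = A) \<longrightarrow>
        measure \<mu> A = 0 \<or> measure \<mu> A = 1)"

definition mean_jump :: "(('d::finite) zd \<Rightarrow> 'd zd) measure \<Rightarrow> 'd zd \<Rightarrow> bool" where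
  "mean_jump \<mu> v \<longleftrightarrow> (\<forall>x i. integrable \<mu> (\<lambda>\<sigma>. real_of_int ((\<sigma> x - x) $ i)) \<and>
        (\<integral>\<sigma>. real_of_int ((\<sigma> x - x) $ i) \<partial>\<mu>) = real_of_int (v $ i))"

definition csupp :: "(('d::finite) zd \<Rightarrow> 'd zd) \<Rightarrow> 'd zd set" where
  "csupp \<gamma> = {x. \<gamma> x \<noteq> x}"

definition is_fcycle :: "(('d::finite) zd \<Rightarrow> 'd zd) \<Rightarrow> bool" where
  "is_fcycle \<gamma> \<longleftrightarrow> bij \<gamma> \<and> finite (csupp \<gamma>) \<and> card (csupp \<gamma>) \<ge> 2 \<and>
     (\<forall>x\<in>csupp \<gamma>. \<forall>y\<in>csupp \<gamma>. \<exists>n. (\<gamma> ^^ n) x = y)"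

definition cweight :: "(('d::finite) zd \<Rightarrow> real) \<Rightarrow> real \<Rightarrow> ('d zd \<Rightarrow> 'd zd) \<Rightarrow> real" where
  "cweight V \<alpha> \<gamma> = exp (- \<alpha> * (\<Sum>x\<in>csupp \<gamma>. V (\<gamma> x - x)))"

text \<open>beta(V, alpha) (possibly infinite, hence valued in ennreal).\<close>
definition beta :: "(('d::finite) zd \<Rightarrow> real) \<Rightarrow> real \<Rightarrow> ennreal" where
  "beta V \<alpha> = (\<Sum>\<^sub>\<infinity>\<gamma>\<in>{\<gamma>. is_fcycle \<gamma> \<and> 0 \<in> csupp \<gamma>}.
                 ennreal (real (card (csupp \<gamma>)) * cweight V \<alpha> \<gamma>))"

text \<open>alpha^*(V) = inf {alpha. beta(V,alpha) < 1}, in the extended reals (inf of empty set = +infinity).\<close>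
definition alpha_star :: "(('d::finite) zd \<Rightarrow> real) \<Rightarrow> ereal" where
  "alpha_star V = Inf (ereal ` {\<alpha>. beta V \<alpha> < 1})"

definition sqnorm :: "('d::finite) zd \<Rightarrow> real" where
  "sqnorm x = real_of_int (\<Sum>i\<in>UNIV. (x $ i)^2)"

end

theory Submission
  imports Defs "HOL-Combinatorics.Combinatorics"
begin

text \<open>
  A permutation of a finite set is a family of disjoint cycles, so \<open>G\<^sub>\<Lambda>\<close> is a gas of cycles with
  hard-core exclusion and partition function \<open>Z \<Lambda>\<close>. Revealing the cycle through one site expresses
  \<open>Z (\<Lambda> - {x}) / Z \<Lambda>\<close> through the same ratios in smaller volumes, and \<open>beta < 1\<close> makes this
  recursion a contraction in the supremum norm. Hence all ratios \<open>Z (\<Lambda> - F) / Z \<Lambda>\<close> are uniformly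
  continuous functions of \<open>\<Lambda>\<close>, so they converge as \<open>\<Lambda>\<close> exhausts the lattice, the limit does not feel
  translations, and far apart events decouple; this gives the weak limit, its invariance and mixing.
  Almost sure convergence is obtained from one uniform variable: enumerate the sites and sample the
  cycles through them by lexicographic quantiles, whose interval endpoints are finite sums of
  converging probabilities. The Gibbs property is equivalent to quasi-invariance under composition
  with finite permutations, which passes to the limit, and which composition with a translation
  preserves because the squared norm changes by a term depending only on the image of \<open>\<Lambda>\<close>.
  Finally, \<open>beta\<close> is bounded by summing over all jump sequences and comparing the theta series with a
  Gaussian integral.
\<close>

section \<open>Cycles of finite permutations\<close>

text \<open>Sampling records the whole cycle through a site, not merely its image: a prescribed
  cycle has probability a weight times one ratio \<open>Q\<close>, whereas a prescribed image
  collects ever more cycles as the volume grows. It also settles the obstacle that a pointwise limit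
  of bijections need not be onto: once the cycle at y has stabilized, so has the preimage of y. The
  other danger is mass escaping to ever longer cycles; the weights of the cycles at one site form a
  summable majorant uniform in the volume, so Tannery's theorem keeps the limit probabilities total.
  The constant comes from r/(1-r)^2 - r being the sum of k r^k over k >= 2, where r = (1 +
  sqrt(pi/\<alpha>))^d - 1 bounds the total weight of the nonzero jumps. Since the critical value is
  an infimum, every larger \<alpha> leaves a smaller \<alpha>' with \<open>beta\<close> still below
  1, and this gap pays for the first moment of a jump. The untranslated limit has mean jump 0 by
  reflection in a site, so composing with \<open>tau v\<close> gives mean jump v.\<close>

definition cycles_at :: "('d::finite) zd \<Rightarrow> ('d zd \<Rightarrow> 'd zd) set" where
  "cycles_at x = {\<gamma>. is_fcycle \<gamma> \<and> x \<in> csupp \<gamma>}"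

text \<open>At a fixed point the value is \<open>id\<close>, which lies in no
  \<open>cycles_at\<close>; being fixed is thus one more possible value of the cycle at a
  site.\<close>

definition cyc :: "(('d::finite) zd \<Rightarrow> 'd zd) \<Rightarrow> 'd zd \<Rightarrow> ('d zd \<Rightarrow> 'd zd)" where
  "cyc \<sigma> x = perm_restrict \<sigma> (orbit \<sigma> x)"

lemma Scond_id: "Scond \<Lambda> id = {\<sigma>. \<sigma> permutes \<Lambda>}"
  by (auto simp: Scond_def permutes_def bij_iff)

lemma csupp_subset_permutes: "\<sigma> permutes \<Lambda> \<Longrightarrow> csupp \<sigma> \<subseteq> \<Lambda>"
  by (auto simp: csupp_def permutes_def)

lemma permutes_csupp: "bij \<sigma> \<Longrightarrow> \<sigma> permutes csupp \<sigma>"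
  by (auto simp: csupp_def permutes_def bij_iff)

lemma permutes_permutation: "finite \<Lambda> \<Longrightarrow> \<sigma> permutes \<Lambda> \<Longrightarrow> permutation \<sigma>"
  by (auto simp: permutation_permutes)

lemma cycles_atD:
  assumes "\<gamma> \<in> cycles_at x"
  shows "permutation \<gamma>" "finite (csupp \<gamma>)" "x \<in> csupp \<gamma>" "\<gamma> permutes csupp \<gamma>"
    "2 \<le> card (csupp \<gamma>)" "bij \<gamma>" "is_fcycle \<gamma>"
  using assms by (auto simp: cycles_at_def is_fcycle_def permutation_permutes intro: permutes_csupp)

lemma orbit_fcycle:
  assumes "\<gamma> \<in> cycles_at x"
  shows "orbit \<gamma> x = csupp \<gamma>"
proof -
  note g = cycles_atD[OF assms]
  have "orbit \<gamma> x \<subseteq> csupp \<gamma>"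
    using permutes_orbit_subset[OF g(4) g(3)] .
  moreover have "csupp \<gamma> \<subseteq> orbit \<gamma> x"
    using g(3,7) unfolding orbit_altdef_permutation[OF g(1)] is_fcycle_def by force
  ultimately show ?thesis by auto
qed

lemma permutes_perm_restrict:
  assumes "inj \<sigma>" "finite F" "\<sigma> ` F \<subseteq> F"
  shows "perm_restrict \<sigma> F permutes F"
proof -
  have "bij_betw \<sigma> F F"
    using assms inj_on_subset[OF assms(1), of F] by (simp add: bij_betw_def endo_inj_surj)
  then have "bij_betw (perm_restrict \<sigma> F) F F"
    by (rule iffD1[OF bij_betw_cong, rotated]) (simp add: perm_restrict_def)
  then show ?thesis
    by (rule bij_imp_permutes) (simp add: perm_restrict_def)
qed

lemma permutes_perm_restrict_orbit:
  assumes "permutation \<sigma>"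
  shows "perm_restrict \<sigma> (orbit \<sigma> x) permutes orbit \<sigma> x"
proof (rule permutes_perm_restrict)
  show "inj \<sigma>" using assms permutation_bijective bij_def by blast
  show "finite (orbit \<sigma> x)" by (intro finite_orbit permutation_self_in_orbit assms)
qed (auto intro: orbit.intros)

lemma cyc_eq_id_iff:
  assumes "permutation \<sigma>"
  shows "cyc \<sigma> x = id \<longleftrightarrow> \<sigma> x = x"
proof
  assume "cyc \<sigma> x = id"
  then have "cyc \<sigma> x x = x" by simp
  then show "\<sigma> x = x"
    by (simp add: cyc_def perm_restrict_def permutation_self_in_orbit[OF assms])
next
  assume "\<sigma> x = x"
  then have "orbit \<sigma> x = {x}" by (simp add: orbit_eq_singleton_iff)
  then show "cyc \<sigma> x = id" using \<open>\<sigma> x = x\<close> by (auto simp: cyc_def perm_restrict_def)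
qed

lemma orbit_no_fixpoint:
  assumes "permutation \<sigma>" "\<sigma> x \<noteq> x" "y \<in> orbit \<sigma> x"
  shows "\<sigma> y \<noteq> y"
proof
  assume "\<sigma> y = y"
  then have "orbit \<sigma> y = {y}" by (simp add: orbit_eq_singleton_iff)
  moreover have "x \<in> orbit \<sigma> y"
    using orbit_swap[OF permutation_self_in_orbit[OF assms(1)] assms(3)] .
  ultimately show False using assms(2) \<open>\<sigma> y = y\<close> by auto
qed

lemma csupp_cyc:
  assumes "permutation \<sigma>" "\<sigma> x \<noteq> x"
  shows "csupp (cyc \<sigma> x) = orbit \<sigma> x"
  using orbit_no_fixpoint[OF assms] by (auto simp: csupp_def cyc_def perm_restrict_def)

lemma cyc_in_cycles_at:
  assumes "permutation \<sigma>" "\<sigma> x \<noteq> x"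
  shows "cyc \<sigma> x \<in> cycles_at x"
proof -
  have perm: "cyc \<sigma> x permutes orbit \<sigma> x"
    unfolding cyc_def by (rule permutes_perm_restrict_orbit[OF assms(1)])
  have fin: "finite (orbit \<sigma> x)"
    by (intro finite_orbit permutation_self_in_orbit assms)
  have self: "x \<in> orbit \<sigma> x" using permutation_self_in_orbit[OF assms(1)] .
  have two: "2 \<le> card (orbit \<sigma> x)"
  proof -
    have "{x, \<sigma> x} \<subseteq> orbit \<sigma> x" using self by (auto intro: orbit.intros)
    from card_mono[OF fin this] show ?thesis using assms(2) by simp
  qed
  have "(cyc \<sigma> x ^^ n) y = (\<sigma> ^^ n) y \<and> (\<sigma> ^^ n) y \<in> orbit \<sigma> x" if "y \<in> orbit \<sigma> x" for n y
    by (induction n) (auto simp: cyc_def perm_restrict_def that intro: orbit.intros)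
  moreover have "\<exists>n. (\<sigma> ^^ n) y = z" if "y \<in> orbit \<sigma> x" "z \<in> orbit \<sigma> x" for y z
  proof -
    have "z \<in> orbit \<sigma> y"
      using orbit_swap[OF self that(1)] that(2) orbit_trans by fastforce
    then show ?thesis by (auto simp: orbit_altdef)
  qed
  ultimately have "\<exists>n. (cyc \<sigma> x ^^ n) y = z" if "y \<in> orbit \<sigma> x" "z \<in> orbit \<sigma> x" for y z
    using that by simp
  then show ?thesis
    using fin two self perm by (auto simp: cycles_at_def is_fcycle_def csupp_cyc[OF assms] permutes_bij)
qed

lemma orbit_cong_on:
  assumes "\<And>y. y \<in> orbit \<tau> x \<Longrightarrow> \<sigma> y = \<tau> y" "x \<in> orbit \<tau> x"
  shows "orbit \<sigma> x = orbit \<tau> x"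
proof -
  have "(\<sigma> ^^ n) x = (\<tau> ^^ n) x \<and> (\<tau> ^^ n) x \<in> orbit \<tau> x" for n
    using assms by (induction n) (auto intro: orbit.intros)
  then show ?thesis by (simp add: orbit_altdef)
qed

text \<open>Prescribing the cycle at a site is a condition on finitely many values of \<sigma>. This
  converts cycle events into agreement events, for which the weights factorize.\<close>

lemma cyc_eq_iff:
  assumes "permutation \<sigma>" "permutation \<tau>"
  shows "cyc \<sigma> x = cyc \<tau> x \<longleftrightarrow> (\<forall>y\<in>orbit \<tau> x. \<sigma> y = \<tau> y)"
proof
  assume *: "\<forall>y\<in>orbit \<tau> x. \<sigma> y = \<tau> y"
  then have "orbit \<sigma> x = orbit \<tau> x"
    by (intro orbit_cong_on permutation_self_in_orbit assms) auto
  then show "cyc \<sigma> x = cyc \<tau> x" using * by (auto simp: cyc_def perm_restrict_def)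
next
  assume *: "cyc \<sigma> x = cyc \<tau> x"
  show "\<forall>y\<in>orbit \<tau> x. \<sigma> y = \<tau> y"
  proof (cases "\<tau> x = x")
    case True
    then have "\<sigma> x = x" using * cyc_eq_id_iff assms by metis
    moreover have "orbit \<tau> x = {x}" using True by (simp add: orbit_eq_singleton_iff)
    ultimately show ?thesis using True by simp
  next
    case False
    then have ne: "\<sigma> x \<noteq> x" using * cyc_eq_id_iff assms by metis
    have "orbit \<sigma> x = orbit \<tau> x"
      using csupp_cyc[OF assms(1) ne] csupp_cyc[OF assms(2) False] * by simp
    then show ?thesis using * by (metis cyc_def perm_restrict_def)
  qed
qed

lemma cyc_fcycle:
  assumes "\<gamma> \<in> cycles_at x"
  shows "cyc \<gamma> x = \<gamma>"
  using orbit_fcycle[OF assms] by (auto simp: cyc_def perm_restrict_def csupp_def)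

lemma cyc_eq_fcycle_iff:
  assumes "permutation \<sigma>" "\<gamma> \<in> cycles_at x"
  shows "cyc \<sigma> x = \<gamma> \<longleftrightarrow> (\<forall>y\<in>csupp \<gamma>. \<sigma> y = \<gamma> y)"
  using cyc_eq_iff[OF assms(1) cycles_atD(1)[OF assms(2)], of x] cyc_fcycle[OF assms(2)]
    orbit_fcycle[OF assms(2)] by simp

section \<open>Conjugation by a bijection, serving both translations and point reflections\<close>

definition conj_by :: "('a \<Rightarrow> 'a) \<Rightarrow> ('a \<Rightarrow> 'a) \<Rightarrow> 'a \<Rightarrow> 'a" where
  "conj_by g \<sigma> = g \<circ> \<sigma> \<circ> inv g"

lemma conj_by_apply: "bij g \<Longrightarrow> conj_by g \<sigma> (g x) = g (\<sigma> x)"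
  by (simp add: conj_by_def bij_is_inj)

lemma bij_conj_by: "bij g \<Longrightarrow> bij \<sigma> \<Longrightarrow> bij (conj_by g \<sigma>)"
  unfolding conj_by_def by (intro bij_comp bij_imp_bij_inv)

lemma conj_by_inv: "bij g \<Longrightarrow> conj_by (inv g) (conj_by g \<sigma>) = \<sigma>"
  by (rule ext) (simp add: conj_by_def inv_inv_eq bij_is_inj)

lemma inv_conj_by: "bij g \<Longrightarrow> conj_by g (conj_by (inv g) \<sigma>) = \<sigma>"
  by (rule ext) (simp add: conj_by_def inv_inv_eq bij_is_surj surj_f_inv_f)

lemma conj_by_permutes:
  assumes "bij g" "\<sigma> permutes \<Lambda>"
  shows "conj_by g \<sigma> permutes g ` \<Lambda>"
unfolding permutes_def
proof (intro conjI allI impI)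
  show "\<exists>!x. conj_by g \<sigma> x = y" for y
    using bij_conj_by[OF assms(1) permutes_bij[OF assms(2)]] by (simp add: bij_iff)
  show "conj_by g \<sigma> x = x" if "x \<notin> g ` \<Lambda>" for x
  proof -
    obtain y where "x = g y" using assms(1) by (metis bij_pointE)
    moreover from this have "y \<notin> \<Lambda>" using that by blast
    ultimately show ?thesis using assms(2) by (simp add: conj_by_apply[OF assms(1)] permutes_not_in)
  qed
qed

lemma csupp_conj_by:
  assumes "bij g"
  shows "csupp (conj_by g \<sigma>) = g ` csupp \<sigma>"
proof -
  have "conj_by g \<sigma> (g y) \<noteq> g y \<longleftrightarrow> \<sigma> y \<noteq> y" for y
    using assms by (simp add: conj_by_apply bij_is_inj inj_eq)
  then have "y \<in> csupp \<sigma> \<longleftrightarrow> g y \<in> csupp (conj_by g \<sigma>)" for y by (simp add: csupp_def)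
  then have "g -` csupp (conj_by g \<sigma>) = csupp \<sigma>" by auto
  then show ?thesis
    using surj_image_vimage_eq[OF bij_is_surj[OF assms], of "csupp (conj_by g \<sigma>)"] by simp
qed

lemma conj_by_funpow: "bij g \<Longrightarrow> (conj_by g \<sigma> ^^ n) (g x) = g ((\<sigma> ^^ n) x)"
  by (induction n) (auto simp: conj_by_apply)

lemma conj_by_cycles_at:
  assumes "bij g" "\<gamma> \<in> cycles_at x"
  shows "conj_by g \<gamma> \<in> cycles_at (g x)"
proof -
  have "\<exists>n. (conj_by g \<gamma> ^^ n) y = z" if "y \<in> g ` csupp \<gamma>" "z \<in> g ` csupp \<gamma>" for y z
  proof -
    from that obtain y' z' where "y = g y'" "z = g z'" "y' \<in> csupp \<gamma>" "z' \<in> csupp \<gamma>" by (elim imageE) blast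
    moreover from this obtain n where "(\<gamma> ^^ n) y' = z'"
      using cycles_atD(7)[OF assms(2)] unfolding is_fcycle_def by blast
    ultimately show ?thesis using conj_by_funpow[OF assms(1)] by metis
  qed
  then show ?thesis
    using assms(1) cycles_atD[OF assms(2)]
      card_image[OF inj_on_subset[OF bij_is_inj[OF assms(1)], of "csupp \<gamma>"]]
    unfolding cycles_at_def is_fcycle_def
    by (simp add: bij_conj_by csupp_conj_by[OF assms(1)])
qed

lemma cweight_conj_by:
  assumes "bij g" "\<And>x y. V (g x - g y) = V (x - y)"
  shows "cweight V \<alpha> (conj_by g \<sigma>) = cweight V \<alpha> \<sigma>"
proof -
  have "(\<Sum>x\<in>g ` csupp \<sigma>. V (conj_by g \<sigma> x - x)) = (\<Sum>x\<in>csupp \<sigma>. V (\<sigma> x - x))"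
    by (subst sum.reindex) (auto simp: assms conj_by_apply inj_on_subset[OF bij_is_inj])
  then show ?thesis by (simp add: cweight_def csupp_conj_by[OF assms(1)])
qed

lemma bij_tau: "bij (tau u)"
  unfolding tau_def by (rule bij_betw_byWitness[where f'="\<lambda>x. x - u"]) auto

lemma inv_tau: "inv (tau u) = tau (- u)"
  by (rule inv_equality) (auto simp: tau_def)

lemma shift_eq_conj_by: "shift u = conj_by (tau u)"
  by (rule ext) (simp add: shift_def conj_by_def inv_tau)

section \<open>Partition functions of the gas of cycles\<close>

locale cycle_gas =
  fixes V :: "('d::finite) zd \<Rightarrow> real" and \<alpha> :: real
  assumes V_zero: "V 0 = 0" and V_nonneg: "V x \<ge> 0"
begin

abbreviation W :: "('d zd \<Rightarrow> 'd zd) \<Rightarrow> real" where "W \<equiv> cweight V \<alpha>"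

definition Z :: "'d zd set \<Rightarrow> real" where
  "Z \<Lambda> = (\<Sum>\<sigma> | \<sigma> permutes \<Lambda>. W \<sigma>)"

text \<open>For F inside \<Lambda> this is the probability under the Gibbs measure on \<Lambda> that
  every site of F is fixed. All finite-volume probabilities needed below are a weight times such a
  ratio.\<close>

definition Q :: "'d zd set \<Rightarrow> 'd zd set \<Rightarrow> real" where
  "Q \<Lambda> F = Z (\<Lambda> - F) / Z \<Lambda>"

lemma W_pos: "0 < W \<sigma>"
  by (simp add: cweight_def)

lemma W_id: "W id = 1"
  by (simp add: cweight_def csupp_def)

text \<open>Fixed points cost no energy because V vanishes at 0, so the weight of a permutation does
  not depend on the volume in which it is viewed.\<close>

lemma W_eq_exp_Ham:
  assumes "finite \<Lambda>" "csupp \<sigma> \<subseteq> \<Lambda>"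
  shows "W \<sigma> = exp (- \<alpha> * Ham V \<Lambda> \<sigma>)"
proof -
  have "(\<Sum>x\<in>csupp \<sigma>. V (\<sigma> x - x)) = (\<Sum>x\<in>\<Lambda>. V (\<sigma> x - x))"
    using assms V_zero by (intro sum.mono_neutral_left) (auto simp: csupp_def)
  then show ?thesis by (simp add: cweight_def Ham_def)
qed

lemma W_comp_disjoint:
  assumes "finite \<Lambda>" "F \<subseteq> \<Lambda>" "\<tau> permutes \<Lambda> - F" "\<pi> permutes F"
  shows "W (\<tau> \<circ> \<pi>) = W \<tau> * W \<pi>"
proof -
  have perm: "\<tau> \<circ> \<pi> permutes \<Lambda>"
    using assms by (intro permutes_compose) (auto intro: permutes_subset)
  have split: "Ham V \<Lambda> s = Ham V F s + Ham V (\<Lambda> - F) s" for s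
    using assms(1,2) unfolding Ham_def by (subst sum.subset_diff[of F]) auto
  have "Ham V F (\<tau> \<circ> \<pi>) = Ham V F \<pi>"
    unfolding Ham_def using assms(3,4) permutes_in_image[OF assms(4)] permutes_not_in[OF assms(3)]
    by (intro sum.cong) auto
  moreover have "Ham V (\<Lambda> - F) (\<tau> \<circ> \<pi>) = Ham V (\<Lambda> - F) \<tau>"
    unfolding Ham_def using permutes_not_in[OF assms(4)] by (intro sum.cong) auto
  moreover have "W \<tau> = exp (- \<alpha> * Ham V (\<Lambda> - F) \<tau>)" "W \<pi> = exp (- \<alpha> * Ham V F \<pi>)"
    using assms by (intro W_eq_exp_Ham csupp_subset_permutes; simp add: finite_subset[OF assms(2)])+
  moreover have "W (\<tau> \<circ> \<pi>) = exp (- \<alpha> * Ham V \<Lambda> (\<tau> \<circ> \<pi>))"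
    using perm assms by (intro W_eq_exp_Ham csupp_subset_permutes)
  ultimately show ?thesis
    by (simp add: split exp_add[symmetric] algebra_simps)
qed

lemma Z_ge_1: "finite \<Lambda> \<Longrightarrow> 1 \<le> Z \<Lambda>"
proof -
  assume "finite \<Lambda>"
  then have "sum W {id} \<le> Z \<Lambda>"
    unfolding Z_def
    by (intro sum_mono2) (auto simp: finite_permutations permutes_id less_imp_le[OF W_pos])
  then show ?thesis by (simp add: W_id)
qed

lemma Z_pos: "finite \<Lambda> \<Longrightarrow> 0 < Z \<Lambda>"
  using Z_ge_1 by fastforce

lemma Z_mono: "finite \<Lambda> \<Longrightarrow> A \<subseteq> \<Lambda> \<Longrightarrow> Z A \<le> Z \<Lambda>"
  unfolding Z_def
  by (intro sum_mono2) (auto simp: finite_permutations less_imp_le[OF W_pos] intro: permutes_subset)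

lemma Q_pos: "finite \<Lambda> \<Longrightarrow> 0 < Q \<Lambda> F"
  by (simp add: Q_def Z_pos)

lemma Q_le_1: "finite \<Lambda> \<Longrightarrow> Q \<Lambda> F \<le> 1"
  by (simp add: Q_def Z_pos Z_mono)

text \<open>Chain rule: the factor \<open>Z (\<Lambda> - A)\<close> cancels. It reduces every ratio
  to single-site ratios in decreasing volumes.\<close>

lemma Q_Un: "finite \<Lambda> \<Longrightarrow> Q \<Lambda> (A \<union> B) = Q \<Lambda> A * Q (\<Lambda> - A) B"
  using Z_pos[of "\<Lambda> - A"] by (simp add: Q_def Diff_eq Int_ac)

text \<open>Agreement with \<pi> makes F invariant, so such a \<sigma> splits uniquely as \<tau>
  composed with \<pi>, with \<tau> permuting the complement of F, and the weights multiply.\<close>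

lemma sum_W_extending:
  assumes "finite \<Lambda>" "F \<subseteq> \<Lambda>" "\<pi> permutes F"
  shows "(\<Sum>\<sigma> | \<sigma> permutes \<Lambda> \<and> (\<forall>x\<in>F. \<sigma> x = \<pi> x). W \<sigma>) = W \<pi> * Z (\<Lambda> - F)"
proof -
  have "(\<Sum>\<sigma> | \<sigma> permutes \<Lambda> \<and> (\<forall>x\<in>F. \<sigma> x = \<pi> x). W \<sigma>) = (\<Sum>\<tau> | \<tau> permutes \<Lambda> - F. W \<pi> * W \<tau>)"
  proof (rule sum.reindex_bij_witness[of _ "\<lambda>\<tau>. \<tau> \<circ> \<pi>" "\<lambda>\<sigma>. \<sigma> \<circ> inv \<pi>"], goal_cases)
    case (1 \<sigma>)
    then show ?case
      using permutes_inv_o(2)[OF assms(3)] by (simp add: comp_assoc)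
  next
    case (2 \<sigma>)
    have "\<sigma> \<circ> inv \<pi> permutes \<Lambda>"
      using 2 permutes_subset[OF permutes_inv[OF assms(3)] assms(2)] by (intro permutes_compose) auto
    moreover have "(\<sigma> \<circ> inv \<pi>) x = x" if "x \<in> F" for x
      using 2 assms that permutes_in_image[OF permutes_inv[OF assms(3)], of x]
      by (auto simp: permutes_inverses)
    ultimately show ?case by (auto intro: permutes_superset)
  next
    case (3 \<tau>)
    then show ?case
      using permutes_inv_o(1)[OF assms(3)] by (simp add: comp_assoc)
  next
    case (4 \<tau>)
    have "\<tau> \<circ> \<pi> permutes \<Lambda>"
      using 4 assms by (intro permutes_compose) (auto intro: permutes_subset)
    moreover have "(\<tau> \<circ> \<pi>) x = \<pi> x" if "x \<in> F" for x
      using permutes_in_image[OF assms(3), of x] that 4 by (auto simp: permutes_def)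
    ultimately show ?case by simp
  next
    case (5 \<sigma>)
    have eq: "\<sigma> = (\<sigma> \<circ> inv \<pi>) \<circ> \<pi>"
      using permutes_inv_o(2)[OF assms(3)] by (simp add: comp_assoc)
    have "\<sigma> \<circ> inv \<pi> permutes \<Lambda>"
      using 5 permutes_subset[OF permutes_inv[OF assms(3)] assms(2)] by (intro permutes_compose) auto
    moreover have "(\<sigma> \<circ> inv \<pi>) x = x" if "x \<in> F" for x
      using 5 assms that permutes_in_image[OF permutes_inv[OF assms(3)], of x]
      by (auto simp: permutes_inverses)
    ultimately have "\<sigma> \<circ> inv \<pi> permutes \<Lambda> - F" by (auto intro: permutes_superset)
    then show ?case using W_comp_disjoint[OF assms(1,2) _ assms(3)] eq
      by (metis mult.commute)
  qed
  then show ?thesis by (simp add: Z_def sum_distrib_left)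
qed

text \<open>The permutations are grouped by their cycle at x; each group is an agreement event with
  free remainder off that cycle.\<close>

lemma Z_recurrence:
  assumes "finite \<Lambda>" "x \<in> \<Lambda>"
  shows "Z \<Lambda> = Z (\<Lambda> - {x}) + (\<Sum>\<gamma> | \<gamma> \<in> cycles_at x \<and> csupp \<gamma> \<subseteq> \<Lambda>. W \<gamma> * Z (\<Lambda> - csupp \<gamma>))"
proof -
  let ?S = "{\<sigma>. \<sigma> permutes \<Lambda>}" and ?C = "{\<gamma>. \<gamma> \<in> cycles_at x \<and> csupp \<gamma> \<subseteq> \<Lambda>}"
  have finS: "finite ?S" using assms by (simp add: finite_permutations)
  have perm: "permutation \<sigma>" if "\<sigma> permutes \<Lambda>" for \<sigma>
    using that assms permutes_permutation by blast
  have C_sub: "?C \<subseteq> ?S"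
    using cycles_atD(4) permutes_subset by blast
  have finC: "finite ?C" using finite_subset[OF C_sub finS] .
  have maps: "(\<lambda>\<sigma>. cyc \<sigma> x) ` ?S \<subseteq> insert id ?C"
  proof (rule image_subsetI)
    fix \<sigma> assume "\<sigma> \<in> ?S"
    then have s: "\<sigma> permutes \<Lambda>" by simp
    show "cyc \<sigma> x \<in> insert id ?C"
    proof (cases "\<sigma> x = x")
      case True
      then show ?thesis using cyc_eq_id_iff[OF perm[OF s]] by simp
    next
      case False
      then show ?thesis
        using csupp_cyc[OF perm[OF s]] permutes_orbit_subset[OF s assms(2)]
          cyc_in_cycles_at[OF perm[OF s]] by simp
    qed
  qed
  have "Z \<Lambda> = (\<Sum>\<gamma>\<in>insert id ?C. \<Sum>\<sigma> | \<sigma> \<in> ?S \<and> cyc \<sigma> x = \<gamma>. W \<sigma>)"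
    unfolding Z_def by (rule sum.group[symmetric]) (use finS finC maps in auto)
  also have "\<dots> = (\<Sum>\<sigma> | \<sigma> \<in> ?S \<and> cyc \<sigma> x = id. W \<sigma>) + (\<Sum>\<gamma>\<in>?C. \<Sum>\<sigma> | \<sigma> \<in> ?S \<and> cyc \<sigma> x = \<gamma>. W \<sigma>)"
    using finC cycles_atD(3)[of id x] by (subst sum.insert) (auto simp: csupp_def)
  also have "{\<sigma>. \<sigma> \<in> ?S \<and> cyc \<sigma> x = id} = {\<sigma>. \<sigma> permutes \<Lambda> \<and> (\<forall>y\<in>{x}. \<sigma> y = id y)}"
    using perm by (auto simp: cyc_eq_id_iff)
  also have "sum W \<dots> = W id * Z (\<Lambda> - {x})"
    using assms by (intro sum_W_extending) (auto simp: permutes_id)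
  also have "(\<Sum>\<gamma>\<in>?C. \<Sum>\<sigma> | \<sigma> \<in> ?S \<and> cyc \<sigma> x = \<gamma>. W \<sigma>) = (\<Sum>\<gamma>\<in>?C. W \<gamma> * Z (\<Lambda> - csupp \<gamma>))"
  proof (rule sum.cong)
    fix \<gamma> assume g: "\<gamma> \<in> ?C"
    have "{\<sigma>. \<sigma> \<in> ?S \<and> cyc \<sigma> x = \<gamma>} = {\<sigma>. \<sigma> permutes \<Lambda> \<and> (\<forall>y\<in>csupp \<gamma>. \<sigma> y = \<gamma> y)}"
      using perm g cyc_eq_fcycle_iff[of _ \<gamma> x] by blast
    then show "(\<Sum>\<sigma> | \<sigma> \<in> ?S \<and> cyc \<sigma> x = \<gamma>. W \<sigma>) = W \<gamma> * Z (\<Lambda> - csupp \<gamma>)"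
      using sum_W_extending[OF assms(1), of "csupp \<gamma>" \<gamma>] g cycles_atD(4) by auto
  qed simp
  finally show ?thesis unfolding W_id by simp
qed

lemma Z_image:
  assumes "bij g" "\<And>x y. V (g x - g y) = V (x - y)"
  shows "Z (g ` \<Lambda>) = Z \<Lambda>"
  unfolding Z_def
proof (rule sum.reindex_bij_witness[of _ "conj_by g" "conj_by (inv g)"], goal_cases)
  case (2 \<sigma>)
  then show ?case
    using conj_by_permutes[OF bij_imp_bij_inv[OF assms(1)], of \<sigma> "g ` \<Lambda>"] assms(1)
    by (simp add: image_comp bij_is_inj)
next
  case (5 \<sigma>)
  have "W \<sigma> = W (conj_by g (conj_by (inv g) \<sigma>))" by (simp add: inv_conj_by assms)
  then show ?case using cweight_conj_by[OF assms] by simp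
qed (use assms in \<open>auto simp: conj_by_permutes conj_by_inv inv_conj_by\<close>)

lemma Q_image:
  assumes "bij g" "\<And>x y. V (g x - g y) = V (x - y)"
  shows "Q (g ` \<Lambda>) (g ` F) = Q \<Lambda> F"
  by (simp add: Q_def Z_image[OF assms] image_set_diff[OF bij_is_inj[OF assms(1)], symmetric])

end

section \<open>Uniform continuity in the volume below the critical value\<close>

lemma abs_mult_diff_le:
  fixes a b c d :: real
  assumes "\<bar>a\<bar> \<le> 1" "\<bar>d\<bar> \<le> 1"
  shows "\<bar>a * b - c * d\<bar> \<le> \<bar>a - c\<bar> + \<bar>b - d\<bar>"
proof -
  have "a * b - c * d = a * (b - d) + d * (a - c)" by (simp add: algebra_simps)
  also have "\<bar>\<dots>\<bar> \<le> \<bar>a\<bar> * \<bar>b - d\<bar> + \<bar>d\<bar> * \<bar>a - c\<bar>" by (metis abs_mult abs_triangle_ineq)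
  also have "\<dots> \<le> 1 * \<bar>b - d\<bar> + 1 * \<bar>a - c\<bar>" by (intro add_mono mult_right_mono assms) auto
  finally show ?thesis by simp
qed

lemma inverse_one_plus_diff_le:
  fixes s t :: real
  assumes "0 \<le> s" "0 \<le> t"
  shows "\<bar>1 / (1 + s) - 1 / (1 + t)\<bar> \<le> \<bar>s - t\<bar>"
proof -
  have "1 / (1 + s) - 1 / (1 + t) = (t - s) / ((1 + s) * (1 + t))"
    using assms by (simp add: field_simps)
  moreover have "1 \<le> (1 + s) * (1 + t)" using assms by (simp add: algebra_simps)
  then have "\<bar>t - s\<bar> / ((1 + s) * (1 + t)) \<le> \<bar>t - s\<bar> / 1"
    by (intro divide_left_mono) auto
  ultimately show ?thesis using assms by (simp add: abs_minus_commute)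
qed

locale subcritical = cycle_gas +
  assumes beta_less_1: "beta V \<alpha> < 1"
begin

definition b :: real where "b = enn2real (beta V \<alpha>)"

lemma beta_eq: "beta V \<alpha> = ennreal b"
  unfolding b_def using order_less_trans[OF beta_less_1 ennreal_one_less_top]
  by (subst ennreal_enn2real) auto

lemma b_nonneg: "0 \<le> b"
  by (simp add: b_def)

lemma b_less_1: "b < 1"
  using beta_less_1 b_nonneg by (simp add: beta_eq ennreal_less_one_iff)

text \<open>\<open>beta\<close> is anchored at the origin; translating the cycles by -x preserves
  lengths and weights, and a finite sum is below the unordered infinite sum.\<close>

lemma sum_cycles_le_b:
  assumes "finite \<Gamma>" "\<Gamma> \<subseteq> cycles_at x"
  shows "(\<Sum>\<gamma>\<in>\<Gamma>. card (csupp \<gamma>) * W \<gamma>) \<le> b"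
proof -
  let ?s = "conj_by (tau (- x))" and ?f = "\<lambda>\<gamma>. card (csupp \<gamma>) * W \<gamma>"
  have V: "V (tau u y - tau u z) = V (y - z)" for u y z by (simp add: tau_def)
  have inj: "inj_on ?s \<Gamma>"
    by (rule inj_on_inverseI[where g="conj_by (inv (tau (- x)))"]) (simp add: conj_by_inv bij_tau)
  have sub: "?s ` \<Gamma> \<subseteq> {\<gamma>. is_fcycle \<gamma> \<and> 0 \<in> csupp \<gamma>}"
    using assms(2) conj_by_cycles_at[OF bij_tau, of _ x "- x"] by (force simp: tau_def cycles_at_def)
  have "sum ?f \<Gamma> = sum ?f (?s ` \<Gamma>)"
    by (subst sum.reindex[OF inj])
      (auto simp: cweight_conj_by bij_tau V csupp_conj_by card_image inj_on_subset[OF bij_is_inj])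
  moreover have "ennreal (sum ?f (?s ` \<Gamma>)) \<le> beta V \<alpha>"
  proof -
    have "ennreal (sum ?f (?s ` \<Gamma>)) = (\<Sum>\<gamma>\<in>?s ` \<Gamma>. ennreal (?f \<gamma>))"
      by (subst sum_ennreal) (auto simp: less_imp_le[OF W_pos])
    also have "\<dots> \<le> beta V \<alpha>"
      unfolding beta_def using assms(1) sub
      by (subst nonneg_infsum_complete) (auto intro!: SUP_upper)
    finally show ?thesis .
  qed
  ultimately show ?thesis using b_nonneg by (simp add: beta_eq)
qed

lemma sum_W_cycles_le_b:
  assumes "finite \<Gamma>" "\<Gamma> \<subseteq> cycles_at x"
  shows "sum W \<Gamma> \<le> b"
proof -
  have "sum W \<Gamma> \<le> (\<Sum>\<gamma>\<in>\<Gamma>. card (csupp \<gamma>) * W \<gamma>)"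
  proof (rule sum_mono)
    fix \<gamma> assume "\<gamma> \<in> \<Gamma>"
    then have "1 \<le> real (card (csupp \<gamma>))" using assms(2) cycles_atD(5) by fastforce
    then show "W \<gamma> \<le> card (csupp \<gamma>) * W \<gamma>" using W_pos[of \<gamma>] by simp
  qed
  then show ?thesis using sum_cycles_le_b[OF assms] by simp
qed

text \<open>A finite family almost attaining the supremum of all finite sums leaves at most
  \<epsilon> for any family disjoint from it.\<close>

lemma sum_W_cycles_tail:
  assumes "0 < \<epsilon>"
  obtains \<Gamma>0 where "finite \<Gamma>0" "\<Gamma>0 \<subseteq> cycles_at x"
    "\<And>\<Gamma>. finite \<Gamma> \<Longrightarrow> \<Gamma> \<subseteq> cycles_at x \<Longrightarrow> \<Gamma> \<inter> \<Gamma>0 = {} \<Longrightarrow> sum W \<Gamma> \<le> \<epsilon>"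
proof -
  let ?A = "{sum W \<Gamma> | \<Gamma>. finite \<Gamma> \<and> \<Gamma> \<subseteq> cycles_at x}"
  have bdd: "bdd_above ?A" using sum_W_cycles_le_b[of _ x] by (intro bdd_aboveI[of _ b]) auto
  have "Sup ?A - \<epsilon> < Sup ?A" using assms by simp
  moreover have "?A \<noteq> {}" by auto
  ultimately obtain a where "a \<in> ?A" "Sup ?A - \<epsilon> < a"
    using less_cSup_iff[OF _ bdd] by blast
  then obtain \<Gamma>0 where \<Gamma>0: "finite \<Gamma>0" "\<Gamma>0 \<subseteq> cycles_at x" "Sup ?A - \<epsilon> < sum W \<Gamma>0"
    by blast
  show thesis
  proof (rule that[OF \<Gamma>0(1,2)])
    fix \<Gamma> assume G: "finite \<Gamma>" "\<Gamma> \<subseteq> cycles_at x" "\<Gamma> \<inter> \<Gamma>0 = {}"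
    have "sum W (\<Gamma> \<union> \<Gamma>0) \<in> ?A" using G \<Gamma>0 by blast
    then have "sum W (\<Gamma> \<union> \<Gamma>0) \<le> Sup ?A" by (intro cSup_upper bdd)
    then show "sum W \<Gamma> \<le> \<epsilon>" using \<Gamma>0(3) sum.union_disjoint[OF G(1) \<Gamma>0(1) G(3), of W] by simp
  qed
qed

text \<open>A uniform modulus of continuity of \<Lambda> |-> \<open>Q \<Lambda> {x}\<close>: K acts
  as an observation window, and both volumes range over all finite sets. In the iteration c is
  common to all sites while K may depend on the site.\<close>

definition close :: "real \<Rightarrow> 'a zd \<Rightarrow> 'a zd set \<Rightarrow> bool" where
  "close c x K \<longleftrightarrow> (\<forall>\<Lambda> \<Lambda>'. finite \<Lambda> \<longrightarrow> finite \<Lambda>' \<longrightarrow> \<Lambda> \<inter> K = \<Lambda>' \<inter> K \<longrightarrow> \<bar>Q \<Lambda> {x} - Q \<Lambda>' {x}\<bar> \<le> c)"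

lemma closeD: "close c x K \<Longrightarrow> finite \<Lambda> \<Longrightarrow> finite \<Lambda>' \<Longrightarrow> \<Lambda> \<inter> K = \<Lambda>' \<inter> K \<Longrightarrow> \<bar>Q \<Lambda> {x} - Q \<Lambda>' {x}\<bar> \<le> c"
  by (auto simp: close_def)

lemma close_mono: "close c x K \<Longrightarrow> K \<subseteq> K' \<Longrightarrow> close c x K'"
  unfolding close_def
proof (intro allI impI)
  fix \<Lambda> \<Lambda>'
  assume *: "\<forall>\<Lambda> \<Lambda>'. finite \<Lambda> \<longrightarrow> finite \<Lambda>' \<longrightarrow> \<Lambda> \<inter> K = \<Lambda>' \<inter> K \<longrightarrow> \<bar>Q \<Lambda> {x} - Q \<Lambda>' {x}\<bar> \<le> c"
    and "K \<subseteq> K'" "\<Lambda> \<inter> K' = \<Lambda>' \<inter> K'" "finite \<Lambda>" "finite \<Lambda>'"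
  then have "\<Lambda> \<inter> K = \<Lambda>' \<inter> K" by blast
  with * \<open>finite \<Lambda>\<close> \<open>finite \<Lambda>'\<close> show "\<bar>Q \<Lambda> {x} - Q \<Lambda>' {x}\<bar> \<le> c" by simp
qed

text \<open>The chain rule removes one site at a time; deleting it from both volumes keeps them
  equal on K, so each site costs at most c.\<close>

lemma Q_close:
  fixes c :: real
  assumes "finite F" "\<And>x. x \<in> F \<Longrightarrow> close c x K" "finite \<Lambda>" "finite \<Lambda>'" "\<Lambda> \<inter> K = \<Lambda>' \<inter> K"
  shows "\<bar>Q \<Lambda> F - Q \<Lambda>' F\<bar> \<le> card F * c"
  using assms
proof (induction F arbitrary: \<Lambda> \<Lambda>' rule: finite_induct)
  case empty
  then show ?case using Z_pos[of \<Lambda>] Z_pos[of \<Lambda>'] by (simp add: Q_def)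
next
  case (insert x F)
  have eq: "Q L (insert x F) = Q L {x} * Q (L - {x}) F" if "finite L" for L
    using Q_Un[OF that, of "{x}" F] by simp
  have bnd: "\<bar>Q L A\<bar> \<le> 1" if "finite L" for L A
    using Q_pos[OF that, of A] Q_le_1[OF that, of A] by simp
  have "\<bar>Q \<Lambda> (insert x F) - Q \<Lambda>' (insert x F)\<bar> \<le> \<bar>Q \<Lambda> {x} - Q \<Lambda>' {x}\<bar> + \<bar>Q (\<Lambda> - {x}) F - Q (\<Lambda>' - {x}) F\<bar>"
    using insert.prems by (subst (1 2) eq) (auto intro!: abs_mult_diff_le bnd)
  also have "\<dots> \<le> c + card F * c"
    using insert.prems by (intro add_mono closeD[of c x K] insert.IH) auto
  finally show ?case using insert.hyps by (simp add: algebra_simps)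
qed

text \<open>For a cycle that fits, this is
  \<open>Z (\<Lambda> - csupp \<gamma>) / Z (\<Lambda> - {x})\<close>. The value 0 for a cycle that
  does not fit lets the recursions of two volumes be summed over one common index set.\<close>

definition cyc_fraction :: "'a zd \<Rightarrow> 'a zd set \<Rightarrow> ('a zd \<Rightarrow> 'a zd) \<Rightarrow> real" where
  "cyc_fraction x \<Lambda> \<gamma> = (if csupp \<gamma> \<subseteq> \<Lambda> then Q (\<Lambda> - {x}) (csupp \<gamma> - {x}) else 0)"

lemma finite_cycles_within: "finite \<Lambda> \<Longrightarrow> finite {\<gamma> \<in> cycles_at x. csupp \<gamma> \<subseteq> \<Lambda>}"
  by (rule finite_subset[OF _ finite_permutations[of \<Lambda>]]) (use cycles_atD(4) permutes_subset in blast)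

text \<open>The recurrence divided by \<open>Z (\<Lambda> - {x})\<close>. The index set may be any
  finite enlargement, so that two volumes can share it.\<close>

lemma Q_single:
  assumes "finite \<Lambda>" "x \<in> \<Lambda>" "finite \<Gamma>" "\<Gamma> \<subseteq> cycles_at x" "{\<gamma> \<in> cycles_at x. csupp \<gamma> \<subseteq> \<Lambda>} \<subseteq> \<Gamma>"
  shows "Q \<Lambda> {x} = 1 / (1 + (\<Sum>\<gamma>\<in>\<Gamma>. W \<gamma> * cyc_fraction x \<Lambda> \<gamma>))"
proof -
  let ?C = "{\<gamma> \<in> cycles_at x. csupp \<gamma> \<subseteq> \<Lambda>}"
  have pos: "0 < Z (\<Lambda> - {x})" using assms(1) by (simp add: Z_pos)
  have "(\<Sum>\<gamma>\<in>\<Gamma>. W \<gamma> * cyc_fraction x \<Lambda> \<gamma>) = (\<Sum>\<gamma>\<in>?C. W \<gamma> * cyc_fraction x \<Lambda> \<gamma>)"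
    using assms by (intro sum.mono_neutral_right) (auto simp: cyc_fraction_def)
  also have "\<dots> = (\<Sum>\<gamma>\<in>?C. W \<gamma> * Z (\<Lambda> - csupp \<gamma>)) / Z (\<Lambda> - {x})"
    unfolding sum_divide_distrib
  proof (rule sum.cong[OF refl])
    fix \<gamma> assume g: "\<gamma> \<in> ?C"
    then have "\<Lambda> - {x} - (csupp \<gamma> - {x}) = \<Lambda> - csupp \<gamma>" using cycles_atD(3)[of \<gamma> x] by auto
    then show "W \<gamma> * cyc_fraction x \<Lambda> \<gamma> = W \<gamma> * Z (\<Lambda> - csupp \<gamma>) / Z (\<Lambda> - {x})"
      using g by (simp add: cyc_fraction_def Q_def)
  qed
  also have "1 + \<dots> = Z \<Lambda> / Z (\<Lambda> - {x})"
    using Z_recurrence[OF assms(1,2)] pos by (simp add: field_simps)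
  finally show ?thesis by (simp add: Q_def)
qed

text \<open>Removing a site and revealing its cycle expresses \<open>Q \<Lambda> {x}\<close> through ratios in smaller volumes;
  a cycle of length \<open>k\<close> contributes \<open>k - 1\<close> of them, so \<open>beta < 1\<close> makes the recursion a contraction.\<close>

lemma close_step:
  assumes "0 \<le> c" "\<And>y. \<exists>K. finite K \<and> close c y K" "0 < \<epsilon>"
  shows "\<exists>K. finite K \<and> close (b * c + \<epsilon>) x K"
proof -
  from assms(2) obtain N where N: "\<And>y. finite (N y)" "\<And>y. close c y (N y)" by metis
  from sum_W_cycles_tail[OF assms(3)] obtain \<Gamma>0 where \<Gamma>0: "finite \<Gamma>0" "\<Gamma>0 \<subseteq> cycles_at x"
    "\<And>\<Gamma>. finite \<Gamma> \<Longrightarrow> \<Gamma> \<subseteq> cycles_at x \<Longrightarrow> \<Gamma> \<inter> \<Gamma>0 = {} \<Longrightarrow> sum W \<Gamma> \<le> \<epsilon>" by metis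
  \<comment> \<open>Agreement on K settles three things: whether x is present, whether each cycle of
    \<open>\<Gamma>0\<close> fits, and the ratios at its sites up to c.\<close>
  define K where "K = {x} \<union> (\<Union>\<gamma>\<in>\<Gamma>0. csupp \<gamma> \<union> (\<Union>y\<in>csupp \<gamma>. N y))"
  have "finite K" unfolding K_def using \<Gamma>0(1,2) N(1) cycles_atD(2) by (auto intro!: finite_UN_I)
  moreover have "close (b * c + \<epsilon>) x K"
    unfolding close_def
  proof (intro allI impI)
    fix \<Lambda> \<Lambda>' assume fin: "finite \<Lambda>" "finite \<Lambda>'" and agree: "\<Lambda> \<inter> K = \<Lambda>' \<inter> K"
    have x_iff: "x \<in> \<Lambda> \<longleftrightarrow> x \<in> \<Lambda>'" using agree by (auto simp: K_def)
    show "\<bar>Q \<Lambda> {x} - Q \<Lambda>' {x}\<bar> \<le> b * c + \<epsilon>"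
    proof (cases "x \<in> \<Lambda>")
      case False
      then have "Q \<Lambda> {x} = 1" "Q \<Lambda>' {x} = 1"
        using x_iff fin Z_pos[of \<Lambda>] Z_pos[of \<Lambda>'] by (simp_all add: Q_def)
      then show ?thesis using assms b_nonneg by simp
    next
      case True
      let ?\<Gamma> = "{\<gamma> \<in> cycles_at x. csupp \<gamma> \<subseteq> \<Lambda>} \<union> {\<gamma> \<in> cycles_at x. csupp \<gamma> \<subseteq> \<Lambda>'}"
      let ?d = "\<lambda>\<gamma>. \<bar>cyc_fraction x \<Lambda> \<gamma> - cyc_fraction x \<Lambda>' \<gamma>\<bar>"
      have fin\<Gamma>: "finite ?\<Gamma>" using fin by (simp add: finite_cycles_within)
      have frac: "0 \<le> cyc_fraction x L \<gamma>" "cyc_fraction x L \<gamma> \<le> 1" if "finite L" for L \<gamma>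
        using that by (auto simp: cyc_fraction_def Q_le_1 less_imp_le[OF Q_pos])
      have d1: "?d \<gamma> \<le> 1" for \<gamma> using frac[OF fin(1), of \<gamma>] frac[OF fin(2), of \<gamma>] by auto
      have dc: "?d \<gamma> \<le> card (csupp \<gamma>) * c" if "\<gamma> \<in> \<Gamma>0" for \<gamma>
      proof -
        have "csupp \<gamma> \<subseteq> K" using that by (auto simp: K_def)
        then have sub_iff: "csupp \<gamma> \<subseteq> \<Lambda> \<longleftrightarrow> csupp \<gamma> \<subseteq> \<Lambda>'" using agree by blast
        have "\<bar>Q (\<Lambda> - {x}) (csupp \<gamma> - {x}) - Q (\<Lambda>' - {x}) (csupp \<gamma> - {x})\<bar> \<le> card (csupp \<gamma> - {x}) * c"
        proof (rule Q_close)
          show "finite (csupp \<gamma> - {x})" using that \<Gamma>0(2) cycles_atD(2) by blast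
          show "close c y K" if "y \<in> csupp \<gamma> - {x}" for y
            by (rule close_mono[OF N(2)[of y]]) (use that \<open>\<gamma> \<in> \<Gamma>0\<close> in \<open>auto simp: K_def\<close>)
        qed (use fin agree in auto)
        \<comment> \<open>Rounding the k - 1 sites up to k produces the factor
          \<open>card (csupp \<gamma>)\<close> that appears in \<open>beta\<close>.\<close>
        also have "\<dots> \<le> card (csupp \<gamma>) * c"
          using assms(1) by (intro mult_right_mono) (auto simp: card_Diff1_le)
        finally show ?thesis using sub_iff assms(1) by (auto simp: cyc_fraction_def)
      qed
      have "\<bar>Q \<Lambda> {x} - Q \<Lambda>' {x}\<bar> \<le> \<bar>(\<Sum>\<gamma>\<in>?\<Gamma>. W \<gamma> * cyc_fraction x \<Lambda> \<gamma>) - (\<Sum>\<gamma>\<in>?\<Gamma>. W \<gamma> * cyc_fraction x \<Lambda>' \<gamma>)\<bar>"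
        using fin True x_iff fin\<Gamma> Q_single[OF fin(1), of x ?\<Gamma>] Q_single[OF fin(2), of x ?\<Gamma>]
          inverse_one_plus_diff_le[OF sum_nonneg sum_nonneg, of ?\<Gamma> "\<lambda>\<gamma>. W \<gamma> * cyc_fraction x \<Lambda> \<gamma>"
            ?\<Gamma> "\<lambda>\<gamma>. W \<gamma> * cyc_fraction x \<Lambda>' \<gamma>"] frac(1)[OF fin(1)] frac(1)[OF fin(2)] less_imp_le[OF W_pos]
        by auto
      also have "\<dots> = \<bar>\<Sum>\<gamma>\<in>?\<Gamma>. W \<gamma> * (cyc_fraction x \<Lambda> \<gamma> - cyc_fraction x \<Lambda>' \<gamma>)\<bar>"
        by (simp add: sum_subtractf[symmetric] right_diff_distrib)
      also have "\<dots> \<le> (\<Sum>\<gamma>\<in>?\<Gamma>. W \<gamma> * ?d \<gamma>)"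
        by (rule order_trans[OF sum_abs]) (simp add: abs_mult less_imp_le[OF W_pos])
      \<comment> \<open>Cycles in \<open>\<Gamma>0\<close> contract the error by b; for the others
        the trivial bound 1 on the difference suffices, as their total weight is at most
        \<epsilon>.\<close>
      also have "\<dots> = (\<Sum>\<gamma>\<in>?\<Gamma> \<inter> \<Gamma>0. W \<gamma> * ?d \<gamma>) + (\<Sum>\<gamma>\<in>?\<Gamma> - \<Gamma>0. W \<gamma> * ?d \<gamma>)"
        using fin\<Gamma> by (subst sum.Int_Diff[of _ _ \<Gamma>0]) auto
      also have "(\<Sum>\<gamma>\<in>?\<Gamma> \<inter> \<Gamma>0. W \<gamma> * ?d \<gamma>) \<le> (\<Sum>\<gamma>\<in>?\<Gamma> \<inter> \<Gamma>0. W \<gamma> * (card (csupp \<gamma>) * c))"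
        by (intro sum_mono mult_left_mono dc) (auto simp: less_imp_le[OF W_pos])
      also have "\<dots> = (\<Sum>\<gamma>\<in>?\<Gamma> \<inter> \<Gamma>0. card (csupp \<gamma>) * W \<gamma>) * c"
        unfolding sum_distrib_right by (rule sum.cong) auto
      also have "\<dots> \<le> b * c"
        using fin\<Gamma> assms(1) by (intro mult_right_mono sum_cycles_le_b[of _ x]) auto
      also have "(\<Sum>\<gamma>\<in>?\<Gamma> - \<Gamma>0. W \<gamma> * ?d \<gamma>) \<le> (\<Sum>\<gamma>\<in>?\<Gamma> - \<Gamma>0. W \<gamma>)"
        by (intro sum_mono mult_left_le d1 less_imp_le[OF W_pos])
      also have "\<dots> \<le> \<epsilon>" using fin\<Gamma> by (intro \<Gamma>0(3)) auto
      finally show ?thesis by simp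
    qed
  qed
  ultimately show ?thesis by blast
qed

lemma close_exists:
  assumes "0 < \<epsilon>"
  shows "\<exists>K. finite K \<and> close \<epsilon> x K"
proof -
  \<comment> \<open>A rate strictly between b and 1: the slack \<theta> - b, times the current
    error, is the tail allowance \<epsilon> of each contraction step. The start is the trivial bound
    1 with an empty window.\<close>
  define \<theta> where "\<theta> = (1 + b) / 2"
  have \<theta>: "0 < \<theta>" "\<theta> < 1" "b < \<theta>" using b_less_1 b_nonneg by (auto simp: \<theta>_def)
  have "\<forall>x. \<exists>K. finite K \<and> close (\<theta> ^ n) x K" for n
  proof (induction n)
    case 0
    have "close 1 x {}" for x
      unfolding close_def
    proof (intro allI impI)
      fix \<Lambda> \<Lambda>' :: "'a zd set" assume "finite \<Lambda>" "finite \<Lambda>'"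
      then show "\<bar>Q \<Lambda> {x} - Q \<Lambda>' {x}\<bar> \<le> 1"
        using Q_pos[of \<Lambda> "{x}"] Q_le_1[of \<Lambda> "{x}"] Q_pos[of \<Lambda>' "{x}"] Q_le_1[of \<Lambda>' "{x}"] by auto
    qed
    then show ?case by auto
  next
    case (Suc n)
    have "\<exists>K. finite K \<and> close (b * \<theta> ^ n + (\<theta> - b) * \<theta> ^ n) x K" for x
      using \<theta> Suc by (intro close_step) auto
    then show ?case by (simp add: algebra_simps)
  qed
  moreover obtain n where "\<theta> ^ n < \<epsilon>" using real_arch_pow_inv[OF assms \<theta>(2)] by blast
  ultimately show ?thesis unfolding close_def by (meson less_imp_le order_trans)
qed

lemma Q_uniformly_continuous:
  assumes "finite F" "0 < \<epsilon>"
  obtains K where "finite K"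
    "\<And>\<Lambda> \<Lambda>'. finite \<Lambda> \<Longrightarrow> finite \<Lambda>' \<Longrightarrow> \<Lambda> \<inter> K = \<Lambda>' \<inter> K \<Longrightarrow> \<bar>Q \<Lambda> F - Q \<Lambda>' F\<bar> \<le> \<epsilon>"
proof -
  define c where "c = \<epsilon> / (card F + 1)"
  have c: "0 < c" using assms by (simp add: c_def)
  from close_exists[OF c] obtain N where N: "\<And>y. finite (N y)" "\<And>y. close c y (N y)" by metis
  show thesis
  proof (rule that[of "\<Union>y\<in>F. N y"])
    show "finite (\<Union>y\<in>F. N y)" using assms N by blast
    fix \<Lambda> \<Lambda>' assume *: "finite \<Lambda>" "finite \<Lambda>'" "\<Lambda> \<inter> (\<Union>y\<in>F. N y) = \<Lambda>' \<inter> (\<Union>y\<in>F. N y)"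
    have "\<bar>Q \<Lambda> F - Q \<Lambda>' F\<bar> \<le> card F * c"
      by (rule Q_close[OF assms(1) close_mono[OF N(2)] *]) auto
    also have "\<dots> \<le> \<epsilon>" using assms(2) by (simp add: c_def field_simps)
    finally show "\<bar>Q \<Lambda> F - Q \<Lambda>' F\<bar> \<le> \<epsilon>" .
  qed
qed

section \<open>Infinite-volume ratios\<close>

definition q :: "'a zd set \<Rightarrow> real" where
  "q F = Lim (finite_subsets_at_top UNIV) (\<lambda>\<Lambda>. Q \<Lambda> F)"

text \<open>Any two volumes containing the window K agree on it, so uniform continuity makes the net
  Cauchy.\<close>

lemma Q_tendsto_q:
  assumes "finite F"
  shows "((\<lambda>\<Lambda>. Q \<Lambda> F) \<longlongrightarrow> q F) (finite_subsets_at_top UNIV)"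
proof -
  have "cauchy_filter (filtermap (\<lambda>\<Lambda>. Q \<Lambda> F) (finite_subsets_at_top UNIV))"
    unfolding cauchy_filter_metric_filtermap
  proof (intro allI impI)
    fix e :: real assume "e > 0"
    then obtain K where K: "finite K"
      "\<And>\<Lambda> \<Lambda>'. finite \<Lambda> \<Longrightarrow> finite \<Lambda>' \<Longrightarrow> \<Lambda> \<inter> K = \<Lambda>' \<inter> K \<Longrightarrow> \<bar>Q \<Lambda> F - Q \<Lambda>' F\<bar> \<le> e / 2"
      using Q_uniformly_continuous[OF assms, of "e / 2"] by (metis half_gt_zero)
    have "dist (Q x F) (Q y F) < e" if "finite x \<and> K \<subseteq> x" "finite y \<and> K \<subseteq> y" for x y
      using K(2)[of x y] that \<open>e > 0\<close> by (auto simp: dist_real_def Int_absorb1)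
    moreover have "eventually (\<lambda>x. finite x \<and> K \<subseteq> x) (finite_subsets_at_top UNIV)"
      using K(1) by (auto simp: eventually_finite_subsets_at_top)
    ultimately show "\<exists>P. eventually P (finite_subsets_at_top UNIV) \<and>
      (\<forall>x y. P x \<and> P y \<longrightarrow> dist (Q x F) (Q y F) < e)" by blast
  qed
  moreover note complete_UNIV[where 'a=real]
  ultimately obtain l where "((\<lambda>\<Lambda>. Q \<Lambda> F) \<longlongrightarrow> l) (finite_subsets_at_top UNIV)"
    unfolding complete_uniform filterlim_def
    by (metis (no_types, lifting) filtermap_bot_iff finite_subsets_at_top_neq_bot principal_UNIV top_greatest)
  then show ?thesis unfolding q_def using tendsto_Lim[OF finite_subsets_at_top_neq_bot] by metis
qed

end

section \<open>Lexicographic quantiles\<close>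

text \<open>Such a p is the family of cylinder masses of a probability on sequences of naturals:
  \<open>p a\<close> is the mass of the sequences beginning with the word a.\<close>

definition consistent :: "(nat list \<Rightarrow> real) \<Rightarrow> bool" where
  "consistent p \<longleftrightarrow> p [] = 1 \<and> (\<forall>a. 0 \<le> p a) \<and> (\<forall>a. (\<lambda>k. p (a @ [k])) sums p a)"

text \<open>The mass of the cylinders of length at most \<open>length a\<close> that precede \<open>a\<close> lexicographically:
  a finite sum, so it inherits pointwise limits of \<open>p\<close> along any filter.\<close>

definition lexl :: "(nat list \<Rightarrow> real) \<Rightarrow> nat list \<Rightarrow> real" where
  "lexl p a = (\<Sum>m<length a. \<Sum>j<a ! m. p (take m a @ [j]))"

text \<open>The unit interval is split into half-open intervals from \<open>lexl p a\<close> to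
  \<open>lexl p a + p a\<close>, each subdivided from left to right by one-letter extensions; the
  word of length n names the interval containing u.\<close>

primrec quant :: "(nat list \<Rightarrow> real) \<Rightarrow> real \<Rightarrow> nat \<Rightarrow> nat list" where
  "quant p u 0 = []"
| "quant p u (Suc n) = quant p u n @ [LEAST k. u < lexl p (quant p u n @ [k]) + p (quant p u n @ [k])]"

lemma lexl_snoc: "lexl p (a @ [k]) = lexl p a + (\<Sum>j<k. p (a @ [j]))"
  by (simp add: lexl_def nth_append cong: sum.cong_simp)

lemma lexl_snoc_Suc: "lexl p (a @ [Suc k]) = lexl p (a @ [k]) + p (a @ [k])"
  by (simp add: lexl_snoc)

lemma length_quant [simp]: "length (quant p u n) = n"
  by (induction n) auto

lemma consistentD:
  assumes "consistent p"
  shows "p [] = 1" "0 \<le> p a" "(\<lambda>k. p (a @ [k])) sums p a"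
  using assms by (auto simp: consistent_def)

lemma lexl_snoc_mono:
  assumes "consistent p" "i \<le> k"
  shows "lexl p (a @ [i]) \<le> lexl p (a @ [k])"
  unfolding lexl_snoc using assms(2) by (intro add_left_mono sum_mono2) (auto simp: consistentD(2)[OF assms(1)])

lemma lexl_snoc_bounds:
  assumes "consistent p"
  shows "lexl p a \<le> lexl p (a @ [k])" "lexl p (a @ [k]) + p (a @ [k]) \<le> lexl p a + p a"
proof -
  show "lexl p a \<le> lexl p (a @ [k])"
    using lexl_snoc_mono[OF assms, of 0 k a] by (simp add: lexl_snoc)
  have "(\<Sum>j<Suc k. p (a @ [j])) \<le> p a"
    using consistentD(2)[OF assms] sums_summable[OF consistentD(3)[OF assms, of a]]
      sums_unique[OF consistentD(3)[OF assms, of a]]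
    by (metis (no_types, lifting) finite_lessThan sum_le_suminf)
  then show "lexl p (a @ [k]) + p (a @ [k]) \<le> lexl p a + p a" by (simp add: lexl_snoc)
qed

lemma quant_bounds:
  assumes "consistent p" "0 \<le> u" "u < 1"
  shows "lexl p (quant p u n) \<le> u \<and> u < lexl p (quant p u n) + p (quant p u n)"
proof (induction n)
  case 0
  then show ?case using assms consistentD(1)[OF assms(1)] by (simp add: lexl_def)
next
  case (Suc n)
  let ?a = "quant p u n" and ?P = "\<lambda>k. u < lexl p (quant p u n @ [k]) + p (quant p u n @ [k])"
  \<comment> \<open>The subintervals exhaust their parent because the series of their lengths sums
    to \<open>p ?a\<close>, so some right endpoint passes u and the \<open>LEAST\<close> is
    attained.\<close>
  have "(\<lambda>n. \<Sum>j<Suc n. p (?a @ [j])) \<longlonglongrightarrow> p ?a"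
    using consistentD(3)[OF assms(1), of ?a] by (intro LIMSEQ_Suc) (simp add: sums_def)
  moreover have "u - lexl p ?a < p ?a" using Suc by simp
  ultimately have "eventually (\<lambda>n. u - lexl p ?a < (\<Sum>j<Suc n. p (?a @ [j]))) sequentially"
    by (rule order_tendstoD)
  then obtain k where "u - lexl p ?a < (\<Sum>j<Suc k. p (?a @ [j]))"
    using eventually_happens'[OF sequentially_bot] by blast
  then have "?P k" by (simp add: lexl_snoc)
  then have P: "?P (Least ?P)" by (rule LeastI)
  have "lexl p (?a @ [Least ?P]) \<le> u"
  proof (cases "Least ?P")
    case 0
    then show ?thesis using Suc by (simp add: lexl_snoc)
  next
    case (Suc i)
    \<comment> \<open>By minimality u is not below the right endpoint of the interval i, which is
      the left endpoint of the chosen one.\<close>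
    then have "\<not> ?P i" using not_less_Least[of i ?P] by simp
    then show ?thesis unfolding Suc by (simp add: lexl_snoc_Suc)
  qed
  then show ?case using P by simp
qed

lemma quant_unique:
  assumes "consistent p" "lexl p a \<le> u" "u < lexl p a + p a"
  shows "quant p u (length a) = a"
  using assms(2,3)
proof (induction a rule: rev_induct)
  case (snoc k a)
  have a: "quant p u (length a) = a"
    using snoc.prems lexl_snoc_bounds[OF assms(1), of a k] by (intro snoc.IH) auto
  have "(LEAST k. u < lexl p (a @ [k]) + p (a @ [k])) = k"
  proof (rule Least_equality)
    fix i assume i: "u < lexl p (a @ [i]) + p (a @ [i])"
    show "k \<le> i"
    proof (rule ccontr)
      assume "\<not> k \<le> i"
      then have "lexl p (a @ [Suc i]) \<le> lexl p (a @ [k])" by (intro lexl_snoc_mono assms) auto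
      with i snoc.prems show False by (simp add: lexl_snoc_Suc)
    qed
  qed (use snoc.prems in simp)
  then show ?case by (simp add: a)
qed simp

lemma lexl_in_unit:
  assumes "consistent p"
  shows "0 \<le> lexl p a \<and> lexl p a + p a \<le> 1"
proof (induction a rule: rev_induct)
  case Nil
  then show ?case using consistentD(1)[OF assms] by (simp add: lexl_def)
next
  case (snoc k a)
  then show ?case using lexl_snoc_bounds[OF assms, of a k] by linarith
qed

lemma quant_eq_iff:
  assumes "consistent p"
  shows "{u \<in> {0..<1}. quant p u (length a) = a} = {lexl p a..<lexl p a + p a}"
proof (intro set_eqI iffI)
  fix u assume "u \<in> {u \<in> {0..<1}. quant p u (length a) = a}"
  then show "u \<in> {lexl p a..<lexl p a + p a}"
    using quant_bounds[OF assms, of u "length a"] by simp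
next
  fix u assume "u \<in> {lexl p a..<lexl p a + p a}"
  then show "u \<in> {u \<in> {0..<1}. quant p u (length a) = a}"
    using quant_unique[OF assms, of a u] lexl_in_unit[OF assms, of a] by auto
qed

text \<open>If u is not a left endpoint, it is interior to its limiting interval. The endpoints for
  \<open>p i\<close> are finite sums of convergent terms, so they eventually enclose u as well.
  Right endpoints are excluded by half-openness, and words are countable, so the excluded set of u
  is countable.\<close>

lemma quant_eventually_eq:
  assumes q: "consistent q" and p: "\<And>i. i \<in> I \<Longrightarrow> consistent (p i)" and I: "eventually (\<lambda>i. i \<in> I) F"
    and lim: "\<And>a. ((\<lambda>i. p i a) \<longlongrightarrow> q a) F"
    and u: "0 \<le> u" "u < 1" "u \<notin> range (lexl q)"
  shows "eventually (\<lambda>i. quant (p i) u n = quant q u n) F"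
proof -
  let ?a = "quant q u n"
  have lim': "((\<lambda>i. lexl (p i) ?a) \<longlongrightarrow> lexl q ?a) F"
    unfolding lexl_def by (intro tendsto_sum lim)
  have "lexl q ?a \<noteq> u" using u(3) by (metis rangeI)
  then have "lexl q ?a < u" "u < lexl q ?a + q ?a"
    using quant_bounds[OF q u(1,2), of n] by linarith+
  then have "eventually (\<lambda>i. lexl (p i) ?a < u) F" "eventually (\<lambda>i. u < lexl (p i) ?a + p i ?a) F"
    using order_tendstoD[OF lim'] order_tendstoD[OF tendsto_add[OF lim' lim]] by auto
  then show ?thesis using I
  proof eventually_elim
    case (elim i)
    then show ?case using quant_unique[OF p, of i ?a u] by simp
  qed
qed

section \<open>Sampling words from one uniform variable\<close>

abbreviation unit_uniform :: "real measure" where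
  "unit_uniform \<equiv> restrict_space lborel {0..<1}"

lemma prob_space_unit_uniform: "prob_space unit_uniform"
  by (rule prob_spaceI) (simp add: emeasure_restrict_space space_restrict_space)

lemma quant_sets:
  assumes "consistent p"
  shows "{u \<in> space unit_uniform. quant p u n = a} \<in> sets unit_uniform"
proof (cases "length a = n")
  case True
  have "{u \<in> space unit_uniform. quant p u n = a} = {lexl p a..<lexl p a + p a} \<inter> {0..<1}"
    using lexl_in_unit[OF assms, of a] unfolding quant_eq_iff[OF assms, symmetric] using True
    by (auto simp: space_restrict_space)
  also have "\<dots> \<in> sets unit_uniform" by (auto simp: sets_restrict_space)
  finally show ?thesis .
next
  case False
  then have "{u \<in> space unit_uniform. quant p u n = a} = {}" by auto
  then show ?thesis by (metis sets.empty_sets)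
qed

lemma emeasure_quant:
  assumes "consistent p"
  shows "emeasure unit_uniform {u \<in> space unit_uniform. quant p u (length a) = a} = ennreal (p a)"
proof -
  have "{u \<in> space unit_uniform. quant p u (length a) = a} = {u \<in> {0..<1}. quant p u (length a) = a}"
    by (auto simp: space_restrict_space)
  also have "emeasure unit_uniform \<dots> = emeasure lborel {lexl p a..<lexl p a + p a}"
    unfolding quant_eq_iff[OF assms]
    using lexl_in_unit[OF assms, of a] by (subst emeasure_restrict_space) auto
  also have "\<dots> = ennreal (p a)" using consistentD(2)[OF assms, of a] by simp
  finally show ?thesis .
qed

section \<open>The space of permutations and finite-volume Gibbs measures\<close>

text \<open>Constraints are given as a set of pairs, possibly contradictory, so that intersections
  are again cylinders.\<close>

definition cyl :: "('d::finite zd \<times> 'd zd) set \<Rightarrow> ('d zd \<Rightarrow> 'd zd) set" where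
  "cyl L = {\<sigma>. bij \<sigma> \<and> (\<forall>(x, y)\<in>L. \<sigma> x = y)}"

lemma space_Sspace: "space Sspace = {\<sigma>. bij \<sigma>}"
  by (auto simp: Sspace_def space_restrict_space space_PiM)

lemma measurable_eval [measurable]: "(\<lambda>\<sigma>. \<sigma> x) \<in> Sspace \<rightarrow>\<^sub>M count_space UNIV"
  unfolding Sspace_def by (intro measurable_restrict_space1 measurable_component_singleton) auto

lemma measurable_SspaceI:
  assumes "\<And>\<omega>. \<omega> \<in> space M \<Longrightarrow> bij (f \<omega>)" "\<And>x. (\<lambda>\<omega>. f \<omega> x) \<in> M \<rightarrow>\<^sub>M count_space UNIV"
  shows "f \<in> M \<rightarrow>\<^sub>M Sspace"
  unfolding Sspace_def using assms
  by (intro measurable_restrict_space2 measurable_PiM_single') auto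

lemma cyl_Int: "cyl L \<inter> cyl L' = cyl (L \<union> L')"
  by (auto simp: cyl_def ball_Un)

lemma cyl_sets:
  assumes "finite L"
  shows "cyl L \<in> sets Sspace"
proof -
  have "{\<sigma> \<in> space Sspace. \<forall>p\<in>L. \<sigma> (fst p) \<in> {snd p}} \<in> sets Sspace"
    using assms by (intro sets.sets_Collect_finite_All measurable_sets_Collect[OF measurable_eval]) auto
  also have "{\<sigma> \<in> space Sspace. \<forall>p\<in>L. \<sigma> (fst p) \<in> {snd p}} = cyl L"
    by (auto simp: cyl_def space_Sspace)
  finally show ?thesis .
qed

text \<open>For the nontrivial inclusion the identity is measurable from the generated sigma
  algebra, since the values form a countable set and single-value events are cylinders.\<close>

lemma sets_Sspace: "sets Sspace = sigma_sets {\<sigma>. bij \<sigma>} {cyl L | L. finite L}" (is "_ = sigma_sets _ ?E")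
proof
  have E: "?E \<subseteq> Pow {\<sigma>. bij \<sigma>}" by (auto simp: cyl_def)
  show "sigma_sets {\<sigma>. bij \<sigma>} ?E \<subseteq> sets Sspace"
    using sets.sigma_sets_subset[of ?E Sspace] cyl_sets by (auto simp: space_Sspace)
  let ?M = "sigma {\<sigma>. bij \<sigma>} ?E"
  have "(\<lambda>\<sigma>. \<sigma>) \<in> ?M \<rightarrow>\<^sub>M Sspace"
  proof (rule measurable_SspaceI)
    show "bij \<sigma>" if "\<sigma> \<in> space ?M" for \<sigma> :: "'a zd \<Rightarrow> 'a zd"
      using that E by (simp add: space_measure_of)
    show "(\<lambda>\<sigma>. \<sigma> x) \<in> ?M \<rightarrow>\<^sub>M count_space UNIV" for x :: "'a zd"
      unfolding measurable_count_space_eq2_countable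
    proof (intro conjI ballI)
      fix y :: "'a zd"
      have "(\<lambda>\<sigma>. \<sigma> x) -` {y} \<inter> space ?M = cyl {(x, y)}"
        using E by (auto simp: space_measure_of cyl_def)
      also have "\<dots> \<in> sets ?M" using E by (auto simp: sets_measure_of)
      finally show "(\<lambda>\<sigma>. \<sigma> x) -` {y} \<inter> space ?M \<in> sets ?M" .
    qed auto
  qed
  then have "A \<in> sets ?M" if "A \<in> sets Sspace" for A
    using measurable_sets[of "\<lambda>\<sigma>. \<sigma>" ?M Sspace A] that sets.sets_into_space[OF that] E
    by (simp add: space_measure_of space_Sspace Int_absorb2 vimage_def)
  then show "sets Sspace \<subseteq> sigma_sets {\<sigma>. bij \<sigma>} ?E" using E by (auto simp: sets_measure_of)
qed

lemma Int_stable_cyl: "Int_stable {cyl L | L. finite L}"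
  unfolding Int_stable_def using cyl_Int by (smt (verit) finite_Un mem_Collect_eq)

lemma Sspace_measure_eqI:
  assumes "sets M = sets Sspace" "sets N = sets Sspace" "finite_measure M"
    and "\<And>L. finite L \<Longrightarrow> emeasure M (cyl L) = emeasure N (cyl L)"
  shows "M = N"
proof (rule measure_eqI_generator_eq[OF Int_stable_cyl, where A="\<lambda>_. cyl {}" and \<Omega>="{\<sigma>. bij \<sigma>}"])
  show "{cyl L |L. finite L} \<subseteq> Pow {\<sigma>. bij \<sigma>}" by (auto simp: cyl_def)
  show "emeasure M (cyl {}) \<noteq> \<infinity>" using finite_measure.emeasure_finite[OF assms(3)] by simp
  show "range (\<lambda>_. cyl {}) \<subseteq> {cyl L |L. finite L}" by auto
qed (use assms sets_Sspace in \<open>auto simp: cyl_def\<close>)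

lemma measurable_comp_left [measurable]:
  assumes "bij g"
  shows "(\<lambda>\<sigma>. g \<circ> \<sigma>) \<in> Sspace \<rightarrow>\<^sub>M Sspace"
proof (rule measurable_SspaceI)
  show "(\<lambda>\<sigma>. (g \<circ> \<sigma>) x) \<in> Sspace \<rightarrow>\<^sub>M count_space UNIV" for x
    unfolding comp_def using measurable_compose[OF measurable_eval, of g "count_space UNIV"] by simp
qed (use assms in \<open>auto simp: space_Sspace bij_comp\<close>)

lemma measurable_comp_right [measurable]:
  assumes "bij g"
  shows "(\<lambda>\<sigma>. \<sigma> \<circ> g) \<in> Sspace \<rightarrow>\<^sub>M Sspace"
proof (rule measurable_SspaceI)
  show "(\<lambda>\<sigma>. (\<sigma> \<circ> g) x) \<in> Sspace \<rightarrow>\<^sub>M count_space UNIV" for x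
    unfolding comp_def by measurable
qed (use assms in \<open>auto simp: space_Sspace bij_comp\<close>)

lemma measurable_conj_by [measurable]:
  assumes "bij g"
  shows "conj_by g \<in> Sspace \<rightarrow>\<^sub>M Sspace"
  using measurable_compose[OF measurable_comp_right[OF bij_imp_bij_inv[OF assms]] measurable_comp_left[OF assms]]
  by (simp add: conj_by_def[abs_def] comp_assoc)

lemma measurable_Ham [measurable]: "Ham V \<Lambda> \<in> borel_measurable Sspace"
  unfolding Ham_def[abs_def]
  by (intro borel_measurable_sum measurable_compose[OF measurable_eval, of "\<lambda>y. V (y - x)" borel x for x]) simp

text \<open>The configurations with boundary condition \<xi> form a coset of the permutations of
  \<Lambda>, so every conditional sum runs over the same finite index set.\<close>

lemma Scond_eq_image:
  assumes "bij \<xi>"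
  shows "Scond \<Lambda> \<xi> = (\<lambda>\<pi>. \<xi> \<circ> \<pi>) ` {\<pi>. \<pi> permutes \<Lambda>}"
proof (intro set_eqI iffI)
  fix \<sigma> assume s: "\<sigma> \<in> Scond \<Lambda> \<xi>"
  then have "inv \<xi> \<circ> \<sigma> permutes \<Lambda>"
    using bij_comp[OF _ bij_imp_bij_inv[OF assms], of \<sigma>] assms
    by (auto simp: permutes_def Scond_def bij_iff[of "inv \<xi> \<circ> \<sigma>"] bij_is_inj)
  moreover have "\<xi> \<circ> (inv \<xi> \<circ> \<sigma>) = \<sigma>"
    using assms by (simp add: comp_assoc[symmetric] surj_iff[THEN iffD1] bij_is_surj)
  ultimately show "\<sigma> \<in> (\<lambda>\<pi>. \<xi> \<circ> \<pi>) ` {\<pi>. \<pi> permutes \<Lambda>}" by (metis imageI mem_Collect_eq)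
next
  fix \<sigma> assume "\<sigma> \<in> (\<lambda>\<pi>. \<xi> \<circ> \<pi>) ` {\<pi>. \<pi> permutes \<Lambda>}"
  then show "\<sigma> \<in> Scond \<Lambda> \<xi>"
    using assms by (auto simp: Scond_def bij_comp permutes_bij permutes_not_in)
qed

lemma inj_comp_bij: "bij \<xi> \<Longrightarrow> inj_on (\<lambda>\<pi>. \<xi> \<circ> \<pi>) A"
  by (rule inj_onI) (metis bij_is_inj fun.inj_map_strong inj_eq)

lemma sum_Scond:
  "bij \<xi> \<Longrightarrow> (\<Sum>\<sigma>\<in>Scond \<Lambda> \<xi>. f \<sigma>) = (\<Sum>\<pi> | \<pi> permutes \<Lambda>. f (\<xi> \<circ> \<pi>))"
  by (simp add: Scond_eq_image sum.reindex[OF inj_comp_bij])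

lemma finite_Scond: "finite \<Lambda> \<Longrightarrow> bij \<xi> \<Longrightarrow> finite (Scond \<Lambda> \<xi>)"
  by (simp add: Scond_eq_image finite_permutations)

lemma Zpart_eq: "bij \<xi> \<Longrightarrow> Zpart V \<alpha> \<Lambda> \<xi> = (\<Sum>\<pi> | \<pi> permutes \<Lambda>. exp (- \<alpha> * Ham V \<Lambda> (\<xi> \<circ> \<pi>)))"
  by (simp add: Zpart_def sum_Scond)

lemma Zpart_pos: "finite \<Lambda> \<Longrightarrow> bij \<xi> \<Longrightarrow> 0 < Zpart V \<alpha> \<Lambda> \<xi>"
  unfolding Zpart_eq by (rule sum_pos) (auto simp: finite_permutations intro: permutes_id)

lemma measurable_point_measure_Scond: "(\<lambda>\<sigma>. \<sigma>) \<in> point_measure (Scond \<Lambda> \<xi>) f \<rightarrow>\<^sub>M Sspace"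
  by (simp add: measurable_point_measure_eq1 Scond_def space_Sspace)

lemma sets_Gibbs_fin [simp, measurable_cong]: "sets (Gibbs_fin V \<alpha> \<Lambda> \<xi>) = sets Sspace"
  by (simp add: Gibbs_fin_def)

lemma nn_integral_Gibbs_fin:
  assumes "finite \<Lambda>" "bij \<xi>" "f \<in> borel_measurable Sspace"
  shows "(\<integral>\<^sup>+\<sigma>. f \<sigma> \<partial>Gibbs_fin V \<alpha> \<Lambda> \<xi>) =
    (\<Sum>\<pi> | \<pi> permutes \<Lambda>. ennreal (exp (- \<alpha> * Ham V \<Lambda> (\<xi> \<circ> \<pi>)) / Zpart V \<alpha> \<Lambda> \<xi>) * f (\<xi> \<circ> \<pi>))"
  unfolding Gibbs_fin_def
  by (subst nn_integral_distr[OF measurable_point_measure_Scond])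
    (simp_all add: nn_integral_point_measure_finite finite_Scond assms sum_Scond)

lemma emeasure_Gibbs_fin:
  assumes "finite \<Lambda>" "bij \<xi>" "A \<in> sets Sspace"
  shows "emeasure (Gibbs_fin V \<alpha> \<Lambda> \<xi>) A =
    (\<Sum>\<pi> | \<pi> permutes \<Lambda>. ennreal (exp (- \<alpha> * Ham V \<Lambda> (\<xi> \<circ> \<pi>)) / Zpart V \<alpha> \<Lambda> \<xi>) * indicator A (\<xi> \<circ> \<pi>))"
  using nn_integral_Gibbs_fin[OF assms(1,2), of "indicator A"] assms(3) by simp

lemma integral_Gibbs_fin:
  fixes f :: "('d::finite zd \<Rightarrow> 'd zd) \<Rightarrow> real"
  assumes "finite \<Lambda>" "bij \<xi>" "f \<in> borel_measurable Sspace"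
  shows "(\<integral>\<sigma>. f \<sigma> \<partial>Gibbs_fin V \<alpha> \<Lambda> \<xi>) =
    (\<Sum>\<pi> | \<pi> permutes \<Lambda>. exp (- \<alpha> * Ham V \<Lambda> (\<xi> \<circ> \<pi>)) / Zpart V \<alpha> \<Lambda> \<xi> * f (\<xi> \<circ> \<pi>))"
  unfolding Gibbs_fin_def
  using Zpart_pos[OF assms(1,2), of V \<alpha>]
  by (subst integral_distr[OF measurable_point_measure_Scond assms(3)])
    (simp add: lebesgue_integral_point_measure_finite finite_Scond assms sum_Scond)

section \<open>The DLR equations from quasi-invariance\<close>

lemma sets_Foff_subset: "sets (Foff \<Lambda>) \<subseteq> sets Sspace"
proof -
  have "{\<sigma> \<in> space Sspace. \<sigma> x = y} = cyl {(x, y)}" for x y :: "'a zd"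
    by (auto simp: cyl_def space_Sspace)
  then have "{{\<sigma> \<in> space Sspace. \<sigma> x = y} |x y. x \<notin> \<Lambda>} \<subseteq> sets Sspace" by (auto simp: cyl_sets)
  then show ?thesis
    unfolding Foff_def using sets.space_closed[of Sspace]
    by (subst sets_measure_of) (auto intro!: sets.sigma_sets_subset)
qed

lemma Foff_determined:
  assumes "B \<in> sets (Foff \<Lambda>)" "bij \<sigma>" "bij \<tau>" "\<And>x. x \<notin> \<Lambda> \<Longrightarrow> \<sigma> x = \<tau> x"
  shows "\<sigma> \<in> B \<longleftrightarrow> \<tau> \<in> B"
proof -
  have "B \<in> sigma_sets (space Sspace) {{\<sigma> \<in> space Sspace. \<sigma> x = y} |x y. x \<notin> \<Lambda>}"
    using assms(1) unfolding Foff_def by (subst (asm) sets_measure_of) auto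
  then show ?thesis
    by (induction rule: sigma_sets.induct) (use assms in \<open>auto simp: space_Sspace\<close>)
qed

text \<open>Expand the conditional probability as a sum over permutations of \<Lambda> and move each
  one across by \<open>quasi\<close>. The transferred weights add up to the partition function,
  which cancels the normalization.\<close>

lemma is_Gibbs_if_quasi_invariant:
  fixes \<mu> :: "('d::finite zd \<Rightarrow> 'd zd) measure"
  assumes "prob_space \<mu>" and sets [measurable_cong]: "sets \<mu> = sets Sspace"
    and quasi: "\<And>\<Lambda> \<pi> f. finite \<Lambda> \<Longrightarrow> \<pi> permutes \<Lambda> \<Longrightarrow> f \<in> borel_measurable Sspace \<Longrightarrow>
      (\<integral>\<^sup>+\<xi>. ennreal (exp (- \<alpha> * Ham V \<Lambda> (\<xi> \<circ> \<pi>))) * f (\<xi> \<circ> \<pi>) \<partial>\<mu>) =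
      (\<integral>\<^sup>+\<xi>. ennreal (exp (- \<alpha> * Ham V \<Lambda> (\<xi> \<circ> inv \<pi>))) * f \<xi> \<partial>\<mu>)"
  shows "is_Gibbs V \<alpha> \<mu>"
  unfolding is_Gibbs_def
proof (intro conjI allI impI ballI assms)
  fix \<Lambda> :: "'d zd set" and A B :: "('d zd \<Rightarrow> 'd zd) set"
  assume fin: "finite \<Lambda>" and A [measurable]: "A \<in> sets Sspace" and B: "B \<in> sets (Foff \<Lambda>)"
  have [measurable]: "B \<in> sets Sspace" using B sets_Foff_subset by blast
  have sp: "space \<mu> = {\<sigma>. bij \<sigma>}" using sets_eq_imp_space_eq[OF sets] by (simp add: space_Sspace)
  have Zm [measurable]: "Zpart V \<alpha> \<Lambda> \<in> borel_measurable Sspace"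
  proof (rule measurable_cong[THEN iffD2])
    show "(\<lambda>\<xi>. \<Sum>\<pi> | \<pi> permutes \<Lambda>. exp (- \<alpha> * Ham V \<Lambda> (\<xi> \<circ> \<pi>))) \<in> borel_measurable Sspace"
    proof (rule borel_measurable_sum)
      fix \<pi> assume "\<pi> \<in> {\<pi>. \<pi> permutes \<Lambda>}"
      then have [measurable]: "(\<lambda>\<sigma>. \<sigma> \<circ> \<pi>) \<in> Sspace \<rightarrow>\<^sub>M Sspace"
        by (auto intro: measurable_comp_right permutes_bij)
      show "(\<lambda>\<xi>. exp (- \<alpha> * Ham V \<Lambda> (\<xi> \<circ> \<pi>))) \<in> borel_measurable Sspace" by measurable
    qed
  qed (simp add: Zpart_eq space_Sspace)
  \<comment> \<open>Besides the indicator of A and B, f carries the reciprocal of the partition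
    function; the latter and membership in B do not change under rearrangement inside
    \<Lambda>.\<close>
  define f where "f \<xi> = ennreal (1 / Zpart V \<alpha> \<Lambda> \<xi>) * indicator (A \<inter> B) \<xi>" for \<xi>
  have f [measurable]: "f \<in> borel_measurable Sspace" unfolding f_def by measurable
  have Zinv: "Zpart V \<alpha> \<Lambda> (\<xi> \<circ> \<pi>) = Zpart V \<alpha> \<Lambda> \<xi>" if "bij \<xi>" "\<pi> permutes \<Lambda>" for \<xi> \<pi>
  proof -
    have "Scond \<Lambda> (\<xi> \<circ> \<pi>) = Scond \<Lambda> \<xi>"
      using that by (auto simp: Scond_def permutes_not_in)
    then show ?thesis by (simp add: Zpart_def)
  qed
  have "(\<integral>\<^sup>+\<xi>. emeasure (Gibbs_fin V \<alpha> \<Lambda> \<xi>) A * indicator B \<xi> \<partial>\<mu>) =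
    (\<integral>\<^sup>+\<xi>. (\<Sum>\<pi> | \<pi> permutes \<Lambda>. ennreal (exp (- \<alpha> * Ham V \<Lambda> (\<xi> \<circ> \<pi>))) * f (\<xi> \<circ> \<pi>)) \<partial>\<mu>)"
  proof (rule nn_integral_cong)
    fix \<xi> assume "\<xi> \<in> space \<mu>"
    then have bij: "bij \<xi>" by (simp add: sp)
    have "ennreal (exp (- \<alpha> * Ham V \<Lambda> (\<xi> \<circ> \<pi>)) / Zpart V \<alpha> \<Lambda> \<xi>) * indicator A (\<xi> \<circ> \<pi>) * indicator B \<xi>
      = ennreal (exp (- \<alpha> * Ham V \<Lambda> (\<xi> \<circ> \<pi>))) * f (\<xi> \<circ> \<pi>)" if p: "\<pi> permutes \<Lambda>" for \<pi>
    proof -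
      have "\<xi> \<circ> \<pi> \<in> B \<longleftrightarrow> \<xi> \<in> B"
        using p bij by (intro Foff_determined[OF B]) (auto simp: bij_comp permutes_bij permutes_not_in)
      moreover have "ennreal (exp (- \<alpha> * Ham V \<Lambda> (\<xi> \<circ> \<pi>)) / Zpart V \<alpha> \<Lambda> \<xi>) =
        ennreal (exp (- \<alpha> * Ham V \<Lambda> (\<xi> \<circ> \<pi>))) * ennreal (1 / Zpart V \<alpha> \<Lambda> \<xi>)"
        using Zpart_pos[OF fin bij, of V \<alpha>] by (subst ennreal_mult[symmetric]) auto
      ultimately show ?thesis
        by (auto simp: f_def Zinv[OF bij p] indicator_def)
    qed
    then show "emeasure (Gibbs_fin V \<alpha> \<Lambda> \<xi>) A * indicator B \<xi> =
      (\<Sum>\<pi> | \<pi> permutes \<Lambda>. ennreal (exp (- \<alpha> * Ham V \<Lambda> (\<xi> \<circ> \<pi>))) * f (\<xi> \<circ> \<pi>))"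
      unfolding emeasure_Gibbs_fin[OF fin bij A] sum_distrib_right by (intro sum.cong) auto
  qed
  also have "\<dots> = (\<Sum>\<pi> | \<pi> permutes \<Lambda>. \<integral>\<^sup>+\<xi>. ennreal (exp (- \<alpha> * Ham V \<Lambda> (\<xi> \<circ> \<pi>))) * f (\<xi> \<circ> \<pi>) \<partial>\<mu>)"
  proof (rule nn_integral_sum)
    fix \<pi> assume "\<pi> \<in> {\<pi>. \<pi> permutes \<Lambda>}"
    then have [measurable]: "(\<lambda>\<sigma>. \<sigma> \<circ> \<pi>) \<in> Sspace \<rightarrow>\<^sub>M Sspace"
      by (auto intro: measurable_comp_right permutes_bij)
    show "(\<lambda>\<xi>. ennreal (exp (- \<alpha> * Ham V \<Lambda> (\<xi> \<circ> \<pi>))) * f (\<xi> \<circ> \<pi>)) \<in> borel_measurable \<mu>" by measurable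
  qed
  also have "\<dots> = (\<Sum>\<pi> | \<pi> permutes \<Lambda>. \<integral>\<^sup>+\<xi>. ennreal (exp (- \<alpha> * Ham V \<Lambda> (\<xi> \<circ> inv \<pi>))) * f \<xi> \<partial>\<mu>)"
    using quasi[OF fin _ f] by (intro sum.cong) auto
  also have "\<dots> = (\<Sum>\<pi> | \<pi> permutes \<Lambda>. \<integral>\<^sup>+\<xi>. ennreal (exp (- \<alpha> * Ham V \<Lambda> (\<xi> \<circ> \<pi>))) * f \<xi> \<partial>\<mu>)"
    by (rule sum.reindex_bij_witness[of _ inv inv]) (auto simp: permutes_inv permutes_inv_inv)
  also have "\<dots> = (\<integral>\<^sup>+\<xi>. (\<Sum>\<pi> | \<pi> permutes \<Lambda>. ennreal (exp (- \<alpha> * Ham V \<Lambda> (\<xi> \<circ> \<pi>))) * f \<xi>) \<partial>\<mu>)"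
  proof (rule nn_integral_sum[symmetric])
    fix \<pi> assume "\<pi> \<in> {\<pi>. \<pi> permutes \<Lambda>}"
    then have [measurable]: "(\<lambda>\<sigma>. \<sigma> \<circ> \<pi>) \<in> Sspace \<rightarrow>\<^sub>M Sspace"
      by (auto intro: measurable_comp_right permutes_bij)
    show "(\<lambda>\<xi>. ennreal (exp (- \<alpha> * Ham V \<Lambda> (\<xi> \<circ> \<pi>))) * f \<xi>) \<in> borel_measurable \<mu>" by measurable
  qed
  also have "\<dots> = (\<integral>\<^sup>+\<xi>. indicator (A \<inter> B) \<xi> \<partial>\<mu>)"
  proof (rule nn_integral_cong)
    fix \<xi> assume "\<xi> \<in> space \<mu>"
    then have bij: "bij \<xi>" by (simp add: sp)
    have "(\<Sum>\<pi> | \<pi> permutes \<Lambda>. ennreal (exp (- \<alpha> * Ham V \<Lambda> (\<xi> \<circ> \<pi>))) * f \<xi>) = ennreal (Zpart V \<alpha> \<Lambda> \<xi>) * f \<xi>"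
      by (simp add: sum_distrib_right[symmetric] Zpart_eq[OF bij])
    also have "\<dots> = ennreal (Zpart V \<alpha> \<Lambda> \<xi> * (1 / Zpart V \<alpha> \<Lambda> \<xi>)) * indicator (A \<inter> B) \<xi>"
      using Zpart_pos[OF fin bij, of V \<alpha>] by (subst ennreal_mult) (auto simp: f_def mult.assoc)
    also have "\<dots> = indicator (A \<inter> B) \<xi>" using Zpart_pos[OF fin bij, of V \<alpha>] by simp
    finally show "(\<Sum>\<pi> | \<pi> permutes \<Lambda>. ennreal (exp (- \<alpha> * Ham V \<Lambda> (\<xi> \<circ> \<pi>))) * f \<xi>) = indicator (A \<inter> B) \<xi>" .
  qed
  also have "\<dots> = emeasure \<mu> (A \<inter> B)" by simp
  finally show "emeasure \<mu> (A \<inter> B) = (\<integral>\<^sup>+\<xi>. emeasure (Gibbs_fin V \<alpha> \<Lambda> \<xi>) A * indicator B \<xi> \<partial>\<mu>)" by simp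
qed

section \<open>Coupling of all finite volumes\<close>

lemma countable_permutations: "countable {\<gamma> :: 'd::finite zd \<Rightarrow> 'd zd. permutation \<gamma>}"
proof (rule countable_subset)
  show "{\<gamma> :: 'd zd \<Rightarrow> 'd zd. permutation \<gamma>} \<subseteq> (\<Union>F\<in>{F. finite F}. {\<gamma>. \<gamma> permutes F})"
    by (auto simp: permutation_permutes)
  show "countable (\<Union>F\<in>{F :: 'd zd set. finite F}. {\<gamma>. \<gamma> permutes F})"
    by (intro countable_UN countable_Collect_finite countable_finite finite_permutations) auto
qed

lemma permutation_cyc: "permutation \<sigma> \<Longrightarrow> permutation (cyc \<sigma> x)"
  unfolding cyc_def
  by (intro permutes_permutation[OF finite_orbit[OF permutation_self_in_orbit] permutes_perm_restrict_orbit])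

definition site :: "nat \<Rightarrow> ('d::finite) zd" where
  "site n = from_nat n"

lemma site_surj: "\<exists>n. site n = x"
  unfolding site_def by (metis from_nat_to_nat)

text \<open>Each letter is a number for the entire cycle at the n-th site, so fixing finitely many
  letters fixes \<sigma> on a finite union of cycles.\<close>

definition code :: "(('d::finite) zd \<Rightarrow> 'd zd) \<Rightarrow> nat \<Rightarrow> nat" where
  "code \<sigma> n = to_nat_on {\<gamma> :: 'd zd \<Rightarrow> 'd zd. permutation \<gamma>} (cyc \<sigma> (site n))"

lemma code_eq_iff:
  assumes "permutation \<sigma>" "permutation \<tau>"
  shows "code \<sigma> n = code \<tau> n \<longleftrightarrow> cyc \<sigma> (site n) = cyc \<tau> (site n)"
  unfolding code_def using assms by (subst to_nat_on_inj) (auto simp: countable_permutations permutation_cyc)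

lemma cyc_self: "permutation \<sigma> \<Longrightarrow> cyc \<sigma> x x = \<sigma> x"
  by (simp add: cyc_def perm_restrict_def permutation_self_in_orbit)

lemma cyc_eq_selfD: "permutation \<sigma> \<Longrightarrow> cyc \<sigma> y z = y \<Longrightarrow> \<sigma> z = y"
  using permutation_self_in_orbit[of \<sigma> y] by (auto simp: cyc_def perm_restrict_def split: if_splits)

section \<open>Gibbs probabilities of code words and their limits\<close>

context subcritical
begin

definition pfin :: "'a zd set \<Rightarrow> nat list \<Rightarrow> real" where
  "pfin \<Lambda> a = (\<Sum>\<sigma> | \<sigma> permutes \<Lambda> \<and> (\<forall>i<length a. code \<sigma> i = a ! i). W \<sigma>) / Z \<Lambda>"

lemma pfin_nonneg: "finite \<Lambda> \<Longrightarrow> 0 \<le> pfin \<Lambda> a"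
  unfolding pfin_def by (intro divide_nonneg_nonneg sum_nonneg less_imp_le[OF W_pos] less_imp_le[OF Z_pos])

lemma consistent_pfin:
  assumes "finite \<Lambda>"
  shows "consistent (pfin \<Lambda>)"
  unfolding consistent_def
proof (intro conjI allI)
  show "pfin \<Lambda> [] = 1" using Z_pos[OF assms] by (simp add: pfin_def Z_def)
  show "0 \<le> pfin \<Lambda> a" for a using pfin_nonneg[OF assms] .
  fix a :: "nat list"
  let ?S = "{\<sigma>. \<sigma> permutes \<Lambda> \<and> (\<forall>i<length a. code \<sigma> i = a ! i)}"
  have fin: "finite ?S" by (rule finite_subset[OF _ finite_permutations[OF assms]]) auto
  have "(\<lambda>k. \<Sum>\<sigma>\<in>?S. if k = code \<sigma> (length a) then W \<sigma> else 0) sums (\<Sum>\<sigma>\<in>?S. W \<sigma>)"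
    by (intro sums_sum sums_single)
  then have "(\<lambda>k. (\<Sum>\<sigma>\<in>?S. if k = code \<sigma> (length a) then W \<sigma> else 0) / Z \<Lambda>) sums pfin \<Lambda> a"
    unfolding pfin_def by (rule sums_divide)
  moreover have "(\<Sum>\<sigma>\<in>?S. if k = code \<sigma> (length a) then W \<sigma> else 0) / Z \<Lambda> = pfin \<Lambda> (a @ [k])" for k
  proof -
    have "{\<sigma>. \<sigma> permutes \<Lambda> \<and> (\<forall>i<length (a @ [k]). code \<sigma> i = (a @ [k]) ! i)} = {\<sigma> \<in> ?S. k = code \<sigma> (length a)}"
      by (auto simp: nth_append less_Suc_eq)
    then show ?thesis using fin by (simp add: pfin_def sum.inter_filter[symmetric])
  qed
  ultimately show "(\<lambda>k. pfin \<Lambda> (a @ [k])) sums pfin \<Lambda> a" by simp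
qed

text \<open>Either no finite permutation has a code beginning with a, or one that does determines a
  finite union F of cycles and its restriction \<pi> there; the word a then means agreement with
  \<pi> on F. Both alternatives make the limit in the volume evident.\<close>

lemma pfin_cases:
  obtains "\<And>\<Lambda>. finite \<Lambda> \<Longrightarrow> pfin \<Lambda> a = 0"
  | F \<pi> where "finite F" "\<pi> permutes F" "\<And>\<Lambda>. finite \<Lambda> \<Longrightarrow> F \<subseteq> \<Lambda> \<Longrightarrow> pfin \<Lambda> a = W \<pi> * Q \<Lambda> F"
proof (cases "\<exists>\<sigma>0 :: 'a zd \<Rightarrow> 'a zd. permutation \<sigma>0 \<and> (\<forall>i<length a. code \<sigma>0 i = a ! i)")
  case False
  have "pfin \<Lambda> a = 0" if "finite \<Lambda>" for \<Lambda>
  proof -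
    have "{\<sigma>. \<sigma> permutes \<Lambda> \<and> (\<forall>i<length a. code \<sigma> i = a ! i)} = {}"
      using False permutes_permutation[OF that] by blast
    then show ?thesis unfolding pfin_def by (metis (no_types) div_0 sum.empty)
  qed
  with that(1) show ?thesis by blast
next
  case True
  then obtain \<sigma>0 :: "'a zd \<Rightarrow> 'a zd" where s0: "permutation \<sigma>0" "\<And>i. i < length a \<Longrightarrow> code \<sigma>0 i = a ! i" by blast
  define F where "F = (\<Union>i<length a. orbit \<sigma>0 (site i))"
  define \<pi> where "\<pi> = perm_restrict \<sigma>0 F"
  have finF: "finite F"
    unfolding F_def by (intro finite_UN_I finite_orbit permutation_self_in_orbit s0) auto
  have perm: "\<pi> permutes F"
    unfolding \<pi>_def
  proof (rule permutes_perm_restrict)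
    show "inj \<sigma>0" using s0(1) permutation_bijective bij_def by blast
    show "\<sigma>0 ` F \<subseteq> F" by (auto simp: F_def intro: orbit.intros)
  qed (rule finF)
  have "pfin \<Lambda> a = W \<pi> * Q \<Lambda> F" if "finite \<Lambda>" "F \<subseteq> \<Lambda>" for \<Lambda>
  proof -
    have "(\<forall>i<length a. code \<sigma> i = a ! i) \<longleftrightarrow> (\<forall>x\<in>F. \<sigma> x = \<pi> x)" if "\<sigma> permutes \<Lambda>" for \<sigma>
    proof -
      have p: "permutation \<sigma>" using that \<open>finite \<Lambda>\<close> permutes_permutation by blast
      have "(\<forall>i<length a. code \<sigma> i = a ! i) \<longleftrightarrow> (\<forall>i<length a. code \<sigma> i = code \<sigma>0 i)"
        using s0(2) by simp
      also have "\<dots> \<longleftrightarrow> (\<forall>i<length a. \<forall>y\<in>orbit \<sigma>0 (site i). \<sigma> y = \<sigma>0 y)"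
        by (simp add: code_eq_iff[OF p s0(1)] cyc_eq_iff[OF p s0(1)])
      also have "\<dots> \<longleftrightarrow> (\<forall>x\<in>F. \<sigma> x = \<sigma>0 x)" by (auto simp: F_def)
      also have "\<dots> \<longleftrightarrow> (\<forall>x\<in>F. \<sigma> x = \<pi> x)" by (simp add: \<pi>_def perm_restrict_def)
      finally show ?thesis .
    qed
    then have "{\<sigma>. \<sigma> permutes \<Lambda> \<and> (\<forall>i<length a. code \<sigma> i = a ! i)} = {\<sigma>. \<sigma> permutes \<Lambda> \<and> (\<forall>x\<in>F. \<sigma> x = \<pi> x)}"
      by blast
    then show ?thesis by (simp add: pfin_def sum_W_extending[OF that perm] Q_def)
  qed
  with that(2)[OF finF perm] show ?thesis by blast
qed

definition pinf :: "nat list \<Rightarrow> real" where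
  "pinf a = Lim (finite_subsets_at_top UNIV) (\<lambda>\<Lambda>. pfin \<Lambda> a)"

lemma pfin_tendsto: "((\<lambda>\<Lambda>. pfin \<Lambda> a) \<longlongrightarrow> pinf a) (finite_subsets_at_top UNIV)"
proof -
  have "\<exists>l. ((\<lambda>\<Lambda>. pfin \<Lambda> a) \<longlongrightarrow> l) (finite_subsets_at_top UNIV)"
  proof (cases rule: pfin_cases[of a])
    case 1
    then have "((\<lambda>\<Lambda>. pfin \<Lambda> a) \<longlongrightarrow> 0) (finite_subsets_at_top UNIV)"
      by (intro tendsto_eventually) (auto simp: eventually_finite_subsets_at_top)
    then show ?thesis by blast
  next
    case (2 F \<pi>)
    have "((\<lambda>\<Lambda>. W \<pi> * Q \<Lambda> F) \<longlongrightarrow> W \<pi> * q F) (finite_subsets_at_top UNIV)"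
      by (intro tendsto_intros Q_tendsto_q 2)
    moreover have "eventually (\<lambda>\<Lambda>. W \<pi> * Q \<Lambda> F = pfin \<Lambda> a) (finite_subsets_at_top UNIV)"
      using 2 unfolding eventually_finite_subsets_at_top by (intro exI[of _ F]) auto
    ultimately have "((\<lambda>\<Lambda>. pfin \<Lambda> a) \<longlongrightarrow> W \<pi> * q F) (finite_subsets_at_top UNIV)"
      by (rule Lim_transform_eventually)
    then show ?thesis by blast
  qed
  then show ?thesis unfolding pinf_def using tendsto_Lim[OF finite_subsets_at_top_neq_bot] by metis
qed

text \<open>The majorant for Tannery's theorem: the weight of the cycle with number k. It depends on
  neither the volume nor the preceding letters, and its sum is at most 1 + b, the 1 coming from
  \<open>id\<close>.\<close>

definition code_bound :: "nat \<Rightarrow> nat \<Rightarrow> real" where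
  "code_bound n k = (if k \<in> to_nat_on {\<gamma> :: 'a zd \<Rightarrow> 'a zd. permutation \<gamma>} ` insert id (cycles_at (site n))
    then W (from_nat_into {\<gamma>. permutation \<gamma>} k) else 0)"

lemma cycles_at_subset_permutation: "insert id (cycles_at x) \<subseteq> {\<gamma>. permutation \<gamma>}"
  using cycles_atD(1) by (auto simp: permutation_id)

lemma summable_code_bound: "summable (code_bound n)"
proof (rule bounded_imp_summable)
  show "0 \<le> code_bound n k" for k by (simp add: code_bound_def less_imp_le[OF W_pos])
  fix N
  let ?P = "{\<gamma> :: 'a zd \<Rightarrow> 'a zd. permutation \<gamma>}" and ?C = "insert id (cycles_at (site n))"
  let ?K = "{..N} \<inter> to_nat_on ?P ` ?C"
  have inv: "from_nat_into ?P (to_nat_on ?P \<gamma>) = \<gamma>" if "\<gamma> \<in> ?C" for \<gamma>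
    using that cycles_at_subset_permutation[of "site n"] by (intro from_nat_into_to_nat_on countable_permutations) auto
  have inj: "inj_on (from_nat_into ?P) ?K"
    by (rule inj_on_inverseI[where g="to_nat_on ?P"]) (use inv in auto)
  have sub: "from_nat_into ?P ` ?K \<subseteq> ?C" using inv by auto
  have "(\<Sum>k\<le>N. code_bound n k) = (\<Sum>k\<in>?K. W (from_nat_into ?P k))"
    unfolding code_bound_def by (simp add: sum.inter_restrict)
  also have "\<dots> = sum W (from_nat_into ?P ` ?K)" unfolding sum.reindex[OF inj] by simp
  also have "\<dots> \<le> sum W (insert id (from_nat_into ?P ` ?K - {id}))"
    by (intro sum_mono2) (auto simp: less_imp_le[OF W_pos])
  also have "\<dots> = 1 + sum W (from_nat_into ?P ` ?K - {id})" by (subst sum.insert) (auto simp: W_id)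
  also have "\<dots> \<le> 1 + b" using sub by (intro add_left_mono sum_W_cycles_le_b[of _ "site n"]) auto
  finally show "(\<Sum>k\<le>N. code_bound n k) \<le> 1 + b" .
qed

text \<open>Only the last letter is kept. It prescribes the cycle at one site, an event of
  probability \<open>W \<gamma>\<close> times a ratio at most 1; for a fixed site the trivial bound
  1 equals the weight of \<open>id\<close>.\<close>

lemma pfin_le_code_bound:
  assumes "finite \<Lambda>"
  shows "pfin \<Lambda> (a @ [k]) \<le> code_bound (length a) k"
proof (cases "\<exists>\<sigma>0. \<sigma>0 permutes \<Lambda> \<and> code \<sigma>0 (length a) = k")
  case False
  then have "{\<sigma>. \<sigma> permutes \<Lambda> \<and> (\<forall>i<length (a @ [k]). code \<sigma> i = (a @ [k]) ! i)} = {}"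
    by (auto simp: nth_append less_Suc_eq)
  then have "pfin \<Lambda> (a @ [k]) = 0" unfolding pfin_def by (metis (no_types) div_0 sum.empty)
  then show ?thesis by (simp add: code_bound_def less_imp_le[OF W_pos])
next
  case True
  then obtain \<sigma>0 where s0: "\<sigma>0 permutes \<Lambda>" "code \<sigma>0 (length a) = k" by blast
  let ?x = "site (length a)" and ?P = "{\<gamma> :: 'a zd \<Rightarrow> 'a zd. permutation \<gamma>}"
  have p0: "permutation \<sigma>0" using permutes_permutation[OF assms s0(1)] .
  define \<gamma> where "\<gamma> = cyc \<sigma>0 ?x"
  have \<gamma>: "\<gamma> = id \<or> \<gamma> \<in> cycles_at ?x"
    using cyc_in_cycles_at[OF p0, of ?x] cyc_eq_id_iff[OF p0, of ?x] by (auto simp: \<gamma>_def)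
  have k: "k = to_nat_on ?P \<gamma>" using s0(2) by (simp add: code_def \<gamma>_def)
  have "from_nat_into ?P k = \<gamma>"
    unfolding k using permutation_cyc[OF p0, of ?x]
    by (intro from_nat_into_to_nat_on countable_permutations) (simp add: \<gamma>_def)
  moreover have "k \<in> to_nat_on ?P ` insert id (cycles_at ?x)" unfolding k using \<gamma> by blast
  ultimately have bnd: "code_bound (length a) k = W \<gamma>" by (simp add: code_bound_def)
  have sub: "{\<sigma>. \<sigma> permutes \<Lambda> \<and> (\<forall>i<length (a @ [k]). code \<sigma> i = (a @ [k]) ! i)} \<subseteq>
    {\<sigma>. \<sigma> permutes \<Lambda> \<and> cyc \<sigma> ?x = \<gamma>}"
  proof (rule subsetI)
    fix \<sigma> assume "\<sigma> \<in> {\<sigma>. \<sigma> permutes \<Lambda> \<and> (\<forall>i<length (a @ [k]). code \<sigma> i = (a @ [k]) ! i)}"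
    then have s: "\<sigma> permutes \<Lambda>" "\<forall>i<length (a @ [k]). code \<sigma> i = (a @ [k]) ! i" by auto
    then have "code \<sigma> (length a) = code \<sigma>0 (length a)" using s0(2) by simp
    then show "\<sigma> \<in> {\<sigma>. \<sigma> permutes \<Lambda> \<and> cyc \<sigma> ?x = \<gamma>}"
      using s(1) code_eq_iff[OF permutes_permutation[OF assms s(1)] p0] by (simp add: \<gamma>_def)
  qed
  have "(\<Sum>\<sigma> | \<sigma> permutes \<Lambda> \<and> cyc \<sigma> ?x = \<gamma>. W \<sigma>) \<le> W \<gamma> * Z \<Lambda>"
  proof (cases "\<gamma> = id")
    case True
    have "(\<Sum>\<sigma> | \<sigma> permutes \<Lambda> \<and> cyc \<sigma> ?x = \<gamma>. W \<sigma>) \<le> Z \<Lambda>"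
      unfolding Z_def by (intro sum_mono2) (auto simp: finite_permutations[OF assms] less_imp_le[OF W_pos])
    then show ?thesis unfolding True W_id by simp
  next
    case False
    then have g: "\<gamma> \<in> cycles_at ?x" using \<gamma> by blast
    have "\<sigma>0 ?x \<noteq> ?x" using False cyc_eq_id_iff[OF p0, of ?x] by (simp add: \<gamma>_def)
    then have "?x \<in> \<Lambda>" "csupp \<gamma> = orbit \<sigma>0 ?x"
      using s0(1) csupp_cyc[OF p0, of ?x] by (auto simp: permutes_def \<gamma>_def)
    then have sub': "csupp \<gamma> \<subseteq> \<Lambda>" using permutes_orbit_subset[OF s0(1), of ?x] by simp
    have "{\<sigma>. \<sigma> permutes \<Lambda> \<and> cyc \<sigma> ?x = \<gamma>} = {\<sigma>. \<sigma> permutes \<Lambda> \<and> (\<forall>y\<in>csupp \<gamma>. \<sigma> y = \<gamma> y)}"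
      using cyc_eq_fcycle_iff[OF permutes_permutation[OF assms] g] by blast
    then have "(\<Sum>\<sigma> | \<sigma> permutes \<Lambda> \<and> cyc \<sigma> ?x = \<gamma>. W \<sigma>) = W \<gamma> * Z (\<Lambda> - csupp \<gamma>)"
      using sum_W_extending[OF assms sub' cycles_atD(4)[OF g]] by simp
    also have "\<dots> \<le> W \<gamma> * Z \<Lambda>" using assms by (intro mult_left_mono Z_mono less_imp_le[OF W_pos]) auto
    finally show ?thesis .
  qed
  moreover have "(\<Sum>\<sigma> | \<sigma> permutes \<Lambda> \<and> (\<forall>i<length (a @ [k]). code \<sigma> i = (a @ [k]) ! i). W \<sigma>) \<le>
    (\<Sum>\<sigma> | \<sigma> permutes \<Lambda> \<and> cyc \<sigma> ?x = \<gamma>. W \<sigma>)"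
    by (rule sum_mono2[OF finite_subset[OF _ finite_permutations[OF assms]] sub])
      (auto simp: less_imp_le[OF W_pos])
  ultimately show ?thesis
    unfolding bnd pfin_def using Z_pos[OF assms] by (simp add: divide_le_eq del: length_append)
qed

text \<open>Additivity in the last letter is where mass could escape in the limit; domination by
  \<open>code_bound\<close> allows limit and series to be exchanged.\<close>

lemma consistent_pinf: "consistent pinf"
  unfolding consistent_def
proof (intro conjI allI)
  let ?F = "finite_subsets_at_top (UNIV :: 'a zd set)"
  have ev: "eventually finite ?F" by (auto simp: eventually_finite_subsets_at_top)
  show "pinf [] = 1"
  proof (rule tendsto_unique[OF finite_subsets_at_top_neq_bot pfin_tendsto])
    show "((\<lambda>\<Lambda>. pfin \<Lambda> []) \<longlongrightarrow> 1) ?F"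
      by (rule tendsto_eventually, rule eventually_mono[OF ev]) (simp add: consistentD(1)[OF consistent_pfin])
  qed
  show "0 \<le> pinf a" for a
    by (rule tendsto_lowerbound[OF pfin_tendsto eventually_mono[OF ev] finite_subsets_at_top_neq_bot])
      (simp add: pfin_nonneg)
  fix a
  have *: "eventually (\<lambda>n. summable (\<lambda>k. norm (pfin n (a @ [k])))) ?F \<and>
    summable (\<lambda>k. norm (pinf (a @ [k]))) \<and>
    ((\<lambda>\<Lambda>. \<Sum>k. pfin \<Lambda> (a @ [k])) \<longlongrightarrow> (\<Sum>k. pinf (a @ [k]))) ?F"
  proof (rule tannerys_theorem[OF pfin_tendsto _ summable_code_bound[of "length a"] finite_subsets_at_top_neq_bot])
    show "\<forall>\<^sub>F (k, \<Lambda>) in sequentially \<times>\<^sub>F ?F. norm (pfin \<Lambda> (a @ [k])) \<le> code_bound (length a) k"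
      unfolding eventually_prod_filter
      by (intro exI[of _ "\<lambda>_. True"] exI[of _ finite])
        (use ev in \<open>auto simp: pfin_le_code_bound pfin_nonneg\<close>)
  qed
  have "((\<lambda>\<Lambda>. \<Sum>k. pfin \<Lambda> (a @ [k])) \<longlongrightarrow> pinf a) ?F"
    by (rule Lim_transform_eventually[OF pfin_tendsto eventually_mono[OF ev]])
      (rule sums_unique[OF consistentD(3)[OF consistent_pfin]])
  from tendsto_unique[OF finite_subsets_at_top_neq_bot conjunct2[OF conjunct2[OF *]] this]
  have "(\<Sum>k. pinf (a @ [k])) = pinf a" .
  moreover have "summable (\<lambda>k. pinf (a @ [k]))"
    by (rule summable_norm_cancel[OF conjunct1[OF conjunct2[OF *]]])
  ultimately show "(\<lambda>k. pinf (a @ [k])) sums pinf a" by (simp add: sums_iff)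
qed

end

section \<open>Reading permutations off the code words\<close>

lemma take_quant: "n \<le> m \<Longrightarrow> take n (quant p u m) = quant p u n"
  by (induction m) (auto simp: le_Suc_eq)

lemma filterlim_finite_subsets_at_top_iff:
  fixes B :: "'i \<Rightarrow> 'a set"
  shows "filterlim B (finite_subsets_at_top UNIV) F \<longleftrightarrow> (\<forall>K. finite K \<longrightarrow> eventually (\<lambda>n. finite (B n) \<and> K \<subseteq> B n) F)"
  (is "?L \<longleftrightarrow> ?R")
proof
  assume ?L
  show ?R
  proof (intro allI impI)
    fix K :: "'a set" assume "finite K"
    then have "eventually (\<lambda>X. finite X \<and> K \<subseteq> X) (finite_subsets_at_top UNIV)"
      by (auto simp: eventually_finite_subsets_at_top)
    then show "eventually (\<lambda>n. finite (B n) \<and> K \<subseteq> B n) F"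
      using \<open>?L\<close> by (auto simp: filterlim_iff)
  qed
next
  assume R: ?R
  show ?L
    unfolding filterlim_iff
  proof (intro allI impI)
    fix P :: "'a set \<Rightarrow> bool" assume "eventually P (finite_subsets_at_top UNIV)"
    then obtain K where K: "finite K" "\<And>X. finite X \<Longrightarrow> K \<subseteq> X \<Longrightarrow> P X"
      by (auto simp: eventually_finite_subsets_at_top)
    have "eventually (\<lambda>n. finite (B n) \<and> K \<subseteq> B n) F" using R K(1) by blast
    then show "eventually (\<lambda>x. P (B x)) F" by (rule eventually_mono) (simp add: K(2))
  qed
qed

definition sites :: "nat \<Rightarrow> ('d::finite) zd set" where
  "sites n = site ` {..<n}"

lemma finite_sites [simp]: "finite (sites n)"
  by (simp add: sites_def)

lemma finite_subset_sites:
  fixes \<Lambda> :: "'d::finite zd set"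
  assumes "finite \<Lambda>"
  obtains n where "\<Lambda> \<subseteq> sites n"
proof -
  from site_surj obtain i :: "'d zd \<Rightarrow> nat" where i: "\<And>x. site (i x) = x" by metis
  have "\<Lambda> \<subseteq> sites (Suc (Max (insert 0 (i ` \<Lambda>))))"
  proof
    fix x assume "x \<in> \<Lambda>"
    then have "i x \<le> Max (insert 0 (i ` \<Lambda>))" using assms by (intro Max_ge) auto
    then show "x \<in> sites (Suc (Max (insert 0 (i ` \<Lambda>))))"
      unfolding sites_def using i[of x] by (metis imageI lessThan_iff less_Suc_eq_le)
  qed
  then show thesis by (rule that)
qed

lemma filterlim_sites: "filterlim sites (finite_subsets_at_top UNIV) sequentially"
  unfolding filterlim_finite_subsets_at_top_iff
proof (intro allI impI)
  fix K :: "'d::finite zd set" assume "finite K"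
  then obtain n where "K \<subseteq> sites n" by (rule finite_subset_sites)
  moreover have "sites n \<subseteq> (sites m :: 'd zd set)" if "n \<le> m" for m using that by (auto simp: sites_def)
  ultimately show "eventually (\<lambda>m. finite (sites m) \<and> K \<subseteq> sites m) sequentially"
    unfolding eventually_sequentially by (intro exI[of _ n]) auto
qed

context subcritical
begin

lemma code_inj_on_sites:
  assumes "\<sigma> permutes \<Lambda>" "\<tau> permutes \<Lambda>" "finite \<Lambda>" "\<Lambda> \<subseteq> sites n" "\<And>i. i < n \<Longrightarrow> code \<sigma> i = code \<tau> i"
  shows "\<sigma> = \<tau>"
proof
  fix x
  show "\<sigma> x = \<tau> x"
  proof (cases "x \<in> \<Lambda>")
    case True
    then obtain i where "i < n" "x = site i" using assms(4) by (auto simp: sites_def)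
    then show ?thesis
      using assms(5)[of i] permutes_permutation[OF assms(3,1)] permutes_permutation[OF assms(3,2)]
      by (metis code_eq_iff cyc_self)
  qed (use assms in \<open>auto simp: permutes_def\<close>)
qed

definition zfin :: "'a zd set \<Rightarrow> real \<Rightarrow> 'a zd \<Rightarrow> 'a zd" where
  "zfin \<Lambda> u = (THE \<sigma>. \<sigma> permutes \<Lambda> \<and> (\<forall>n. quant (pfin \<Lambda>) u n = map (code \<sigma>) [0..<n]))"

lemma zfin_unique:
  assumes "finite \<Lambda>" "\<Lambda> \<subseteq> sites n" "\<sigma> permutes \<Lambda>" "\<tau> permutes \<Lambda>"
    "map (code \<sigma>) [0..<n] = map (code \<tau>) [0..<n]"
  shows "\<sigma> = \<tau>"
  using assms(5) by (intro code_inj_on_sites[OF assms(3,4,1,2)]) (auto simp: map_eq_conv)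

text \<open>The word of u has positive mass, since u lies in its half-open interval, so at each
  length some permutation of \<Lambda> carries it. As soon as the enumerated sites cover \<Lambda>
  the word determines that permutation, hence one permutation serves all lengths.\<close>

lemma zfin_props:
  assumes "finite \<Lambda>" "u \<in> {0..<1}"
  shows "zfin \<Lambda> u permutes \<Lambda>" "quant (pfin \<Lambda>) u n = map (code (zfin \<Lambda> u)) [0..<n]"
proof -
  let ?P = "\<lambda>\<sigma>. \<sigma> permutes \<Lambda> \<and> (\<forall>n. quant (pfin \<Lambda>) u n = map (code \<sigma>) [0..<n])"
  have "\<exists>\<sigma>. \<sigma> permutes \<Lambda> \<and> quant (pfin \<Lambda>) u n = map (code \<sigma>) [0..<n]" for n
  proof -
    let ?a = "quant (pfin \<Lambda>) u n"
    have "pfin \<Lambda> ?a \<noteq> 0"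
      using quant_bounds[OF consistent_pfin[OF assms(1)], of u n] assms(2) by auto
    then have "{\<sigma>. \<sigma> permutes \<Lambda> \<and> (\<forall>i<length ?a. code \<sigma> i = ?a ! i)} \<noteq> {}"
      unfolding pfin_def by (metis div_0 sum.empty)
    then obtain \<sigma> where "\<sigma> permutes \<Lambda>" "\<forall>i<n. code \<sigma> i = ?a ! i" by auto
    then show ?thesis by (intro exI[of _ \<sigma>]) (auto intro!: nth_equalityI)
  qed
  then obtain s where s: "\<And>n. s n permutes \<Lambda>" "\<And>n. quant (pfin \<Lambda>) u n = map (code (s n)) [0..<n]" by metis
  obtain N where N: "\<Lambda> \<subseteq> sites N" using finite_subset_sites[OF assms(1)] .
  have "quant (pfin \<Lambda>) u m = map (code (s N)) [0..<m]" for m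
  proof (cases "m \<le> N")
    case True
    have "quant (pfin \<Lambda>) u m = take m (quant (pfin \<Lambda>) u N)" using take_quant[OF True] by simp
    then show ?thesis using True by (simp add: s(2) take_map)
  next
    case False
    then have "map (code (s m)) [0..<N] = map (code (s N)) [0..<N]"
      using take_quant[of N m "pfin \<Lambda>" u] by (simp add: s(2) take_map)
    then have "s m = s N" by (rule zfin_unique[OF assms(1) N s(1) s(1)])
    then show ?thesis using s(2)[of m] by simp
  qed
  then have P: "?P (s N)" using s(1) by blast
  have "\<sigma> = s N" if "?P \<sigma>" for \<sigma>
  proof (rule zfin_unique[OF assms(1) N])
    show "map (code \<sigma>) [0..<N] = map (code (s N)) [0..<N]"
      using that P by metis
  qed (use that P in blast)+
  with P have "?P (zfin \<Lambda> u)" unfolding zfin_def by (rule theI)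
  then show "zfin \<Lambda> u permutes \<Lambda>" "quant (pfin \<Lambda>) u n = map (code (zfin \<Lambda> u)) [0..<n]" by blast+
qed

lemma zfin_eq_iff:
  assumes "finite \<Lambda>" "u \<in> {0..<1}" "\<Lambda> \<subseteq> sites n" "\<sigma> permutes \<Lambda>"
  shows "zfin \<Lambda> u = \<sigma> \<longleftrightarrow> quant (pfin \<Lambda>) u n = map (code \<sigma>) [0..<n]"
proof
  assume "quant (pfin \<Lambda>) u n = map (code \<sigma>) [0..<n]"
  then show "zfin \<Lambda> u = \<sigma>"
    using zfin_props[OF assms(1,2)] by (intro zfin_unique[OF assms(1,3) _ assms(4)]) auto
qed (use zfin_props(2)[OF assms(1,2)] in blast)

lemma zfin_event:
  assumes "finite \<Lambda>" "\<sigma> permutes \<Lambda>"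
  shows "{u \<in> space unit_uniform. zfin \<Lambda> u = \<sigma>} \<in> sets unit_uniform"
    "emeasure unit_uniform {u \<in> space unit_uniform. zfin \<Lambda> u = \<sigma>} = ennreal (W \<sigma> / Z \<Lambda>)"
proof -
  obtain N where N: "\<Lambda> \<subseteq> sites N" using finite_subset_sites[OF assms(1)] .
  let ?a = "map (code \<sigma>) [0..<N]"
  have eq: "{u \<in> space unit_uniform. zfin \<Lambda> u = \<sigma>} = {u \<in> space unit_uniform. quant (pfin \<Lambda>) u (length ?a) = ?a}"
    using zfin_eq_iff[OF assms(1) _ N assms(2)] by (auto simp: space_restrict_space)
  show "{u \<in> space unit_uniform. zfin \<Lambda> u = \<sigma>} \<in> sets unit_uniform"
    unfolding eq by (rule quant_sets[OF consistent_pfin[OF assms(1)]])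
  \<comment> \<open>A word long enough to visit all of \<Lambda> isolates a single permutation, so
    its interval has length exactly \<open>W \<sigma> / Z \<Lambda>\<close>.\<close>
  have "{\<tau>. \<tau> permutes \<Lambda> \<and> (\<forall>i<length ?a. code \<tau> i = ?a ! i)} = {\<sigma>}"
    using assms(2) code_inj_on_sites[OF _ assms(2,1) N] by auto
  then have "pfin \<Lambda> ?a = (\<Sum>\<sigma>\<in>{\<sigma>}. W \<sigma>) / Z \<Lambda>" unfolding pfin_def by (rule arg_cong)
  then show "emeasure unit_uniform {u \<in> space unit_uniform. zfin \<Lambda> u = \<sigma>} = ennreal (W \<sigma> / Z \<Lambda>)"
    unfolding eq emeasure_quant[OF consistent_pfin[OF assms(1)]] by simp
qed

lemma zfin_measurable:
  assumes "finite \<Lambda>"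
  shows "zfin \<Lambda> \<in> unit_uniform \<rightarrow>\<^sub>M Sspace"
proof (rule measurable_SspaceI)
  show "bij (zfin \<Lambda> u)" if "u \<in> space unit_uniform" for u
    using zfin_props(1)[OF assms, of u] that by (auto simp: space_restrict_space permutes_bij)
  show "(\<lambda>u. zfin \<Lambda> u x) \<in> unit_uniform \<rightarrow>\<^sub>M count_space UNIV" for x
    unfolding measurable_count_space_eq2_countable
  proof (intro conjI ballI)
    fix y
    have "(\<lambda>u. zfin \<Lambda> u x) -` {y} \<inter> space unit_uniform =
      (\<Union>\<sigma>\<in>{\<sigma>. \<sigma> permutes \<Lambda> \<and> \<sigma> x = y}. {u \<in> space unit_uniform. zfin \<Lambda> u = \<sigma>})"
      using zfin_props(1)[OF assms] by (auto simp: space_restrict_space)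
    also have "\<dots> \<in> sets unit_uniform"
      using zfin_event(1)[OF assms] finite_subset[OF _ finite_permutations[OF assms], of "{\<sigma>. \<sigma> permutes \<Lambda> \<and> \<sigma> x = y}"]
      by (intro sets.finite_UN) auto
    finally show "(\<lambda>u. zfin \<Lambda> u x) -` {y} \<inter> space unit_uniform \<in> sets unit_uniform" .
  qed auto
qed

lemma Zpart_id: "finite \<Lambda> \<Longrightarrow> Zpart V \<alpha> \<Lambda> id = Z \<Lambda>"
  unfolding Z_def Zpart_eq[OF bij_id] by (intro sum.cong) (auto simp: W_eq_exp_Ham csupp_subset_permutes)

lemma Gibbs_weight:
  "finite \<Lambda> \<Longrightarrow> \<pi> permutes \<Lambda> \<Longrightarrow> exp (- \<alpha> * Ham V \<Lambda> (id \<circ> \<pi>)) / Zpart V \<alpha> \<Lambda> id = W \<pi> / Z \<Lambda>"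
  using W_eq_exp_Ham[OF _ csupp_subset_permutes, of \<Lambda> \<pi>] by (simp add: Zpart_id)

lemma distr_zfin:
  assumes "finite \<Lambda>"
  shows "distr unit_uniform Sspace (zfin \<Lambda>) = Gibbs_fin V \<alpha> \<Lambda> id"
proof (rule measure_eqI)
  fix A assume "A \<in> sets (distr unit_uniform Sspace (zfin \<Lambda>))"
  then have A: "A \<in> sets Sspace" by simp
  let ?S = "{\<sigma>. \<sigma> permutes \<Lambda> \<and> \<sigma> \<in> A}" and ?E = "\<lambda>\<sigma>. {u \<in> space unit_uniform. zfin \<Lambda> u = \<sigma>}"
  have fin: "finite ?S" by (rule finite_subset[OF _ finite_permutations[OF assms]]) auto
  have "emeasure (distr unit_uniform Sspace (zfin \<Lambda>)) A = emeasure unit_uniform (\<Union>\<sigma>\<in>?S. ?E \<sigma>)"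
    using zfin_props(1)[OF assms]
    by (subst emeasure_distr[OF zfin_measurable[OF assms] A])
      (auto intro!: arg_cong[where f="emeasure unit_uniform"] simp: space_restrict_space)
  also have "\<dots> = (\<Sum>\<sigma>\<in>?S. emeasure unit_uniform (?E \<sigma>))"
    using fin zfin_event(1)[OF assms] by (intro sum_emeasure[symmetric]) (auto simp: disjoint_family_on_def)
  also have "\<dots> = (\<Sum>\<sigma>\<in>?S. ennreal (W \<sigma> / Z \<Lambda>))"
    using zfin_event(2)[OF assms] by (intro sum.cong) auto
  also have "\<dots> = (\<Sum>\<sigma> | \<sigma> permutes \<Lambda>. ennreal (W \<sigma> / Z \<Lambda>) * indicator A \<sigma>)"
    using finite_permutations[OF assms] by (auto intro!: sum.mono_neutral_cong_left split: split_indicator)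
  also have "\<dots> = emeasure (Gibbs_fin V \<alpha> \<Lambda> id) A"
    unfolding emeasure_Gibbs_fin[OF assms bij_id A] using Gibbs_weight[OF assms] by (intro sum.cong) auto
  finally show "emeasure (distr unit_uniform Sspace (zfin \<Lambda>)) A = emeasure (Gibbs_fin V \<alpha> \<Lambda> id) A" .
qed simp

definition good :: "real set" where
  "good = {0..<1} - range (lexl pinf)"

text \<open>The letter for site n is the last one of the word of length n + 1, which is eventually
  constant in the volume. The stabilization of the full cycle is what later gives surjectivity of
  the limit.\<close>

lemma zfin_cyc_eventually_const:
  assumes "u \<in> good"
  obtains \<gamma> where "eventually (\<lambda>\<Lambda>. finite \<Lambda> \<and> cyc (zfin \<Lambda> u) x = \<gamma>) (finite_subsets_at_top UNIV)"
proof -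
  let ?F = "finite_subsets_at_top (UNIV :: 'a zd set)"
  obtain n where n: "site n = x" using site_surj by blast
  have u: "u \<in> {0..<1}" "0 \<le> u" "u < 1" "u \<notin> range (lexl pinf)" using assms by (auto simp: good_def)
  have ev: "eventually finite ?F" by (auto simp: eventually_finite_subsets_at_top)
  have "eventually (\<lambda>\<Lambda>. quant (pfin \<Lambda>) u (Suc n) = quant pinf u (Suc n)) ?F"
  proof (rule quant_eventually_eq[where I="{\<Lambda>. finite \<Lambda>}"])
    show "consistent (pfin i)" if "i \<in> {\<Lambda>. finite \<Lambda>}" for i using that by (simp add: consistent_pfin)
  qed (use u ev in \<open>simp_all add: pfin_tendsto consistent_pinf\<close>)
  then have *: "eventually (\<lambda>\<Lambda>. finite \<Lambda> \<and> code (zfin \<Lambda> u) n = quant pinf u (Suc n) ! n) ?F"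
    using ev
  proof eventually_elim
    case (elim \<Lambda>)
    have "quant (pfin \<Lambda>) u (Suc n) ! n = code (zfin \<Lambda> u) n"
      unfolding zfin_props(2)[OF elim(2) u(1)] by (simp del: upt_Suc)
    then show ?case using elim by metis
  qed
  then obtain \<Lambda>0 where \<Lambda>0: "finite \<Lambda>0" "code (zfin \<Lambda>0 u) n = quant pinf u (Suc n) ! n"
    using eventually_happens'[OF finite_subsets_at_top_neq_bot] by blast
  have perm: "permutation (zfin \<Lambda> u)" if "finite \<Lambda>" for \<Lambda>
    using permutes_permutation[OF that zfin_props(1)[OF that u(1)]] .
  show thesis
  proof (rule that[of "cyc (zfin \<Lambda>0 u) x"], rule eventually_mono[OF *])
    fix \<Lambda> assume "finite \<Lambda> \<and> code (zfin \<Lambda> u) n = quant pinf u (Suc n) ! n"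
    then show "finite \<Lambda> \<and> cyc (zfin \<Lambda> u) x = cyc (zfin \<Lambda>0 u) x"
      using code_eq_iff[OF perm perm, of \<Lambda> \<Lambda>0 n] \<Lambda>0 n by simp
  qed
qed

text \<open>Off the almost sure set the identity is used, so that every value is a
  bijection.\<close>

definition zinf :: "real \<Rightarrow> 'a zd \<Rightarrow> 'a zd" where
  "zinf u x = (if u \<in> good then (THE y. eventually (\<lambda>\<Lambda>. zfin \<Lambda> u x = y) (finite_subsets_at_top UNIV)) else x)"

lemma zfin_eventually_zinf:
  assumes "u \<in> good"
  shows "eventually (\<lambda>\<Lambda>. finite \<Lambda> \<and> zfin \<Lambda> u x = zinf u x) (finite_subsets_at_top UNIV)"
proof -
  let ?F = "finite_subsets_at_top (UNIV :: 'a zd set)"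
  have u: "u \<in> {0..<1}" using assms by (auto simp: good_def)
  obtain \<gamma> where g: "eventually (\<lambda>\<Lambda>. finite \<Lambda> \<and> cyc (zfin \<Lambda> u) x = \<gamma>) ?F"
    using zfin_cyc_eventually_const[OF assms] .
  then have ev: "eventually (\<lambda>\<Lambda>. finite \<Lambda> \<and> zfin \<Lambda> u x = \<gamma> x) ?F"
  proof eventually_elim
    case (elim \<Lambda>)
    then have "permutation (zfin \<Lambda> u)" using permutes_permutation zfin_props(1)[OF _ u] by blast
    then show ?case using cyc_self[of "zfin \<Lambda> u" x] elim by simp
  qed
  have "(THE y. eventually (\<lambda>\<Lambda>. zfin \<Lambda> u x = y) ?F) = \<gamma> x"
  proof (rule the_equality)
    show "eventually (\<lambda>\<Lambda>. zfin \<Lambda> u x = \<gamma> x) ?F" using ev by (rule eventually_mono) simp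
    fix y assume "eventually (\<lambda>\<Lambda>. zfin \<Lambda> u x = y) ?F"
    with ev have "eventually (\<lambda>\<Lambda>. y = \<gamma> x) ?F" by eventually_elim simp
    then show "y = \<gamma> x" by simp
  qed
  then show ?thesis using ev assms by (simp add: zinf_def)
qed

text \<open>Injectivity survives any pointwise limit. Surjectivity might fail if preimages ran off
  to infinity; here the eventually constant cycle at y contains the preimage of y in every large
  volume.\<close>

lemma bij_zinf: "bij (zinf u)"
proof (cases "u \<in> good")
  case False
  then have "zinf u = id" by (auto simp: zinf_def)
  then show ?thesis by simp
next
  case True
  let ?F = "finite_subsets_at_top (UNIV :: 'a zd set)"
  have u: "u \<in> {0..<1}" using True by (auto simp: good_def)
  have perm: "permutation (zfin \<Lambda> u)" if "finite \<Lambda>" for \<Lambda>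
    using permutes_permutation[OF that zfin_props(1)[OF that u]] .
  show ?thesis
  proof (rule bijI)
    show "inj (zinf u)"
    proof (rule injI)
      fix x y assume eq: "zinf u x = zinf u y"
      have "eventually (\<lambda>\<Lambda>. x = y) ?F"
        using zfin_eventually_zinf[OF True, of x] zfin_eventually_zinf[OF True, of y]
      proof eventually_elim
        case (elim \<Lambda>)
        then have "zfin \<Lambda> u x = zfin \<Lambda> u y" using eq by simp
        then show ?case using permutation_bijective[OF perm[of \<Lambda>]] elim by (metis bij_is_inj injD)
      qed
      then show "x = y" by simp
    qed
    have "\<exists>z. zinf u z = y" for y
    proof -
      obtain \<gamma> where g: "eventually (\<lambda>\<Lambda>. finite \<Lambda> \<and> cyc (zfin \<Lambda> u) y = \<gamma>) ?F"
        using zfin_cyc_eventually_const[OF True] .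
      then obtain \<Lambda>0 where L0: "finite \<Lambda>0" "cyc (zfin \<Lambda>0 u) y = \<gamma>"
        using eventually_happens'[OF finite_subsets_at_top_neq_bot] by blast
      obtain z where z: "\<gamma> z = y"
        using permutation_bijective[OF permutation_cyc[OF perm[OF L0(1)], of y]] L0(2) by (metis bij_pointE)
      have "eventually (\<lambda>\<Lambda>. zinf u z = y) ?F"
        using g zfin_eventually_zinf[OF True, of z]
      proof eventually_elim
        case (elim \<Lambda>)
        then have "zfin \<Lambda> u z = y" using cyc_eq_selfD[OF perm, of \<Lambda> y z] z by auto
        then show ?case using elim by simp
      qed
      then show ?thesis by auto
    qed
    then show "surj (zinf u)" by (metis surjI)
  qed
qed

lemma good_sets: "good \<in> sets unit_uniform"
proof -
  have "range (lexl pinf) \<in> sets lborel" by (rule sets.countable) simp_all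
  then have "good \<in> sets lborel" unfolding good_def by (intro sets.Diff) simp_all
  moreover have "good \<subseteq> {0..<1}" by (auto simp: good_def)
  ultimately show ?thesis by (subst sets_restrict_space_iff) auto
qed

lemma AE_good: "AE u in unit_uniform. u \<in> good"
proof -
  have "AE u in lborel. u \<notin> range (lexl pinf)"
    by (rule AE_not_in) (auto intro!: countable_imp_null_set_lborel)
  then show ?thesis
    by (subst AE_restrict_space_iff) (auto simp: good_def)
qed

lemma zinf_measurable: "zinf \<in> unit_uniform \<rightarrow>\<^sub>M Sspace"
proof (rule measurable_SspaceI)
  show "bij (zinf u)" for u by (rule bij_zinf)
  show "(\<lambda>u. zinf u x) \<in> unit_uniform \<rightarrow>\<^sub>M count_space UNIV" for x
    unfolding measurable_count_space_eq2_countable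
  proof (intro conjI ballI)
    fix y
    \<comment> \<open>On \<open>good\<close> the limit over all volumes can be read along the
      exhausting sequence \<open>sites\<close>, which leaves only countable set operations.\<close>
    let ?A = "{u \<in> space unit_uniform. \<exists>n. \<forall>m\<in>{n..}. zfin (sites m) u x = y}"
    have A: "?A \<in> sets unit_uniform"
    proof -
      have "{u \<in> space unit_uniform. zfin (sites m) u x = y} \<in> sets unit_uniform" for m
        using measurable_sets_Collect[OF measurable_compose[OF zfin_measurable[OF finite_sites[of m]] measurable_eval[of x]], of "\<lambda>z. z = y"]
        by simp
      then show ?thesis
        by (intro sets.sets_Collect_countable_Ex sets.sets_Collect_countable_Ball) auto
    qed
    have "(zinf u x = y) = (\<exists>n. \<forall>m\<in>{n..}. zfin (sites m) u x = y)" if "u \<in> good" for u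
    proof -
      have "eventually (\<lambda>m. finite (sites m :: 'a zd set) \<and> zfin (sites m) u x = zinf u x) sequentially"
        by (rule eventually_compose_filterlim[OF zfin_eventually_zinf[OF that, of x] filterlim_sites])
      then obtain n0 where n0: "\<And>m. m \<ge> n0 \<Longrightarrow> zfin (sites m) u x = zinf u x"
        by (auto simp: eventually_sequentially)
      show ?thesis
      proof
        assume "\<exists>n. \<forall>m\<in>{n..}. zfin (sites m) u x = y"
        then obtain n where "\<And>m. m \<ge> n \<Longrightarrow> zfin (sites m) u x = y" by auto
        then show "zinf u x = y" using n0[of "max n n0"] by simp
      qed (use n0 in auto)
    qed
    note good_iff = this
    have bad: "zinf u x = x" if "u \<notin> good" for u using that by (simp add: zinf_def)
    have "(\<lambda>u. zinf u x) -` {y} \<inter> space unit_uniform =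
      (good \<inter> ?A) \<union> ((space unit_uniform - good) \<inter> (if x = y then space unit_uniform else {}))"
    proof (rule set_eqI)
      fix u
      show "u \<in> (\<lambda>u. zinf u x) -` {y} \<inter> space unit_uniform \<longleftrightarrow>
        u \<in> (good \<inter> ?A) \<union> ((space unit_uniform - good) \<inter> (if x = y then space unit_uniform else {}))"
        using good_iff[of u] bad[of u] by (cases "u \<in> good") auto
    qed
    also have "\<dots> \<in> sets unit_uniform"
      using good_sets A by (intro sets.Un sets.Int sets.Diff sets.top) (simp_all only: sets.top sets.empty_sets simp_thms split: if_split)
    finally show "(\<lambda>u. zinf u x) -` {y} \<inter> space unit_uniform \<in> sets unit_uniform" .
  qed auto
qed

end

section \<open>The limit law and convergence of integrals\<close>

lemma open_zd_singleton: "open {l :: 'd::finite zd}"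
  unfolding open_vec_def
  by (auto intro!: exI[of _ "\<lambda>i. {l $ i}"] Topological_Spaces.open_discrete simp: vec_eq_iff)

lemma tendsto_zd_iff: "(f \<longlongrightarrow> (l :: 'd::finite zd)) F \<longleftrightarrow> eventually (\<lambda>x. f x = l) F"
proof
  assume "(f \<longlongrightarrow> l) F"
  from topological_tendstoD[OF this open_zd_singleton] show "eventually (\<lambda>x. f x = l) F" by simp
qed (rule tendsto_eventually)

text \<open>The lattice is countable, so a failure of convergence is witnessed along a sequence of
  volumes containing \<open>sites n\<close>. This makes dominated convergence, a statement about
  sequences, available for the net.\<close>

lemma tendsto_finite_subsets_at_top_sequentially:
  fixes g :: "'d::finite zd set \<Rightarrow> 'b::topological_space"
  assumes "\<And>B. filterlim B (finite_subsets_at_top UNIV) sequentially \<Longrightarrow> (\<And>n. finite (B n)) \<Longrightarrow> (\<lambda>n. g (B n)) \<longlonglongrightarrow> l"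
  shows "(g \<longlongrightarrow> l) (finite_subsets_at_top UNIV)"
proof (rule topological_tendstoI, rule ccontr)
  fix S assume S: "open S" "l \<in> S" and "\<not> eventually (\<lambda>x. g x \<in> S) (finite_subsets_at_top UNIV)"
  then have "\<exists>X. finite X \<and> sites n \<subseteq> X \<and> g X \<notin> S" for n
    unfolding eventually_finite_subsets_at_top using finite_sites[of n] by blast
  then obtain B where B: "\<And>n. finite (B n)" "\<And>n. sites n \<subseteq> B n" "\<And>n. g (B n) \<notin> S" by metis
  have "filterlim B (finite_subsets_at_top UNIV) sequentially"
    unfolding filterlim_finite_subsets_at_top_iff
  proof (intro allI impI)
    fix K :: "'d zd set" assume "finite K"
    then have "eventually (\<lambda>n. finite (sites n :: 'd zd set) \<and> K \<subseteq> sites n) sequentially"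
      using filterlim_sites unfolding filterlim_finite_subsets_at_top_iff by blast
    then show "eventually (\<lambda>n. finite (B n) \<and> K \<subseteq> B n) sequentially"
      by (rule eventually_mono) (use B in blast)
  qed
  from topological_tendstoD[OF assms[OF this B(1)] S] have "eventually (\<lambda>n. g (B n) \<in> S) sequentially" .
  then show False using B(3) by simp
qed

text \<open>For nonpositive \<alpha> a single transposition through the origin has weight at least 1
  and length 2, so \<open>beta\<close> would be at least 2. Positivity later bounds the energy
  factors by 1.\<close>

lemma (in subcritical) alpha_pos: "0 < \<alpha>"
proof (rule ccontr)
  assume "\<not> 0 < \<alpha>"
  \<comment> \<open>Here 1 is the all-ones vector, serving as some site other than the
    origin.\<close>
  let ?\<gamma> = "Transposition.transpose (0::'a zd) 1"
  have ne: "(0::'a zd) \<noteq> 1" by (simp add: vec_eq_iff)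
  have supp: "csupp ?\<gamma> = {0, 1}" using ne by (auto simp: csupp_def Transposition.transpose_def)
  have "\<exists>n. (?\<gamma> ^^ n) x = y" if "x \<in> {0, 1}" "y \<in> {0, 1}" for x y
    using that ne by (cases "x = y") (auto intro: exI[of _ 0] exI[of _ 1])
  then have "?\<gamma> \<in> cycles_at 0"
    using ne by (simp add: cycles_at_def is_fcycle_def supp card_insert_if)
  then have "real (card (csupp ?\<gamma>)) * W ?\<gamma> \<le> b"
    using sum_cycles_le_b[of "{?\<gamma>}" 0] by simp
  moreover have "1 \<le> W ?\<gamma>"
    unfolding cweight_def using \<open>\<not> 0 < \<alpha>\<close> V_nonneg by (simp add: mult_nonpos_nonneg sum_nonneg)
  ultimately show False using b_less_1 ne by (simp add: supp card_insert_if)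
qed

text \<open>Everything about the limit law is derived from these coupling properties alone;
  convergence is eventual equality because the lattice is discrete.\<close>

locale gibbs_limit = subcritical V \<alpha> + prob_space M
  for V :: "'d::finite zd \<Rightarrow> real" and \<alpha> and M :: "'w measure" +
  fixes \<zeta> :: "'d zd set \<Rightarrow> 'w \<Rightarrow> 'd zd \<Rightarrow> 'd zd"
  assumes meas [measurable]: "\<zeta> \<Lambda> \<in> M \<rightarrow>\<^sub>M Sspace"
    and law: "finite \<Lambda> \<Longrightarrow> distr M Sspace (\<zeta> \<Lambda>) = Gibbs_fin V \<alpha> \<Lambda> id"
    and conv: "AE \<omega> in M. \<forall>x. eventually (\<lambda>\<Lambda>. \<zeta> \<Lambda> \<omega> x = \<zeta> UNIV \<omega> x) (finite_subsets_at_top UNIV)"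
begin

definition \<mu> :: "('d zd \<Rightarrow> 'd zd) measure" where
  "\<mu> = distr M Sspace (\<zeta> UNIV)"

lemma sets_\<mu> [simp, measurable_cong]: "sets \<mu> = sets Sspace"
  by (simp add: \<mu>_def)

lemma space_\<mu> [simp]: "space \<mu> = {\<sigma>. bij \<sigma>}"
  by (simp add: \<mu>_def space_Sspace)

lemma prob_space_\<mu>: "prob_space \<mu>"
  unfolding \<mu>_def by (rule prob_space_distr) measurable

text \<open>On the common probability space this is dominated convergence along sequences of
  volumes; no separate weak compactness argument is required.\<close>

lemma Gibbs_tendsto:
  fixes f :: "('d zd \<Rightarrow> 'd zd) \<Rightarrow> real"
  assumes f [measurable]: "f \<in> borel_measurable Sspace"
    and bnd: "\<And>\<sigma>. bij \<sigma> \<Longrightarrow> \<bar>f \<sigma>\<bar> \<le> B"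
    and cont: "\<And>s \<sigma>. (\<And>n. bij (s n)) \<Longrightarrow> bij \<sigma> \<Longrightarrow> (\<And>x. eventually (\<lambda>n. s n x = \<sigma> x) sequentially)
      \<Longrightarrow> (\<lambda>n. f (s n)) \<longlonglongrightarrow> f \<sigma>"
  shows "((\<lambda>\<Lambda>. \<integral>\<sigma>. f \<sigma> \<partial>Gibbs_fin V \<alpha> \<Lambda> id) \<longlongrightarrow> (\<integral>\<sigma>. f \<sigma> \<partial>\<mu>)) (finite_subsets_at_top UNIV)"
proof (rule tendsto_finite_subsets_at_top_sequentially)
  fix B' :: "nat \<Rightarrow> 'd zd set"
  assume B': "filterlim B' (finite_subsets_at_top UNIV) sequentially" "\<And>n. finite (B' n)"
  have bij: "bij (\<zeta> \<Lambda> \<omega>)" if "\<omega> \<in> space M" for \<Lambda> \<omega>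
    using measurable_space[OF meas that] by (simp add: space_Sspace)
  have "(\<lambda>n. \<integral>\<omega>. f (\<zeta> (B' n) \<omega>) \<partial>M) \<longlonglongrightarrow> (\<integral>\<omega>. f (\<zeta> UNIV \<omega>) \<partial>M)"
  proof (rule integral_dominated_convergence[where w="\<lambda>_. B"])
    show "AE \<omega> in M. (\<lambda>n. f (\<zeta> (B' n) \<omega>)) \<longlonglongrightarrow> f (\<zeta> UNIV \<omega>)"
      using conv AE_space
    proof eventually_elim
      case (elim \<omega>)
      show ?case
      proof (rule cont)
        show "eventually (\<lambda>n. \<zeta> (B' n) \<omega> x = \<zeta> UNIV \<omega> x) sequentially" for x
          using elim(1) B'(1) by (auto simp: filterlim_iff)
      qed (use elim bij in auto)
    qed
    show "AE \<omega> in M. norm (f (\<zeta> (B' n) \<omega>)) \<le> B" for n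
      using bnd bij by (intro AE_I2) auto
  qed measurable
  moreover have "(\<integral>\<omega>. f (\<zeta> (B' n) \<omega>) \<partial>M) = (\<integral>\<sigma>. f \<sigma> \<partial>Gibbs_fin V \<alpha> (B' n) id)" for n
    unfolding law[OF B'(2), symmetric] by (rule integral_distr[symmetric]) measurable
  moreover have "(\<integral>\<omega>. f (\<zeta> UNIV \<omega>) \<partial>M) = (\<integral>\<sigma>. f \<sigma> \<partial>\<mu>)"
    unfolding \<mu>_def by (rule integral_distr[symmetric]) measurable
  ultimately show "(\<lambda>n. \<integral>\<sigma>. f \<sigma> \<partial>Gibbs_fin V \<alpha> (B' n) id) \<longlonglongrightarrow> (\<integral>\<sigma>. f \<sigma> \<partial>\<mu>)" by simp
qed

lemma Gibbs_tendsto_local: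
  fixes f :: "('d zd \<Rightarrow> 'd zd) \<Rightarrow> real"
  assumes f [measurable]: "f \<in> borel_measurable Sspace"
    and bnd: "\<And>\<sigma>. bij \<sigma> \<Longrightarrow> \<bar>f \<sigma>\<bar> \<le> B"
    and J: "finite J" "\<And>\<sigma> \<tau>. bij \<sigma> \<Longrightarrow> bij \<tau> \<Longrightarrow> (\<And>x. x \<in> J \<Longrightarrow> \<sigma> x = \<tau> x) \<Longrightarrow> f \<sigma> = f \<tau>"
  shows "((\<lambda>\<Lambda>. \<integral>\<sigma>. f \<sigma> \<partial>Gibbs_fin V \<alpha> \<Lambda> id) \<longlongrightarrow> (\<integral>\<sigma>. f \<sigma> \<partial>\<mu>)) (finite_subsets_at_top UNIV)"
proof (rule Gibbs_tendsto[OF f bnd])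
  fix s :: "nat \<Rightarrow> 'd zd \<Rightarrow> 'd zd" and \<sigma> assume s: "\<And>n. bij (s n)" "bij \<sigma>" "\<And>x. eventually (\<lambda>n. s n x = \<sigma> x) sequentially"
  have "eventually (\<lambda>n. \<forall>x\<in>J. s n x = \<sigma> x) sequentially"
    using s(3) by (intro eventually_ball_finite J) auto
  then have "eventually (\<lambda>n. f (s n) = f \<sigma>) sequentially"
    by (rule eventually_mono) (use s(1,2) in \<open>auto intro: J(2)\<close>)
  then show "(\<lambda>n. f (s n)) \<longlonglongrightarrow> f \<sigma>" by (rule tendsto_eventually)
qed

lemma integral_Gibbs_id:
  fixes f :: "('d zd \<Rightarrow> 'd zd) \<Rightarrow> real"
  assumes "finite \<Lambda>" "f \<in> borel_measurable Sspace"
  shows "(\<integral>\<sigma>. f \<sigma> \<partial>Gibbs_fin V \<alpha> \<Lambda> id) = (\<Sum>\<sigma> | \<sigma> permutes \<Lambda>. W \<sigma> * f \<sigma>) / Z \<Lambda>"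
  unfolding integral_Gibbs_fin[OF assms(1) bij_id assms(2)] sum_divide_distrib
  using Gibbs_weight[OF assms(1)] by (intro sum.cong) auto

lemma measure_eq_integral: "A \<in> sets Sspace \<Longrightarrow> measure \<mu> A = (\<integral>\<sigma>. indicator A \<sigma> \<partial>\<mu>)"
  using sets.sets_into_space[of A Sspace] by (simp add: space_Sspace Int_absorb1 Int_absorb2)

lemma indicator_cyl_local:
  "bij \<sigma> \<Longrightarrow> bij \<tau> \<Longrightarrow> (\<And>x. x \<in> fst ` L \<Longrightarrow> \<sigma> x = \<tau> x) \<Longrightarrow> indicator (cyl L) \<sigma> = (indicator (cyl L) \<tau> :: real)"
  by (auto simp: indicator_def cyl_def) (force)+

section \<open>Invariance under lattice isometries\<close>

text \<open>Conjugation carries the Gibbs measure on \<Lambda> to that on the image of \<Lambda>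
  under g, and these images exhaust the lattice together with \<Lambda>, so both nets have the same
  limit on cylinders.\<close>

lemma distr_conj_by:
  assumes g: "bij g" "\<And>x y. V (g x - g y) = V (x - y)"
  shows "distr \<mu> Sspace (conj_by g) = \<mu>"
proof (rule Sspace_measure_eqI)
  note [measurable] = measurable_conj_by[OF g(1)]
  show "finite_measure (distr \<mu> Sspace (conj_by g))"
    by (intro prob_space.finite_measure prob_space.prob_space_distr prob_space_\<mu>) measurable
  fix L :: "('d zd \<times> 'd zd) set" assume L: "finite L"
  let ?F = "finite_subsets_at_top (UNIV :: 'd zd set)"
  let ?f = "indicator (cyl L) :: _ \<Rightarrow> real"
  have [measurable]: "cyl L \<in> sets Sspace" using cyl_sets[OF L] .
  have lim1: "((\<lambda>\<Lambda>. \<integral>\<sigma>. ?f (conj_by g \<sigma>) \<partial>Gibbs_fin V \<alpha> \<Lambda> id) \<longlongrightarrow> (\<integral>\<sigma>. ?f (conj_by g \<sigma>) \<partial>\<mu>)) ?F"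
  proof (rule Gibbs_tendsto_local[where B=1 and J="inv g ` fst ` L"])
    fix \<sigma> \<tau> :: "'d zd \<Rightarrow> 'd zd" assume "bij \<sigma>" "bij \<tau>" "\<And>x. x \<in> inv g ` fst ` L \<Longrightarrow> \<sigma> x = \<tau> x"
    then show "?f (conj_by g \<sigma>) = ?f (conj_by g \<tau>)"
      using g(1) by (intro indicator_cyl_local bij_conj_by) (auto simp: conj_by_def)
  qed (use L in \<open>auto simp: indicator_def\<close>)
  have lim2: "((\<lambda>\<Lambda>. \<integral>\<sigma>. ?f \<sigma> \<partial>Gibbs_fin V \<alpha> \<Lambda> id) \<longlongrightarrow> (\<integral>\<sigma>. ?f \<sigma> \<partial>\<mu>)) ?F"
    by (rule Gibbs_tendsto_local[where B=1 and J="fst ` L"])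
      (use L in \<open>auto intro: indicator_cyl_local simp: indicator_le_1\<close>)
  have "filterlim (image g) ?F ?F"
    unfolding filterlim_finite_subsets_at_top_iff
  proof (intro allI impI)
    fix K :: "'d zd set" assume "finite K"
    then have "eventually (\<lambda>X. finite X \<and> inv g ` K \<subseteq> X) ?F"
      by (auto simp: eventually_finite_subsets_at_top)
    then show "eventually (\<lambda>X. finite (g ` X) \<and> K \<subseteq> g ` X) ?F"
      by (rule eventually_mono) (use g(1) in \<open>auto simp: image_subset_iff intro: image_eqI[of _ g "inv g x" for x] simp: bij_is_surj surj_f_inv_f\<close>)
  qed
  from filterlim_compose[OF lim2 this]
  have "((\<lambda>\<Lambda>. \<integral>\<sigma>. ?f \<sigma> \<partial>Gibbs_fin V \<alpha> (g ` \<Lambda>) id) \<longlongrightarrow> (\<integral>\<sigma>. ?f \<sigma> \<partial>\<mu>)) ?F" .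
  moreover have "eventually (\<lambda>\<Lambda>. (\<integral>\<sigma>. ?f \<sigma> \<partial>Gibbs_fin V \<alpha> (g ` \<Lambda>) id) = (\<integral>\<sigma>. ?f (conj_by g \<sigma>) \<partial>Gibbs_fin V \<alpha> \<Lambda> id)) ?F"
    unfolding eventually_finite_subsets_at_top
  proof (intro exI[of _ "{}"] conjI allI impI)
    fix \<Lambda> :: "'d zd set" assume "finite \<Lambda> \<and> {} \<subseteq> \<Lambda> \<and> \<Lambda> \<subseteq> UNIV"
    then have fin: "finite \<Lambda>" by simp
    have "(\<Sum>\<sigma> | \<sigma> permutes g ` \<Lambda>. W \<sigma> * ?f \<sigma>) = (\<Sum>\<sigma> | \<sigma> permutes \<Lambda>. W \<sigma> * ?f (conj_by g \<sigma>))"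
    proof (rule sum.reindex_bij_witness[of _ "conj_by g" "conj_by (inv g)"], goal_cases)
      case (2 \<sigma>)
      then show ?case
        using conj_by_permutes[OF bij_imp_bij_inv[OF g(1)], of \<sigma> "g ` \<Lambda>"] g(1)
        by (simp add: image_comp bij_is_inj)
    next
      case (5 \<sigma>)
      have "W \<sigma> = W (conj_by g (conj_by (inv g) \<sigma>))" by (simp add: inv_conj_by g)
      also have "\<dots> = W (conj_by (inv g) \<sigma>)" by (rule cweight_conj_by[OF g])
      finally show ?case by (simp add: inv_conj_by g)
    qed (use g in \<open>auto simp: conj_by_permutes conj_by_inv inv_conj_by\<close>)
    then show "(\<integral>\<sigma>. ?f \<sigma> \<partial>Gibbs_fin V \<alpha> (g ` \<Lambda>) id) = (\<integral>\<sigma>. ?f (conj_by g \<sigma>) \<partial>Gibbs_fin V \<alpha> \<Lambda> id)"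
      using fin by (subst (1 2) integral_Gibbs_id) (simp_all add: Z_image[OF g])
  qed auto
  ultimately have "((\<lambda>\<Lambda>. \<integral>\<sigma>. ?f (conj_by g \<sigma>) \<partial>Gibbs_fin V \<alpha> \<Lambda> id) \<longlongrightarrow> (\<integral>\<sigma>. ?f \<sigma> \<partial>\<mu>)) ?F"
    by (rule Lim_transform_eventually)
  from tendsto_unique[OF finite_subsets_at_top_neq_bot lim1 this]
  have "(\<integral>\<sigma>. ?f (conj_by g \<sigma>) \<partial>\<mu>) = (\<integral>\<sigma>. ?f \<sigma> \<partial>\<mu>)" .
  moreover have "(\<integral>\<sigma>. ?f (conj_by g \<sigma>) \<partial>\<mu>) = (\<integral>\<sigma>. ?f \<sigma> \<partial>distr \<mu> Sspace (conj_by g))"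
    by (rule integral_distr[symmetric]) measurable
  moreover have "(\<integral>\<sigma>. ?f \<sigma> \<partial>N) = measure N (cyl L)" if "sets N = sets Sspace" for N
    using sets_eq_imp_space_eq[OF that] by (simp add: space_Sspace cyl_def Int_def conj_ac)
  ultimately have "measure (distr \<mu> Sspace (conj_by g)) (cyl L) = measure \<mu> (cyl L)"
    by (metis sets_\<mu> sets_distr)
  moreover have "prob_space (distr \<mu> Sspace (conj_by g))"
    by (intro prob_space.prob_space_distr prob_space_\<mu>) measurable
  ultimately show "emeasure (distr \<mu> Sspace (conj_by g)) (cyl L) = emeasure \<mu> (cyl L)"
    using prob_space_\<mu> by (simp add: finite_measure.emeasure_eq_measure prob_space.finite_measure)
qed simp_all

section \<open>Quasi-invariance under finite permutations\<close>

text \<open>In a volume containing \<Lambda> this is the substitution of \<sigma> composed with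
  \<pi> for \<sigma>. Placing an energy factor on each side, rather than their quotient on one,
  keeps both factors local and bounded by 1, so the identity survives the limit.\<close>

lemma quasi_invariant:
  assumes "finite \<Lambda>" "\<pi> permutes \<Lambda>" "f \<in> borel_measurable Sspace"
  shows "(\<integral>\<^sup>+\<xi>. ennreal (exp (- \<alpha> * Ham V \<Lambda> (\<xi> \<circ> \<pi>))) * f (\<xi> \<circ> \<pi>) \<partial>\<mu>) =
    (\<integral>\<^sup>+\<xi>. ennreal (exp (- \<alpha> * Ham V \<Lambda> (\<xi> \<circ> inv \<pi>))) * f \<xi> \<partial>\<mu>)"
proof -
  let ?F = "finite_subsets_at_top (UNIV :: 'd zd set)"
  note [measurable] = assms(3) measurable_comp_right[OF permutes_bij[OF assms(2)]]
    measurable_comp_right[OF permutes_bij[OF permutes_inv[OF assms(2)]]]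
  interpret mu: prob_space \<mu> by (rule prob_space_\<mu>)
  define h where "h \<rho> \<xi> = exp (- \<alpha> * Ham V \<Lambda> (\<xi> \<circ> \<rho>))" for \<rho> \<xi> :: "'d zd \<Rightarrow> 'd zd"
  have h [measurable]: "h \<pi> \<in> borel_measurable Sspace" "h (inv \<pi>) \<in> borel_measurable Sspace"
    unfolding h_def[abs_def] by measurable
  have h01: "0 \<le> h \<rho> \<xi>" "h \<rho> \<xi> \<le> 1" for \<rho> \<xi>
    using alpha_pos V_nonneg by (auto simp: h_def Ham_def sum_nonneg)
  have hloc: "h \<rho> \<sigma> = h \<rho> \<tau>" if "\<And>x. x \<in> \<rho> ` \<Lambda> \<Longrightarrow> \<sigma> x = \<tau> x" for \<rho> \<sigma> \<tau>
    unfolding h_def Ham_def using that by (auto intro!: sum.cong)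
  let ?M1 = "distr (density \<mu> (\<lambda>\<xi>. ennreal (h \<pi> \<xi>))) Sspace (\<lambda>\<xi>. \<xi> \<circ> \<pi>)"
  let ?M2 = "density \<mu> (\<lambda>\<xi>. ennreal (h (inv \<pi>) \<xi>))"
  \<comment> \<open>The limit is taken only for cylinders; equality of these two finite measures
    then yields the identity for every measurable f.\<close>
  have "?M1 = ?M2"
  proof (rule Sspace_measure_eqI)
    have bd: "finite_measure (density \<mu> (\<lambda>\<xi>. ennreal (h \<rho> \<xi>)))" if "h \<rho> \<in> borel_measurable Sspace" for \<rho>
    proof
      have "emeasure (density \<mu> (\<lambda>\<xi>. ennreal (h \<rho> \<xi>))) (space \<mu>) = (\<integral>\<^sup>+\<xi>. ennreal (h \<rho> \<xi>) * indicator (space \<mu>) \<xi> \<partial>\<mu>)"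
        using that by (intro emeasure_density sets.top) measurable
      also have "\<dots> \<le> (\<integral>\<^sup>+\<xi>. indicator (space \<mu>) \<xi> \<partial>\<mu>)"
        by (intro nn_integral_mono) (auto simp: h01 split: split_indicator)
      also have "\<dots> = 1" unfolding nn_integral_indicator[OF sets.top] by (rule mu.emeasure_space_1)
      finally show "emeasure (density \<mu> (\<lambda>\<xi>. ennreal (h \<rho> \<xi>))) (space (density \<mu> (\<lambda>\<xi>. ennreal (h \<rho> \<xi>)))) \<noteq> \<infinity>"
        unfolding space_density by (metis ennreal_one_less_top infinity_ennreal_def leD)
    qed
    show "finite_measure ?M1"
      by (intro finite_measure.finite_measure_distr bd h) measurable
    fix L :: "('d zd \<times> 'd zd) set" assume L: "finite L"
    let ?f = "indicator (cyl L) :: _ \<Rightarrow> real"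
    have [measurable]: "cyl L \<in> sets Sspace" using cyl_sets[OF L] .
    have lim1: "((\<lambda>\<Delta>. \<integral>\<sigma>. h \<pi> \<sigma> * ?f (\<sigma> \<circ> \<pi>) \<partial>Gibbs_fin V \<alpha> \<Delta> id) \<longlongrightarrow> (\<integral>\<sigma>. h \<pi> \<sigma> * ?f (\<sigma> \<circ> \<pi>) \<partial>\<mu>)) ?F"
    proof (rule Gibbs_tendsto_local[where B=1 and J="\<pi> ` (fst ` L \<union> \<Lambda>)"])
      fix \<sigma> \<tau> :: "'d zd \<Rightarrow> 'd zd" assume *: "bij \<sigma>" "bij \<tau>" "\<And>x. x \<in> \<pi> ` (fst ` L \<union> \<Lambda>) \<Longrightarrow> \<sigma> x = \<tau> x"
      have "?f (\<sigma> \<circ> \<pi>) = ?f (\<tau> \<circ> \<pi>)"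
        using * permutes_bij[OF assms(2)] by (intro indicator_cyl_local) (auto simp: bij_comp)
      then show "h \<pi> \<sigma> * ?f (\<sigma> \<circ> \<pi>) = h \<pi> \<tau> * ?f (\<tau> \<circ> \<pi>)" using hloc[of \<pi> \<sigma> \<tau>] * by auto
    qed (use L assms(1) h01 in \<open>auto simp: indicator_def\<close>)
    have lim2: "((\<lambda>\<Delta>. \<integral>\<sigma>. h (inv \<pi>) \<sigma> * ?f \<sigma> \<partial>Gibbs_fin V \<alpha> \<Delta> id) \<longlongrightarrow> (\<integral>\<sigma>. h (inv \<pi>) \<sigma> * ?f \<sigma> \<partial>\<mu>)) ?F"
    proof (rule Gibbs_tendsto_local[where B=1 and J="fst ` L \<union> inv \<pi> ` \<Lambda>"])
      fix \<sigma> \<tau> :: "'d zd \<Rightarrow> 'd zd" assume *: "bij \<sigma>" "bij \<tau>" "\<And>x. x \<in> fst ` L \<union> inv \<pi> ` \<Lambda> \<Longrightarrow> \<sigma> x = \<tau> x"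
      have "?f \<sigma> = ?f \<tau>" using * by (intro indicator_cyl_local) auto
      then show "h (inv \<pi>) \<sigma> * ?f \<sigma> = h (inv \<pi>) \<tau> * ?f \<tau>" using hloc[of "inv \<pi>" \<sigma> \<tau>] * by auto
    qed (use L assms(1) h01 in \<open>auto simp: indicator_def\<close>)
    have "eventually (\<lambda>\<Delta>. (\<integral>\<sigma>. h \<pi> \<sigma> * ?f (\<sigma> \<circ> \<pi>) \<partial>Gibbs_fin V \<alpha> \<Delta> id) = (\<integral>\<sigma>. h (inv \<pi>) \<sigma> * ?f \<sigma> \<partial>Gibbs_fin V \<alpha> \<Delta> id)) ?F"
      unfolding eventually_finite_subsets_at_top
    proof (intro exI[of _ \<Lambda>] conjI allI impI assms)
      fix \<Delta> assume "finite \<Delta> \<and> \<Lambda> \<subseteq> \<Delta> \<and> \<Delta> \<subseteq> UNIV"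
      then have \<Delta>: "finite \<Delta>" "\<Lambda> \<subseteq> \<Delta>" by auto
      have \<pi>\<Delta>: "\<pi> permutes \<Delta>" using permutes_subset[OF assms(2) \<Delta>(2)] .
      \<comment> \<open>Outside \<Lambda> the two permutations coincide, so both products contain
        the energies of \<sigma> and of \<sigma> composed with \<pi> on \<Lambda> once each, and one
        common energy outside.\<close>
      have Wh: "W \<sigma> * h \<pi> \<sigma> = W (\<sigma> \<circ> \<pi>) * h id \<sigma>" if s: "\<sigma> permutes \<Delta>" for \<sigma>
      proof -
        have split: "Ham V \<Delta> t = Ham V \<Lambda> t + Ham V (\<Delta> - \<Lambda>) t" for t
          unfolding Ham_def using \<Delta> by (subst sum.subset_diff[of \<Lambda>]) auto
        have "Ham V (\<Delta> - \<Lambda>) (\<sigma> \<circ> \<pi>) = Ham V (\<Delta> - \<Lambda>) \<sigma>"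
          unfolding Ham_def using permutes_not_in[OF assms(2)] by (intro sum.cong) auto
        moreover have "W \<sigma> = exp (- \<alpha> * Ham V \<Delta> \<sigma>)" "W (\<sigma> \<circ> \<pi>) = exp (- \<alpha> * Ham V \<Delta> (\<sigma> \<circ> \<pi>))"
          using \<Delta>(1) s permutes_compose[OF \<pi>\<Delta> s] by (intro W_eq_exp_Ham csupp_subset_permutes; simp)+
        ultimately show ?thesis
          unfolding h_def by (simp add: split exp_add[symmetric] algebra_simps)
      qed
      have "(\<Sum>\<sigma> | \<sigma> permutes \<Delta>. W \<sigma> * (h \<pi> \<sigma> * ?f (\<sigma> \<circ> \<pi>))) = (\<Sum>\<sigma> | \<sigma> permutes \<Delta>. W \<sigma> * (h (inv \<pi>) \<sigma> * ?f \<sigma>))"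
      proof (rule sum.reindex_bij_witness[of _ "\<lambda>\<sigma>. \<sigma> \<circ> inv \<pi>" "\<lambda>\<sigma>. \<sigma> \<circ> \<pi>"], goal_cases)
        case (1 \<sigma>)
        then show ?case using permutes_inv_o(1)[OF assms(2)] by (simp add: comp_assoc)
      next
        case (2 \<sigma>)
        then show ?case using permutes_compose[OF \<pi>\<Delta>] by simp
      next
        case (3 \<sigma>)
        then show ?case using permutes_inv_o(2)[OF assms(2)] by (simp add: comp_assoc)
      next
        case (4 \<sigma>)
        then show ?case using permutes_compose[OF permutes_inv[OF \<pi>\<Delta>]] by simp
      next
        case (5 \<sigma>)
        then have "W \<sigma> * h \<pi> \<sigma> = W (\<sigma> \<circ> \<pi>) * h id \<sigma>" using Wh by simp
        moreover have "h (inv \<pi>) (\<sigma> \<circ> \<pi>) = h id \<sigma>"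
          unfolding h_def using permutes_inv_o(1)[OF assms(2)] by (simp add: comp_assoc)
        ultimately show ?case by (simp add: mult.assoc[symmetric])
      qed
      then show "(\<integral>\<sigma>. h \<pi> \<sigma> * ?f (\<sigma> \<circ> \<pi>) \<partial>Gibbs_fin V \<alpha> \<Delta> id) = (\<integral>\<sigma>. h (inv \<pi>) \<sigma> * ?f \<sigma> \<partial>Gibbs_fin V \<alpha> \<Delta> id)"
        by (subst (1 2) integral_Gibbs_id[OF \<Delta>(1)]) simp_all
    qed auto
    then have eq: "(\<integral>\<sigma>. h \<pi> \<sigma> * ?f (\<sigma> \<circ> \<pi>) \<partial>\<mu>) = (\<integral>\<sigma>. h (inv \<pi>) \<sigma> * ?f \<sigma> \<partial>\<mu>)"
      using tendsto_unique[OF finite_subsets_at_top_neq_bot Lim_transform_eventually[OF lim1] lim2] by blast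
    have "emeasure ?M1 (cyl L) = (\<integral>\<^sup>+\<xi>. ennreal (h \<pi> \<xi> * ?f (\<xi> \<circ> \<pi>)) \<partial>\<mu>)"
    proof -
      have "emeasure ?M1 (cyl L) = (\<integral>\<^sup>+\<xi>. indicator (cyl L) \<xi> \<partial>?M1)" by simp
      also have "\<dots> = (\<integral>\<^sup>+\<xi>. indicator (cyl L) (\<xi> \<circ> \<pi>) \<partial>density \<mu> (\<lambda>\<xi>. ennreal (h \<pi> \<xi>)))"
        by (rule nn_integral_distr) measurable
      also have "\<dots> = (\<integral>\<^sup>+\<xi>. ennreal (h \<pi> \<xi>) * indicator (cyl L) (\<xi> \<circ> \<pi>) \<partial>\<mu>)"
        by (rule nn_integral_density) measurable
      also have "\<dots> = (\<integral>\<^sup>+\<xi>. ennreal (h \<pi> \<xi> * ?f (\<xi> \<circ> \<pi>)) \<partial>\<mu>)"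
        by (intro nn_integral_cong) (auto split: split_indicator)
      finally show ?thesis .
    qed
    also have "\<dots> = ennreal (\<integral>\<xi>. h \<pi> \<xi> * ?f (\<xi> \<circ> \<pi>) \<partial>\<mu>)"
      by (intro nn_integral_eq_integral mu.integrable_const_bound[where B=1] AE_I2)
        (auto simp: h01 split: split_indicator)
    also have "\<dots> = ennreal (\<integral>\<xi>. h (inv \<pi>) \<xi> * ?f \<xi> \<partial>\<mu>)" by (simp add: eq)
    also have "\<dots> = (\<integral>\<^sup>+\<xi>. ennreal (h (inv \<pi>) \<xi> * ?f \<xi>) \<partial>\<mu>)"
      by (intro nn_integral_eq_integral[symmetric] mu.integrable_const_bound[where B=1] AE_I2)
        (auto simp: h01 split: split_indicator)
    also have "\<dots> = (\<integral>\<^sup>+\<xi>. ennreal (h (inv \<pi>) \<xi>) * indicator (cyl L) \<xi> \<partial>\<mu>)"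
      by (intro nn_integral_cong) (auto split: split_indicator)
    also have "\<dots> = emeasure ?M2 (cyl L)"
      by (rule emeasure_density[symmetric]) measurable
    finally show "emeasure ?M1 (cyl L) = emeasure ?M2 (cyl L)" .
  qed simp_all
  then have "(\<integral>\<^sup>+\<xi>. f \<xi> \<partial>?M1) = (\<integral>\<^sup>+\<xi>. f \<xi> \<partial>?M2)" by simp
  also have "(\<integral>\<^sup>+\<xi>. f \<xi> \<partial>?M1) = (\<integral>\<^sup>+\<xi>. f (\<xi> \<circ> \<pi>) \<partial>density \<mu> (\<lambda>\<xi>. ennreal (h \<pi> \<xi>)))"
    by (rule nn_integral_distr) measurable
  also have "\<dots> = (\<integral>\<^sup>+\<xi>. ennreal (h \<pi> \<xi>) * f (\<xi> \<circ> \<pi>) \<partial>\<mu>)"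
    by (rule nn_integral_density) measurable
  also have "(\<integral>\<^sup>+\<xi>. f \<xi> \<partial>?M2) = (\<integral>\<^sup>+\<xi>. ennreal (h (inv \<pi>) \<xi>) * f \<xi> \<partial>\<mu>)"
    by (rule nn_integral_density) measurable
  finally show ?thesis by (simp add: h_def)
qed

end

section \<open>Mixing\<close>

text \<open>The sets with the asserted convergence form a Dynkin class: \<open>space\<close> handles
  complements, and domination of \<open>N n\<close> by \<nu> lets Tannery's theorem handle disjoint
  unions.\<close>

lemma tendsto_dynkin:
  fixes N :: "nat \<Rightarrow> 'a measure" and \<nu> :: "'a measure" and c :: real
  assumes "Int_stable G" "G \<subseteq> sets \<nu>" "finite_measure \<nu>"
    and N: "\<And>n. finite_measure (N n)" "\<And>n. sets (N n) = sets \<nu>"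
    and le: "\<And>n B. B \<in> sets \<nu> \<Longrightarrow> measure (N n) B \<le> measure \<nu> B"
    and space: "(\<lambda>n. measure (N n) (space \<nu>)) \<longlonglongrightarrow> c * measure \<nu> (space \<nu>)"
    and G: "\<And>B. B \<in> G \<Longrightarrow> (\<lambda>n. measure (N n) B) \<longlonglongrightarrow> c * measure \<nu> B"
    and B: "B \<in> sigma_sets (space \<nu>) G"
  shows "(\<lambda>n. measure (N n) B) \<longlonglongrightarrow> c * measure \<nu> B"
proof -
  interpret \<nu>: finite_measure \<nu> by fact
  have sub: "sigma_sets (space \<nu>) G \<subseteq> sets \<nu>" using assms(2) by (rule sets.sigma_sets_subset)
  have sp: "space (N n) = space \<nu>" for n using sets_eq_imp_space_eq[OF N(2)] .
  have GP: "G \<subseteq> Pow (space \<nu>)" using assms(2) sets.sets_into_space by blast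
  from assms(1) GP B show ?thesis
  proof (induction rule: sigma_sets_induct_disjoint)
    case (basic A)
    then show ?case by (rule G)
  next
    case empty
    then show ?case by simp
  next
    case (compl A)
    then have A: "A \<in> sets \<nu>" using sub by blast
    have "measure (N n) (space \<nu> - A) = measure (N n) (space \<nu>) - measure (N n) A" for n
      using finite_measure.finite_measure_compl[OF N(1), of A n] A by (simp add: N(2) sp)
    moreover have "measure \<nu> (space \<nu> - A) = measure \<nu> (space \<nu>) - measure \<nu> A"
      by (rule \<nu>.finite_measure_compl[OF A])
    ultimately show ?case using tendsto_diff[OF space compl(2)] by (simp add: right_diff_distrib)
  next
    case (union A)
    have A: "range A \<subseteq> sets \<nu>" using union(2) sub by blast
    have sums: "(\<lambda>i. measure \<nu> (A i)) sums measure \<nu> (\<Union>i. A i)"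
      by (rule \<nu>.finite_measure_UNION[OF A union(1)])
    have sumsN: "(\<lambda>i. measure (N n) (A i)) sums measure (N n) (\<Union>i. A i)" for n
      using A union(1) N(2)[of n] by (intro finite_measure.finite_measure_UNION[OF N(1)]) auto
    have "eventually (\<lambda>n. summable (\<lambda>k. norm (measure (N n) (A k)))) sequentially \<and>
      summable (\<lambda>k. norm (c * measure \<nu> (A k))) \<and>
      ((\<lambda>n. \<Sum>k. measure (N n) (A k)) \<longlonglongrightarrow> (\<Sum>k. c * measure \<nu> (A k)))"
    proof (rule tannerys_theorem[OF _ _ sums_summable[OF sums]])
      show "\<forall>\<^sub>F (k, n) in sequentially \<times>\<^sub>F sequentially. norm (measure (N n) (A k)) \<le> measure \<nu> (A k)"
        using A by (intro always_eventually) (auto intro!: le)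
    qed (use union(3) in auto)
    then have "(\<lambda>n. \<Sum>k. measure (N n) (A k)) \<longlonglongrightarrow> (\<Sum>k. c * measure \<nu> (A k))" by blast
    then show ?case
      using sums_unique[OF sumsN] sums_unique[OF sums_mult[OF sums, of c]] by simp
  qed
qed

section \<open>Events prescribing finite unions of cycles\<close>

definition ext_event :: "('d::finite) zd set \<Rightarrow> ('d zd \<Rightarrow> 'd zd) \<Rightarrow> ('d zd \<Rightarrow> 'd zd) set" where
  "ext_event F \<pi> = {\<sigma>. bij \<sigma> \<and> (\<forall>x\<in>F. \<sigma> x = \<pi> x)}"

lemma ext_event_cyl: "ext_event F \<pi> = cyl ((\<lambda>x. (x, \<pi> x)) ` F)"
  by (auto simp: ext_event_def cyl_def)

lemma ext_event_sets: "finite F \<Longrightarrow> ext_event F \<pi> \<in> sets Sspace"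
  unfolding ext_event_cyl by (intro cyl_sets) auto

definition ext_events :: "('d::finite zd \<Rightarrow> 'd zd) set set" where
  "ext_events = insert {} {ext_event F \<pi> | F \<pi>. finite F \<and> \<pi> permutes F}"

lemma ext_events_sets: "ext_events \<subseteq> sets Sspace"
  by (auto simp: ext_events_def ext_event_sets)

text \<open>A common element \<sigma> maps F and F' onto themselves, so its restriction to the union
  is again a permutation and describes the intersection.\<close>

lemma Int_stable_ext_events: "Int_stable ext_events"
proof (rule Int_stableI)
  fix A B :: "('d::finite zd \<Rightarrow> 'd zd) set" assume AB: "A \<in> ext_events" "B \<in> ext_events"
  show "A \<inter> B \<in> ext_events"
  proof (cases "A \<inter> B = {}")
    case True
    then show ?thesis by (simp add: ext_events_def)
  next
    case False
    with AB obtain F \<pi> F' \<pi>' where F: "A = ext_event F \<pi>" "finite F" "\<pi> permutes F"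
      and F': "B = ext_event F' \<pi>'" "finite F'" "\<pi>' permutes F'"
      by (auto simp: ext_events_def)
    obtain \<sigma> where \<sigma>: "\<sigma> \<in> A" "\<sigma> \<in> B" using False by blast
    have "\<sigma> x \<in> F \<union> F'" if "x \<in> F \<union> F'" for x
      using that \<sigma> permutes_in_image[OF F(3), of x] permutes_in_image[OF F'(3), of x]
      by (auto simp: F(1) F'(1) ext_event_def)
    then have "perm_restrict \<sigma> (F \<union> F') permutes F \<union> F'"
      using \<sigma>(1) F(2) F'(2) by (intro permutes_perm_restrict) (auto simp: F(1) ext_event_def bij_is_inj)
    moreover have "A \<inter> B = ext_event (F \<union> F') (perm_restrict \<sigma> (F \<union> F'))"
      using \<sigma> by (auto simp: F(1) F'(1) ext_event_def perm_restrict_def)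
    ultimately show ?thesis using F(2) F'(2) unfolding ext_events_def by blast
  qed
qed

definition finite_cycles :: "('d::finite zd \<Rightarrow> 'd zd) set" where
  "finite_cycles = {\<sigma>. bij \<sigma> \<and> (\<forall>x. \<exists>(F, \<pi>)\<in>{(F, \<pi>). finite F \<and> \<pi> permutes F \<and> x \<in> F}. \<sigma> \<in> ext_event F \<pi>)}"

lemma countable_finite_permutes: "countable {(F, \<pi>). finite F \<and> \<pi> permutes (F :: 'd::finite zd set)}"
proof -
  have "countable (SIGMA F:{F :: 'd zd set. finite F}. {\<pi>. \<pi> permutes F})"
    by (intro countable_SIGMA countable_Collect_finite countable_finite finite_permutations) auto
  also have "(SIGMA F:{F :: 'd zd set. finite F}. {\<pi>. \<pi> permutes F}) = {(F, \<pi>). finite F \<and> \<pi> permutes F}" by auto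
  finally show ?thesis .
qed

text \<open>The events \<open>ext_event\<close> prescribe finite invariant sets and therefore
  generate all of the sigma algebra only where every site lies in such a set. That is enough,
  because this set will have full measure.\<close>

lemma finite_cycles_trace:
  fixes A :: "('d::finite zd \<Rightarrow> 'd zd) set"
  assumes A: "A \<in> sets Sspace"
  shows "A \<inter> finite_cycles \<in> sigma_sets {\<sigma>. bij \<sigma>} ext_events"
    "(finite_cycles :: ('d zd \<Rightarrow> 'd zd) set) \<in> sigma_sets {\<sigma>. bij \<sigma>} ext_events"
proof -
  let ?M = "sigma {\<sigma> :: 'd zd \<Rightarrow> 'd zd. bij \<sigma>} ext_events"
  have sub: "ext_events \<subseteq> Pow {\<sigma> :: 'd zd \<Rightarrow> 'd zd. bij \<sigma>}"
    by (auto simp: ext_events_def ext_event_def)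
  have sp: "space ?M = {\<sigma>. bij \<sigma>}" and se: "sets ?M = sigma_sets {\<sigma>. bij \<sigma>} ext_events"
    using sub by (simp_all add: space_measure_of sets_measure_of)
  have evM: "ext_event F \<pi> \<in> sets ?M" if "finite F" "\<pi> permutes F" for F \<pi>
    unfolding se using that by (intro sigma_sets.Basic) (auto simp: ext_events_def)
  define I where "I x P = {(F, \<pi>). finite F \<and> \<pi> permutes F \<and> x \<in> F \<and> P (\<pi> x)}" for x :: "'d zd" and P
  have cI: "countable (I x P)" for x P
    by (rule countable_subset[OF _ countable_finite_permutes]) (auto simp: I_def)
  have U: "(\<Union>(F, \<pi>)\<in>I x P. ext_event F \<pi>) \<in> sets ?M" for x P
    by (intro sets.countable_UN' cI) (auto simp: I_def evM)
  have fc: "finite_cycles = {\<sigma>. bij \<sigma>} \<inter> (\<Inter>x. \<Union>(F, \<pi>)\<in>I x (\<lambda>_. True). ext_event F \<pi>)"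
    by (auto simp: finite_cycles_def I_def)
  have fcM: "finite_cycles \<in> sets ?M"
    unfolding fc
  proof (intro sets.Int sets.countable_INT')
    show "{\<sigma> :: 'd zd \<Rightarrow> 'd zd. bij \<sigma>} \<in> sets ?M" using sets.top[of ?M] unfolding sp .
    show "range (\<lambda>x. \<Union>(F, \<pi>)\<in>I x (\<lambda>_. True). ext_event F \<pi>) \<subseteq> sets ?M" using U by (intro image_subsetI)
  qed auto
  then show "(finite_cycles :: ('d zd \<Rightarrow> 'd zd) set) \<in> sigma_sets {\<sigma>. bij \<sigma>} ext_events" by (simp add: se)
  \<comment> \<open>A retraction onto \<open>finite_cycles\<close>; its measurability from the
    smaller sigma algebra makes every trace measurable there.\<close>
  define \<phi> where "\<phi> \<sigma> = (if \<sigma> \<in> finite_cycles then \<sigma> else id)" for \<sigma> :: "'d zd \<Rightarrow> 'd zd"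
  have "\<phi> \<in> ?M \<rightarrow>\<^sub>M Sspace"
  proof (rule measurable_SspaceI)
    show "bij (\<phi> \<sigma>)" for \<sigma> by (auto simp: \<phi>_def finite_cycles_def)
    show "(\<lambda>\<sigma>. \<phi> \<sigma> x) \<in> ?M \<rightarrow>\<^sub>M count_space UNIV" for x
      unfolding measurable_count_space_eq2_countable
    proof (intro conjI ballI)
      fix y
      define Uy where "Uy = (\<Union>(F, \<pi>)\<in>I x ((=) y). ext_event F \<pi>)"
      have Uy: "Uy \<in> sets ?M" unfolding Uy_def by (rule U)
      have eqU: "\<sigma> x = y \<longleftrightarrow> \<sigma> \<in> Uy" if "\<sigma> \<in> finite_cycles" for \<sigma>
      proof
        assume "\<sigma> x = y"
        from that have "\<exists>(F, \<pi>)\<in>{(F, \<pi>). finite F \<and> \<pi> permutes F \<and> x \<in> F}. \<sigma> \<in> ext_event F \<pi>"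
          unfolding finite_cycles_def by blast
        then obtain F \<pi> where "finite F" "\<pi> permutes F" "x \<in> F" "\<sigma> \<in> ext_event F \<pi>" by blast
        moreover from this have "\<pi> x = y" using \<open>\<sigma> x = y\<close> by (auto simp: ext_event_def)
        ultimately show "\<sigma> \<in> Uy" by (auto simp: I_def Uy_def)
      qed (auto simp: I_def Uy_def ext_event_def)
      have "(\<lambda>\<sigma>. \<phi> \<sigma> x) -` {y} \<inter> space ?M =
        (finite_cycles \<inter> Uy) \<union> ((space ?M - finite_cycles) \<inter> (if x = y then space ?M else {}))"
        (is "?L = ?R")
      proof (rule set_eqI)
        fix \<sigma> :: "'d zd \<Rightarrow> 'd zd"
        have "bij \<sigma>" if "\<sigma> \<in> finite_cycles" using that by (simp add: finite_cycles_def)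
        then show "\<sigma> \<in> ?L \<longleftrightarrow> \<sigma> \<in> ?R"
          using eqU[of \<sigma>] by (cases "\<sigma> \<in> finite_cycles") (auto simp: \<phi>_def sp)
      qed
      also have "\<dots> \<in> sets ?M"
        using fcM Uy by (intro sets.Un sets.Int sets.Diff sets.top) (simp_all only: sets.top sets.empty_sets simp_thms split: if_split)
      finally show "(\<lambda>\<sigma>. \<phi> \<sigma> x) -` {y} \<inter> space ?M \<in> sets ?M" .
    qed auto
  qed
  from measurable_sets[OF this A] fcM have "(\<phi> -` A \<inter> space ?M) \<inter> finite_cycles \<in> sets ?M" by (rule sets.Int)
  also have "(\<phi> -` A \<inter> space ?M) \<inter> finite_cycles = A \<inter> finite_cycles"
    by (auto simp: \<phi>_def sp finite_cycles_def)
  finally show "A \<inter> finite_cycles \<in> sigma_sets {\<sigma>. bij \<sigma>} ext_events" by (simp add: se)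
qed

lemma eventually_translates_disjoint:
  assumes "finite A" "finite (B :: 'd::finite zd set)"
  shows "eventually (\<lambda>n. tau (of_nat n) ` A \<inter> B = {}) sequentially"
proof -
  have "eventually (\<lambda>n. tau (of_nat n) a \<noteq> b) sequentially" for a b :: "'d zd"
  proof -
    fix i :: 'd
    \<comment> \<open>The vector \<open>of_nat n\<close> has all coordinates n, so one coordinate
      already separates a and b for large n.\<close>
    have "tau (of_nat n) a \<noteq> b" if "n \<ge> Suc (nat \<bar>b $ i - a $ i\<bar>)" for n
    proof
      assume "tau (of_nat n) a = b"
      then have "a $ i + int n = b $ i" by (auto simp: tau_def vec_eq_iff of_nat_index)
      then show False using that by linarith
    qed
    then show ?thesis by (auto simp: eventually_sequentially)
  qed
  then have "eventually (\<lambda>n. \<forall>a\<in>A. \<forall>b\<in>B. tau (of_nat n) a \<noteq> b) sequentially"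
    by (intro eventually_ball_finite assms ballI)
  then show ?thesis by (rule eventually_mono) auto
qed

lemma shift_ext_event:
  "shift u -` ext_event F \<pi> \<inter> {\<sigma>. bij \<sigma>} = ext_event (tau (- u) ` F) (shift (- u) \<pi>)"
proof (intro set_eqI iffI)
  fix \<sigma> assume "\<sigma> \<in> shift u -` ext_event F \<pi> \<inter> {\<sigma>. bij \<sigma>}"
  then show "\<sigma> \<in> ext_event (tau (- u) ` F) (shift (- u) \<pi>)"
    by (auto simp: ext_event_def shift_def tau_def algebra_simps)
next
  fix \<sigma> assume s: "\<sigma> \<in> ext_event (tau (- u) ` F) (shift (- u) \<pi>)"
  then have "bij (shift u \<sigma>)" by (simp add: ext_event_def shift_eq_conj_by bij_conj_by bij_tau)
  then show "\<sigma> \<in> shift u -` ext_event F \<pi> \<inter> {\<sigma>. bij \<sigma>}"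
    using s by (auto simp: ext_event_def shift_def tau_def algebra_simps)
qed

context subcritical
begin

text \<open>A union bound: the event that the cycle at x is \<gamma> has probability at most
  \<open>W \<gamma>\<close>. It gives both the tightness of cycle lengths and the moments of jumps;
  \<open>g id = 0\<close> discards fixed sites.\<close>

lemma sum_W_cyc_le:
  assumes "finite \<Lambda>" "\<And>\<gamma>. 0 \<le> g \<gamma>" "g id = 0"
  shows "(\<Sum>\<sigma> | \<sigma> permutes \<Lambda>. W \<sigma> * g (cyc \<sigma> x)) \<le> (\<Sum>\<gamma> | \<gamma> \<in> cycles_at x \<and> csupp \<gamma> \<subseteq> \<Lambda>. g \<gamma> * W \<gamma>) * Z \<Lambda>"
proof -
  let ?C = "{\<gamma>. \<gamma> \<in> cycles_at x \<and> csupp \<gamma> \<subseteq> \<Lambda>}"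
  have finS: "finite {\<sigma>. \<sigma> permutes \<Lambda>}" using finite_permutations[OF assms(1)] .
  have finC: "finite ?C" using finite_cycles_within[OF assms(1), of x] by simp
  have perm: "permutation \<sigma>" if "\<sigma> permutes \<Lambda>" for \<sigma> using permutes_permutation[OF assms(1) that] .
  have cyc: "cyc \<sigma> x = id \<or> cyc \<sigma> x \<in> ?C" if s: "\<sigma> permutes \<Lambda>" for \<sigma>
  proof (cases "\<sigma> x = x")
    case True
    then show ?thesis using cyc_eq_id_iff[OF perm[OF s], of x] by simp
  next
    case False
    then have "x \<in> \<Lambda>" using s by (auto simp: permutes_def)
    then show ?thesis
      using False csupp_cyc[OF perm[OF s]] permutes_orbit_subset[OF s] cyc_in_cycles_at[OF perm[OF s]] by simp
  qed
  have "(\<Sum>\<sigma> | \<sigma> permutes \<Lambda>. W \<sigma> * g (cyc \<sigma> x)) = (\<Sum>\<sigma> | \<sigma> permutes \<Lambda> \<and> cyc \<sigma> x \<in> ?C. W \<sigma> * g (cyc \<sigma> x))"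
  proof (intro sum.mono_neutral_right[OF finS] ballI)
    fix \<sigma> assume "\<sigma> \<in> {\<sigma>. \<sigma> permutes \<Lambda>} - {\<sigma>. \<sigma> permutes \<Lambda> \<and> cyc \<sigma> x \<in> ?C}"
    then have "cyc \<sigma> x = id" using cyc by blast
    then show "W \<sigma> * g (cyc \<sigma> x) = 0" using assms(3) by simp
  qed auto
  also have "\<dots> = (\<Sum>\<gamma>\<in>?C. \<Sum>\<sigma> | \<sigma> \<in> {\<sigma>. \<sigma> permutes \<Lambda> \<and> cyc \<sigma> x \<in> ?C} \<and> cyc \<sigma> x = \<gamma>. W \<sigma> * g (cyc \<sigma> x))"
    by (rule sum.group[symmetric]) (use finS finC in auto)
  also have "\<dots> = (\<Sum>\<gamma>\<in>?C. g \<gamma> * (W \<gamma> * Z (\<Lambda> - csupp \<gamma>)))"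
  proof (rule sum.cong[OF refl])
    fix \<gamma> assume g: "\<gamma> \<in> ?C"
    have "{\<sigma>. \<sigma> \<in> {\<sigma>. \<sigma> permutes \<Lambda> \<and> cyc \<sigma> x \<in> ?C} \<and> cyc \<sigma> x = \<gamma>} = {\<sigma>. \<sigma> permutes \<Lambda> \<and> (\<forall>y\<in>csupp \<gamma>. \<sigma> y = \<gamma> y)}"
      using perm g cyc_eq_fcycle_iff[of _ \<gamma> x] by blast
    moreover have "(\<Sum>\<sigma> | \<sigma> \<in> {\<sigma>. \<sigma> permutes \<Lambda> \<and> cyc \<sigma> x \<in> ?C} \<and> cyc \<sigma> x = \<gamma>. W \<sigma> * g (cyc \<sigma> x)) =
      (\<Sum>\<sigma> | \<sigma> \<in> {\<sigma>. \<sigma> permutes \<Lambda> \<and> cyc \<sigma> x \<in> ?C} \<and> cyc \<sigma> x = \<gamma>. g \<gamma> * W \<sigma>)"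
      by (intro sum.cong) auto
    ultimately show "(\<Sum>\<sigma> | \<sigma> \<in> {\<sigma>. \<sigma> permutes \<Lambda> \<and> cyc \<sigma> x \<in> ?C} \<and> cyc \<sigma> x = \<gamma>. W \<sigma> * g (cyc \<sigma> x)) =
      g \<gamma> * (W \<gamma> * Z (\<Lambda> - csupp \<gamma>))"
      using sum_W_extending[OF assms(1), of "csupp \<gamma>" \<gamma>] g cycles_atD(4)[of \<gamma> x]
      by (simp only: sum_distrib_left[symmetric]) auto
  qed
  also have "\<dots> \<le> (\<Sum>\<gamma>\<in>?C. g \<gamma> * (W \<gamma> * Z \<Lambda>))"
    using assms by (intro sum_mono mult_left_mono Z_mono less_imp_le[OF W_pos]) auto
  finally show ?thesis by (simp add: sum_distrib_right mult.assoc)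
qed

text \<open>By the chain rule the only discrepancy is that the ratio for the translate of F' is
  taken after deleting F. Moving this translate back to F' moves F outside the fixed window K, where
  a deletion changes the ratio by at most \<epsilon>.\<close>

lemma q_factorizes:
  assumes "finite F" "finite F'" "0 < \<epsilon>"
  shows "eventually (\<lambda>n. \<bar>q (F \<union> tau (- of_nat n) ` F') - q F * q (tau (- of_nat n) ` F')\<bar> \<le> \<epsilon>) sequentially"
proof -
  obtain K where K: "finite K"
    "\<And>\<Lambda> \<Lambda>'. finite \<Lambda> \<Longrightarrow> finite \<Lambda>' \<Longrightarrow> \<Lambda> \<inter> K = \<Lambda>' \<inter> K \<Longrightarrow> \<bar>Q \<Lambda> F' - Q \<Lambda>' F'\<bar> \<le> \<epsilon>"
    using Q_uniformly_continuous[OF assms(2,3)] by blast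
  have "\<bar>q (F \<union> tau (- u) ` F') - q F * q (tau (- u) ` F')\<bar> \<le> \<epsilon>" if disj: "tau u ` F \<inter> K = {}" for u
  proof -
    let ?F' = "tau (- u) ` F'"
    have V: "V (tau u x - tau u y) = V (x - y)" for x y by (simp add: tau_def)
    have back': "tau u ` ?F' = F'" by (simp add: image_image tau_def)
    have Qu: "Q (tau u ` \<Lambda>) F' = Q \<Lambda> ?F'" for \<Lambda>
      using Q_image[OF bij_tau V, of \<Lambda> ?F'] by (simp add: back')
    have "\<bar>Q \<Lambda> (F \<union> ?F') - Q \<Lambda> F * Q \<Lambda> ?F'\<bar> \<le> \<epsilon>" if fin: "finite \<Lambda>" for \<Lambda>
    proof -
      have "\<bar>Q (tau u ` (\<Lambda> - F)) F' - Q (tau u ` \<Lambda>) F'\<bar> \<le> \<epsilon>"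
        using fin disj by (intro K(2)) (auto simp: image_set_diff[OF bij_is_inj[OF bij_tau]])
      then have le: "\<bar>Q (\<Lambda> - F) ?F' - Q \<Lambda> ?F'\<bar> \<le> \<epsilon>" by (simp add: Qu)
      have "\<bar>Q \<Lambda> (F \<union> ?F') - Q \<Lambda> F * Q \<Lambda> ?F'\<bar> = Q \<Lambda> F * \<bar>Q (\<Lambda> - F) ?F' - Q \<Lambda> ?F'\<bar>"
        using Q_pos[OF fin, of F] by (simp add: Q_Un[OF fin] right_diff_distrib[symmetric] abs_mult)
      also have "\<dots> \<le> 1 * \<bar>Q (\<Lambda> - F) ?F' - Q \<Lambda> ?F'\<bar>"
        by (rule mult_right_mono[OF Q_le_1[OF fin]]) simp
      also have "\<dots> \<le> \<epsilon>" using le by simp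
      finally show ?thesis .
    qed
    note bound = this
    show ?thesis
    proof (rule tendsto_upperbound[OF _ _ finite_subsets_at_top_neq_bot])
      show "((\<lambda>\<Lambda>. \<bar>Q \<Lambda> (F \<union> ?F') - Q \<Lambda> F * Q \<Lambda> ?F'\<bar>) \<longlongrightarrow> \<bar>q (F \<union> ?F') - q F * q ?F'\<bar>) (finite_subsets_at_top UNIV)"
        by (rule tendsto_rabs[OF tendsto_diff[OF Q_tendsto_q tendsto_mult[OF Q_tendsto_q Q_tendsto_q]]])
          (simp_all add: assms)
      show "\<forall>\<^sub>F \<Lambda> in finite_subsets_at_top UNIV. \<bar>Q \<Lambda> (F \<union> ?F') - Q \<Lambda> F * Q \<Lambda> ?F'\<bar> \<le> \<epsilon>"
        by (rule eventually_finite_subsets_at_top_weakI) (rule bound)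
    qed
  qed
  then show ?thesis
    using eventually_mono[OF eventually_translates_disjoint[OF assms(1) K(1)]] by simp
qed

end

section \<open>Ergodicity\<close>

context gibbs_limit
begin

text \<open>The finite-volume probability is \<open>W \<pi> * Q \<Lambda> F\<close> once \<Lambda>
  contains F, and the indicator is local.\<close>

lemma measure_ext_event:
  assumes "finite F" "\<pi> permutes F"
  shows "measure \<mu> (ext_event F \<pi>) = W \<pi> * q F"
proof -
  let ?F = "finite_subsets_at_top (UNIV :: 'd zd set)"
  let ?f = "indicator (ext_event F \<pi>) :: _ \<Rightarrow> real"
  have [measurable]: "ext_event F \<pi> \<in> sets Sspace" using ext_event_sets[OF assms(1)] .
  have lim: "((\<lambda>\<Lambda>. \<integral>\<sigma>. ?f \<sigma> \<partial>Gibbs_fin V \<alpha> \<Lambda> id) \<longlongrightarrow> (\<integral>\<sigma>. ?f \<sigma> \<partial>\<mu>)) ?F"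
  proof (rule Gibbs_tendsto_local[where B=1 and J=F])
    show "?f \<in> borel_measurable Sspace" by measurable
  qed (use assms(1) in \<open>auto simp: indicator_def ext_event_def\<close>)
  have "eventually (\<lambda>\<Lambda>. W \<pi> * Q \<Lambda> F = (\<integral>\<sigma>. ?f \<sigma> \<partial>Gibbs_fin V \<alpha> \<Lambda> id)) ?F"
    unfolding eventually_finite_subsets_at_top
  proof (intro exI[of _ F] conjI allI impI assms)
    fix \<Lambda> assume "finite \<Lambda> \<and> F \<subseteq> \<Lambda> \<and> \<Lambda> \<subseteq> UNIV"
    then have L: "finite \<Lambda>" "F \<subseteq> \<Lambda>" by auto
    have "(\<Sum>\<sigma> | \<sigma> permutes \<Lambda>. W \<sigma> * ?f \<sigma>) = (\<Sum>\<sigma> | \<sigma> permutes \<Lambda> \<and> (\<forall>x\<in>F. \<sigma> x = \<pi> x). W \<sigma>)"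
      using finite_permutations[OF L(1)]
      by (intro sum.mono_neutral_cong_right) (auto simp: ext_event_def permutes_bij indicator_def)
    then have "(\<Sum>\<sigma> | \<sigma> permutes \<Lambda>. W \<sigma> * ?f \<sigma>) = W \<pi> * Z (\<Lambda> - F)"
      by (simp add: sum_W_extending[OF L assms(2)])
    then show "W \<pi> * Q \<Lambda> F = (\<integral>\<sigma>. ?f \<sigma> \<partial>Gibbs_fin V \<alpha> \<Lambda> id)"
      by (subst integral_Gibbs_id[OF L(1)]) (simp_all add: Q_def)
  qed auto
  then have "((\<lambda>\<Lambda>. \<integral>\<sigma>. ?f \<sigma> \<partial>Gibbs_fin V \<alpha> \<Lambda> id) \<longlongrightarrow> W \<pi> * q F) ?F"
    by (rule Lim_transform_eventually[OF tendsto_mult[OF tendsto_const Q_tendsto_q[OF assms(1)]]])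
  from tendsto_unique[OF finite_subsets_at_top_neq_bot lim this]
  show ?thesis by (simp add: measure_eq_integral)
qed

text \<open>Being fixed or having a cycle in a large finite set \<open>\<Gamma>0\<close> is a local
  event of probability at least 1 - \<epsilon> uniformly in the volume, so the bound passes to the
  limit law.\<close>

lemma AE_finite_cycles: "AE \<sigma> in \<mu>. \<sigma> \<in> finite_cycles"
proof -
  interpret mu: prob_space \<mu> by (rule prob_space_\<mu>)
  let ?F = "finite_subsets_at_top (UNIV :: 'd zd set)"
  define I where "I x = {(F, \<pi>). finite F \<and> \<pi> permutes F \<and> x \<in> F}" for x :: "'d zd"
  define U where "U x = (\<Union>(F, \<pi>)\<in>I x. ext_event F \<pi>)" for x
  have U: "U x \<in> sets Sspace" for x
    unfolding U_def
    by (intro sets.countable_UN' countable_subset[OF _ countable_finite_permutes]) (auto simp: I_def ext_event_sets)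
  have "AE \<sigma> in \<mu>. \<sigma> \<in> U x" for x
  proof -
    have "1 - \<epsilon> \<le> measure \<mu> (U x)" if e: "0 < \<epsilon>" for \<epsilon>
    proof -
      obtain \<Gamma>0 where G0: "finite \<Gamma>0" "\<Gamma>0 \<subseteq> cycles_at x"
        "\<And>\<Gamma>. finite \<Gamma> \<Longrightarrow> \<Gamma> \<subseteq> cycles_at x \<Longrightarrow> \<Gamma> \<inter> \<Gamma>0 = {} \<Longrightarrow> sum W \<Gamma> \<le> \<epsilon>"
        using sum_W_cycles_tail[OF e] by metis
      define A where "A = ext_event {x} id \<union> (\<Union>\<gamma>\<in>\<Gamma>0. ext_event (csupp \<gamma>) \<gamma>)"
      have [measurable]: "A \<in> sets Sspace"
        unfolding A_def using G0 cycles_atD(2) by (intro sets.Un sets.finite_UN ext_event_sets) auto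
      have sub: "A \<subseteq> U x"
      proof -
        have "({x}, id) \<in> I x" by (simp add: I_def permutes_id)
        moreover have "(csupp \<gamma>, \<gamma>) \<in> I x" if "\<gamma> \<in> \<Gamma>0" for \<gamma>
          using that G0(2) cycles_atD(2,3,4)[of \<gamma> x] by (auto simp: I_def)
        ultimately show ?thesis unfolding A_def U_def by blast
      qed
      let ?f = "indicator A :: _ \<Rightarrow> real"
      have lim: "((\<lambda>\<Lambda>. \<integral>\<sigma>. ?f \<sigma> \<partial>Gibbs_fin V \<alpha> \<Lambda> id) \<longlongrightarrow> (\<integral>\<sigma>. ?f \<sigma> \<partial>\<mu>)) ?F"
      proof (rule Gibbs_tendsto_local[where B=1 and J="insert x (\<Union>\<gamma>\<in>\<Gamma>0. csupp \<gamma>)"])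
        show "finite (insert x (\<Union>\<gamma>\<in>\<Gamma>0. csupp \<gamma>))" using G0 cycles_atD(2) by auto
        fix \<sigma> \<tau> :: "'d zd \<Rightarrow> 'd zd"
        assume *: "bij \<sigma>" "bij \<tau>" "\<And>y. y \<in> insert x (\<Union>\<gamma>\<in>\<Gamma>0. csupp \<gamma>) \<Longrightarrow> \<sigma> y = \<tau> y"
        have "(\<forall>y\<in>csupp \<gamma>. \<sigma> y = \<gamma> y) \<longleftrightarrow> (\<forall>y\<in>csupp \<gamma>. \<tau> y = \<gamma> y)" if "\<gamma> \<in> \<Gamma>0" for \<gamma>
        proof (intro ball_cong refl)
          fix y assume "y \<in> csupp \<gamma>"
          then have "\<sigma> y = \<tau> y" using that by (intro *(3)) blast
          then show "\<sigma> y = \<gamma> y \<longleftrightarrow> \<tau> y = \<gamma> y" by simp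
        qed
        then have "\<sigma> \<in> A \<longleftrightarrow> \<tau> \<in> A"
          using *(1,2) *(3)[of x] by (simp add: A_def ext_event_def cong: bex_cong_simp)
        then show "?f \<sigma> = ?f \<tau>" by (simp add: indicator_def)
      next
        show "?f \<in> borel_measurable Sspace" by measurable
      qed (auto simp: indicator_def)
      have "1 - \<epsilon> \<le> (\<integral>\<sigma>. ?f \<sigma> \<partial>\<mu>)"
      proof (rule tendsto_lowerbound[OF lim _ finite_subsets_at_top_neq_bot], rule eventually_finite_subsets_at_top_weakI)
        fix \<Lambda> :: "'d zd set" assume L: "finite \<Lambda>"
        \<comment> \<open>The indicator of the cycles missed by \<open>\<Gamma>0\<close> dominates
          the complement of A, and their weights form the small tail.\<close>
        define g :: "('d zd \<Rightarrow> 'd zd) \<Rightarrow> real" where "g \<gamma> = (if \<gamma> \<in> cycles_at x - \<Gamma>0 then 1 else 0)" for \<gamma>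
        have "W \<sigma> * (1 - ?f \<sigma>) \<le> W \<sigma> * g (cyc \<sigma> x)" if s: "\<sigma> permutes \<Lambda>" for \<sigma>
        proof (rule mult_left_mono[OF _ less_imp_le[OF W_pos]])
          have p: "permutation \<sigma>" using permutes_permutation[OF L s] .
          show "1 - ?f \<sigma> \<le> g (cyc \<sigma> x)"
          proof (cases "\<sigma> \<in> A")
            case False
            then have "\<sigma> x \<noteq> x" using s by (auto simp: A_def ext_event_def permutes_bij)
            then have c: "cyc \<sigma> x \<in> cycles_at x" using cyc_in_cycles_at[OF p] by simp
            have "cyc \<sigma> x \<notin> \<Gamma>0"
            proof
              assume "cyc \<sigma> x \<in> \<Gamma>0"
              then have "\<sigma> \<in> ext_event (csupp (cyc \<sigma> x)) (cyc \<sigma> x)"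
                using cyc_eq_fcycle_iff[OF p c] s by (simp add: ext_event_def permutes_bij)
              then show False using False \<open>cyc \<sigma> x \<in> \<Gamma>0\<close> by (auto simp: A_def)
            qed
            then show ?thesis using c by (simp add: g_def)
          qed (simp add: g_def)
        qed
        then have "(\<Sum>\<sigma> | \<sigma> permutes \<Lambda>. W \<sigma> * (1 - ?f \<sigma>)) \<le> (\<Sum>\<sigma> | \<sigma> permutes \<Lambda>. W \<sigma> * g (cyc \<sigma> x))"
          by (intro sum_mono) auto
        also have "\<dots> \<le> (\<Sum>\<gamma> | \<gamma> \<in> cycles_at x \<and> csupp \<gamma> \<subseteq> \<Lambda>. g \<gamma> * W \<gamma>) * Z \<Lambda>"
          using cycles_atD(3)[of id x] by (intro sum_W_cyc_le[OF L]) (auto simp: g_def csupp_def)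
        also have "(\<Sum>\<gamma> | \<gamma> \<in> cycles_at x \<and> csupp \<gamma> \<subseteq> \<Lambda>. g \<gamma> * W \<gamma>) = sum W ({\<gamma> \<in> cycles_at x. csupp \<gamma> \<subseteq> \<Lambda>} - \<Gamma>0)"
          using finite_cycles_within[OF L, of x] by (intro sum.mono_neutral_cong_right) (auto simp: g_def)
        also have "\<dots> * Z \<Lambda> \<le> \<epsilon> * Z \<Lambda>"
          using finite_cycles_within[OF L, of x] Z_pos[OF L] by (intro mult_right_mono G0(3)) auto
        finally have "Z \<Lambda> - (\<Sum>\<sigma> | \<sigma> permutes \<Lambda>. W \<sigma> * ?f \<sigma>) \<le> \<epsilon> * Z \<Lambda>"
          by (simp add: right_diff_distrib sum_subtractf Z_def)
        then have "(1 - \<epsilon>) * Z \<Lambda> \<le> (\<Sum>\<sigma> | \<sigma> permutes \<Lambda>. W \<sigma> * ?f \<sigma>)" by (simp add: algebra_simps)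
        then show "1 - \<epsilon> \<le> (\<integral>\<sigma>. ?f \<sigma> \<partial>Gibbs_fin V \<alpha> \<Lambda> id)"
          using Z_pos[OF L] by (subst integral_Gibbs_id[OF L]) (simp_all add: pos_le_divide_eq)
      qed
      also have "\<dots> = measure \<mu> A" by (simp add: measure_eq_integral)
      also have "\<dots> \<le> measure \<mu> (U x)" using sub U by (intro mu.finite_measure_mono) auto
      finally show ?thesis .
    qed
    then have "1 \<le> measure \<mu> (U x) + \<epsilon>" if "0 < \<epsilon>" for \<epsilon> using that by (simp add: algebra_simps)
    then have "1 \<le> measure \<mu> (U x)" by (rule field_le_epsilon)
    then have "measure \<mu> (U x) = 1" using mu.prob_le_1[of "U x"] by simp
    then show ?thesis using mu.prob_eq_1[of "U x"] U[of x] by simp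
  qed
  then have "AE \<sigma> in \<mu>. \<forall>x. \<sigma> \<in> U x" by (simp add: AE_all_countable)
  then show ?thesis using AE_space
  proof eventually_elim
    case (elim \<sigma>)
    have "\<exists>(F, \<pi>)\<in>I x. \<sigma> \<in> ext_event F \<pi>" for x
      using spec[OF elim(1), of x] unfolding U_def by (elim UN_E) (auto intro: bexI)
    then show ?case using elim(2) unfolding finite_cycles_def I_def by simp
  qed
qed

lemma shift_measurable [measurable]: "shift u \<in> Sspace \<rightarrow>\<^sub>M Sspace"
  unfolding shift_eq_conj_by by (rule measurable_conj_by[OF bij_tau])

lemma distr_shift: "distr \<mu> Sspace (shift u) = \<mu>"
  unfolding shift_eq_conj_by by (rule distr_conj_by[OF bij_tau]) (simp add: tau_def)

lemma measure_shift_vimage: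
  assumes "A \<in> sets Sspace"
  shows "measure \<mu> (shift u -` A \<inter> {\<sigma>. bij \<sigma>}) = measure \<mu> A"
proof -
  have "measure \<mu> A = measure (distr \<mu> Sspace (shift u)) A" by (simp add: distr_shift)
  also have "\<dots> = measure \<mu> (shift u -` A \<inter> space \<mu>)" using assms by (intro measure_distr) auto
  finally show ?thesis by simp
qed

text \<open>Once the translate of F' is disjoint from F, the two prescriptions compose to one
  permutation of the union and the weights multiply exactly; only the ratios q decouple
  asymptotically.\<close>

lemma mixing_ext_events:
  assumes "A \<in> ext_events" "B \<in> ext_events"
  shows "(\<lambda>n. measure \<mu> (A \<inter> (shift (of_nat n) -` B \<inter> {\<sigma>. bij \<sigma>}))) \<longlonglongrightarrow> measure \<mu> A * measure \<mu> B"
proof (cases "A = {} \<or> B = {}")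
  case True
  then show ?thesis by auto
next
  case False
  with assms obtain F \<pi> F' \<pi>' where F: "A = ext_event F \<pi>" "finite F" "\<pi> permutes F"
    and F': "B = ext_event F' \<pi>'" "finite F'" "\<pi>' permutes F'"
    by (auto simp: ext_events_def)
  show ?thesis
  proof (rule LIMSEQ_I)
    fix r :: real assume "0 < r"
    \<comment> \<open>The error is multiplied by both weights; the factor 2 leaves a strict
      inequality.\<close>
    define \<epsilon> where "\<epsilon> = r / (2 * (W \<pi> * W \<pi>'))"
    have pos: "0 < W \<pi> * W \<pi>'" using W_pos[of \<pi>] W_pos[of \<pi>'] by simp
    have e: "0 < \<epsilon>" "W \<pi> * W \<pi>' * \<epsilon> < r" using pos \<open>0 < r\<close> by (auto simp: \<epsilon>_def)
    have "eventually (\<lambda>n. norm (measure \<mu> (A \<inter> (shift (of_nat n) -` B \<inter> {\<sigma>. bij \<sigma>})) - measure \<mu> A * measure \<mu> B) < r) sequentially"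
      using q_factorizes[OF F(2) F'(2) e(1)] eventually_translates_disjoint[OF F(2) F'(2)]
    proof eventually_elim
      case (elim n)
      let ?F' = "tau (- of_nat n) ` F'" and ?\<pi>' = "shift (- of_nat n) \<pi>'"
      have fin': "finite ?F'" using F'(2) by simp
      have p': "?\<pi>' permutes ?F'" unfolding shift_eq_conj_by by (rule conj_by_permutes[OF bij_tau F'(3)])
      have W': "W ?\<pi>' = W \<pi>'"
        unfolding shift_eq_conj_by by (rule cweight_conj_by[OF bij_tau]) (simp add: tau_def)
      have disj: "F \<inter> ?F' = {}"
      proof (rule ccontr)
        assume "F \<inter> ?F' \<noteq> {}"
        then obtain y where "y \<in> F'" "tau (- of_nat n) y \<in> F" by blast
        moreover have "tau (of_nat n) (tau (- of_nat n) y) = y" by (simp add: tau_def)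
        ultimately have "y \<in> tau (of_nat n) ` F \<inter> F'" by (metis IntI imageI)
        then show False using elim(2) by auto
      qed
      have eqB: "shift (of_nat n) -` B \<inter> {\<sigma>. bij \<sigma>} = ext_event ?F' ?\<pi>'"
        unfolding F'(1) by (rule shift_ext_event)
      have mB: "measure \<mu> B = W \<pi>' * q ?F'"
      proof -
        have "B \<in> sets Sspace" unfolding F'(1) by (rule ext_event_sets[OF F'(2)])
        from measure_shift_vimage[OF this, of "of_nat n"] show ?thesis
          unfolding eqB using measure_ext_event[OF fin' p'] by (simp add: W')
      qed
      have pp: "\<pi> \<circ> ?\<pi>' permutes F \<union> ?F'"
        using F(3) p' by (intro permutes_compose) (auto intro: permutes_subset)
      have "W (\<pi> \<circ> ?\<pi>') = W \<pi> * W \<pi>'"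
        using W_comp_disjoint[of "F \<union> ?F'" ?F' \<pi> ?\<pi>'] F(2,3) F'(2) p' disj W'
        by (simp add: Un_Diff Diff_triv)
      moreover have "A \<inter> ext_event ?F' ?\<pi>' = ext_event (F \<union> ?F') (\<pi> \<circ> ?\<pi>')"
      proof -
        have "(\<pi> \<circ> ?\<pi>') x = \<pi> x" if "x \<in> F" for x
        proof -
          have "x \<notin> ?F'" using that disj by blast
          then show ?thesis using permutes_not_in[OF p', of x] by simp
        qed
        moreover have "(\<pi> \<circ> ?\<pi>') x = ?\<pi>' x" if "x \<in> ?F'" for x
        proof -
          have "?\<pi>' x \<notin> F" using that disj permutes_in_image[OF p', of x] by blast
          then show ?thesis using permutes_not_in[OF F(3)] by simp
        qed
        ultimately show ?thesis unfolding F(1) ext_event_def by (auto simp del: comp_apply)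
      qed
      ultimately have "measure \<mu> (A \<inter> (shift (of_nat n) -` B \<inter> {\<sigma>. bij \<sigma>})) = W \<pi> * W \<pi>' * q (F \<union> ?F')"
        unfolding eqB using measure_ext_event[OF _ pp] F(2) fin' by simp
      then have "measure \<mu> (A \<inter> (shift (of_nat n) -` B \<inter> {\<sigma>. bij \<sigma>})) - measure \<mu> A * measure \<mu> B =
        W \<pi> * W \<pi>' * (q (F \<union> ?F') - q F * q ?F')"
        using measure_ext_event[OF F(2,3)] mB F(1) by (simp add: algebra_simps)
      then have "norm (measure \<mu> (A \<inter> (shift (of_nat n) -` B \<inter> {\<sigma>. bij \<sigma>})) - measure \<mu> A * measure \<mu> B) =
        W \<pi> * W \<pi>' * \<bar>q (F \<union> ?F') - q F * q ?F'\<bar>"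
        by (simp add: abs_mult abs_of_pos[OF W_pos])
      also have "\<dots> \<le> W \<pi> * W \<pi>' * \<epsilon>" using pos elim(1) by (intro mult_left_mono) auto
      finally show ?case using e(2) by simp
    qed
    then show "\<exists>no. \<forall>n\<ge>no. norm (measure \<mu> (A \<inter> (shift (of_nat n) -` B \<inter> {\<sigma>. bij \<sigma>})) - measure \<mu> A * measure \<mu> B) < r"
      by (simp add: eventually_sequentially)
  qed
qed

text \<open>Two extensions from the generator: first in B with A a generating event, then in A with
  B arbitrary. Both use \<mu> restricted to one of the two events; shift invariance supplies the
  domination in the first.\<close>

lemma mixing:
  assumes "A \<in> sigma_sets {\<sigma>. bij \<sigma>} ext_events" "B \<in> sigma_sets {\<sigma>. bij \<sigma>} ext_events"
  shows "(\<lambda>n. measure \<mu> (A \<inter> (shift (of_nat n) -` B \<inter> {\<sigma>. bij \<sigma>}))) \<longlonglongrightarrow> measure \<mu> A * measure \<mu> B"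
proof -
  interpret mu: prob_space \<mu> by (rule prob_space_\<mu>)
  have sub: "sigma_sets {\<sigma>. bij \<sigma>} ext_events \<subseteq> sets Sspace"
    using sets.sigma_sets_subset[OF ext_events_sets] by (simp add: space_Sspace)
  define T where "T n B = shift (of_nat n) -` B \<inter> {\<sigma>. bij \<sigma>}" for n :: nat and B :: "('d zd \<Rightarrow> 'd zd) set"
  have T [measurable]: "T n B \<in> sets Sspace" if "B \<in> sets Sspace" for n B
    unfolding T_def using measurable_sets[OF shift_measurable that] by (simp add: space_Sspace)
  have mT: "measure \<mu> (T n B) = measure \<mu> B" if "B \<in> sets Sspace" for n B
    unfolding T_def by (rule measure_shift_vimage[OF that])
  have space_in: "{\<sigma>. bij \<sigma>} \<in> sets Sspace" using sets.top[of Sspace] by (simp add: space_Sspace)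
  have step1: "(\<lambda>n. measure \<mu> (A \<inter> T n B)) \<longlonglongrightarrow> measure \<mu> A * measure \<mu> B"
    if A: "A \<in> ext_events" and B: "B \<in> sigma_sets {\<sigma>. bij \<sigma>} ext_events" for A B
  proof -
    have A' [measurable]: "A \<in> sets Sspace" using A ext_events_sets by blast
    define N where "N n = distr (density \<mu> (indicator A)) Sspace (shift (of_nat n))" for n :: nat
    have N: "measure (N n) B = measure \<mu> (A \<inter> T n B)" if "B \<in> sets Sspace" for n B
    proof -
      have "emeasure (N n) B = emeasure (density \<mu> (indicator A)) (T n B)"
        unfolding N_def T_def using that by (subst emeasure_distr) (auto simp: space_Sspace)
      also have "\<dots> = emeasure \<mu> (A \<inter> T n B)"
        using that T[OF that, of n] by (subst emeasure_density) (auto simp: indicator_inter_arith[symmetric])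
      finally show ?thesis by (simp add: measure_def)
    qed
    have Nfin: "finite_measure (N n)" for n
    proof
      have "emeasure (N n) (space (N n)) = emeasure (density \<mu> (indicator A)) (T n {\<sigma>. bij \<sigma>})"
        unfolding N_def T_def by (subst emeasure_distr) (auto simp: space_Sspace space_in)
      also have "\<dots> = emeasure \<mu> (A \<inter> T n {\<sigma>. bij \<sigma>})"
        using T[OF space_in, of n] by (subst emeasure_density) (auto simp: indicator_inter_arith[symmetric])
      finally show "emeasure (N n) (space (N n)) \<noteq> \<infinity>" by (simp add: mu.emeasure_eq_measure)
    qed
    have "(\<lambda>n. measure (N n) B) \<longlonglongrightarrow> measure \<mu> A * measure \<mu> B"
    proof (rule tendsto_dynkin[OF Int_stable_ext_events])
      show "measure (N n) C \<le> measure \<mu> C" if "C \<in> sets \<mu>" for n C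
      proof -
        have C: "C \<in> sets Sspace" using that by simp
        have "measure \<mu> (A \<inter> T n C) \<le> measure \<mu> (T n C)"
          using T[OF C, of n] by (intro mu.finite_measure_mono) auto
        then show ?thesis using N[OF C] mT[OF C] by simp
      qed
      show "(\<lambda>n. measure (N n) (space \<mu>)) \<longlonglongrightarrow> measure \<mu> A * measure \<mu> (space \<mu>)"
      proof -
        have "A \<inter> T n {\<sigma>. bij \<sigma>} = A" for n
          using sets.sets_into_space[OF A'] by (auto simp: T_def space_Sspace shift_eq_conj_by bij_conj_by bij_tau)
        then show ?thesis using N[OF space_in] mu.prob_space by simp
      qed
      show "(\<lambda>n. measure (N n) C) \<longlonglongrightarrow> measure \<mu> A * measure \<mu> C" if "C \<in> ext_events" for C
        using mixing_ext_events[OF A that] N[of C] ext_events_sets that by (auto simp: T_def)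
      show "finite_measure \<mu>" by unfold_locales
    qed (use B Nfin ext_events_sets in \<open>auto simp: N_def\<close>)
    then show ?thesis using N[of B] B sub by auto
  qed
  have B': "B \<in> sets Sspace" using assms sub by blast
  define N where "N n = density \<mu> (indicator (T n B))" for n
  have N: "measure (N n) A = measure \<mu> (A \<inter> T n B)" if "A \<in> sets Sspace" for n A
  proof -
    have "emeasure (N n) A = emeasure \<mu> (A \<inter> T n B)"
      unfolding N_def using that T[OF B', of n]
      by (subst emeasure_density) (auto simp: indicator_inter_arith[symmetric] Int_commute)
    then show ?thesis by (simp add: measure_def)
  qed
  have "(\<lambda>n. measure (N n) A) \<longlonglongrightarrow> measure \<mu> B * measure \<mu> A"
  proof (rule tendsto_dynkin[OF Int_stable_ext_events])
    show "finite_measure (N n)" for n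
    proof
      have "emeasure (N n) (space (N n)) = emeasure \<mu> (T n B \<inter> space \<mu>)"
        unfolding N_def using T[OF B', of n] space_in
        by (subst emeasure_density) (auto simp: indicator_inter_arith[symmetric])
      then show "emeasure (N n) (space (N n)) \<noteq> \<infinity>" by (simp add: mu.emeasure_eq_measure)
    qed
    show "measure (N n) C \<le> measure \<mu> C" if "C \<in> sets \<mu>" for n C
      using that N[of C n] T[OF B', of n] by (auto intro!: mu.finite_measure_mono)
    show "(\<lambda>n. measure (N n) (space \<mu>)) \<longlonglongrightarrow> measure \<mu> B * measure \<mu> (space \<mu>)"
    proof -
      have "{\<sigma>. bij \<sigma>} \<inter> T n B = T n B" for n by (auto simp: T_def)
      then show ?thesis using N[OF space_in] mT[OF B'] mu.prob_space by simp
    qed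
    show "(\<lambda>n. measure (N n) C) \<longlonglongrightarrow> measure \<mu> B * measure \<mu> C" if "C \<in> ext_events" for C
      using step1[OF that assms(2)] N[of C] ext_events_sets that by (auto simp: mult.commute)
    show "finite_measure \<mu>" by unfold_locales
  qed (use assms ext_events_sets in \<open>auto simp: N_def\<close>)
  then show ?thesis using N[of A] assms(1) sub by (auto simp: T_def mult.commute)
qed

text \<open>For invariant A, mixing of A with itself gives that its measure equals its own square.
  Mixing is applied to the trace of A on \<open>finite_cycles\<close>, which differs from A by a
  null set, also after every shift.\<close>

lemma ergodic_\<mu>: "ergodic \<mu>"
  unfolding ergodic_def
proof (intro conjI allI ballI impI prob_space_\<mu> sets_\<mu> distr_shift)
  interpret mu: prob_space \<mu> by (rule prob_space_\<mu>)
  fix A :: "('d zd \<Rightarrow> 'd zd) set" assume A: "A \<in> sets Sspace" and inv: "\<forall>u. shift u -` A \<inter> space Sspace = A"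
  let ?A = "A \<inter> finite_cycles"
  have sub: "sigma_sets {\<sigma> :: 'd zd \<Rightarrow> 'd zd. bij \<sigma>} ext_events \<subseteq> sets Sspace"
    using sets.sigma_sets_subset[OF ext_events_sets] by (simp add: space_Sspace)
  have fc: "(finite_cycles :: ('d zd \<Rightarrow> 'd zd) set) \<in> sets Sspace"
    by (rule subsetD[OF sub finite_cycles_trace(2)[OF A]])
  have mA: "measure \<mu> ?A = measure \<mu> A"
  proof (rule mu.finite_measure_eq_AE)
    show "AE \<sigma> in \<mu>. \<sigma> \<in> ?A \<longleftrightarrow> \<sigma> \<in> A" using AE_finite_cycles by eventually_elim simp
  qed (use A fc in auto)
  have "measure \<mu> (?A \<inter> (shift (of_nat n) -` ?A \<inter> {\<sigma>. bij \<sigma>})) = measure \<mu> A" for n :: nat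
  proof (rule mu.finite_measure_eq_AE)
    have "AE \<sigma> in distr \<mu> Sspace (shift (of_nat n)). \<sigma> \<in> finite_cycles"
      unfolding distr_shift by (rule AE_finite_cycles)
    then have "AE \<sigma> in \<mu>. shift (of_nat n) \<sigma> \<in> finite_cycles"
      using sets.Int[OF sets.top[of Sspace] fc] by (subst (asm) AE_distr_iff) (simp_all add: Int_def)
    with AE_finite_cycles
    show "AE \<sigma> in \<mu>. \<sigma> \<in> ?A \<inter> (shift (of_nat n) -` ?A \<inter> {\<sigma>. bij \<sigma>}) \<longleftrightarrow> \<sigma> \<in> A"
      using AE_space
    proof eventually_elim
      case (elim \<sigma>)
      have "\<sigma> \<in> shift (of_nat n) -` A \<inter> space Sspace \<longleftrightarrow> \<sigma> \<in> A" using inv by metis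
      then show ?case using elim by (auto simp: space_Sspace)
    qed
    show "?A \<inter> (shift (of_nat n) -` ?A \<inter> {\<sigma>. bij \<sigma>}) \<in> sets \<mu>"
      using measurable_sets[OF shift_measurable, of ?A "of_nat n"] A fc by (auto simp: space_Sspace)
  qed (use A in simp)
  with mixing[OF finite_cycles_trace(1)[OF A] finite_cycles_trace(1)[OF A]]
  have "(\<lambda>n::nat. measure \<mu> A) \<longlonglongrightarrow> measure \<mu> A * measure \<mu> A" by (simp add: mA)
  then have "measure \<mu> A = measure \<mu> A * measure \<mu> A" by (simp add: LIMSEQ_const_iff)
  then show "measure \<mu> A = 0 \<or> measure \<mu> A = 1" by (metis mult_cancel_right1)
qed

section \<open>Jumps\<close>

text \<open>The jump at x is a function of the cycle at x and vanishes for \<open>id\<close>, so the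
  union bound applies in each finite volume. Fatou's lemma along \<open>sites\<close> transfers it
  although the integrand is unbounded.\<close>

lemma jump_moment:
  assumes C: "\<And>\<Gamma>. finite \<Gamma> \<Longrightarrow> \<Gamma> \<subseteq> cycles_at x \<Longrightarrow> (\<Sum>\<gamma>\<in>\<Gamma>. V (\<gamma> x - x) * W \<gamma>) \<le> C"
  shows "(\<integral>\<^sup>+\<sigma>. ennreal (V (\<sigma> x - x)) \<partial>\<mu>) \<le> ennreal C"
proof -
  have [measurable]: "(\<lambda>\<sigma>. V (\<sigma> x - x)) \<in> borel_measurable Sspace"
    by (rule measurable_compose[OF measurable_eval, of "\<lambda>y. V (y - x)" borel x]) simp
  have fin: "(\<integral>\<^sup>+\<omega>. ennreal (V (\<zeta> \<Lambda> \<omega> x - x)) \<partial>M) \<le> ennreal C" if L: "finite \<Lambda>" for \<Lambda>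
  proof -
    have "(\<integral>\<^sup>+\<omega>. ennreal (V (\<zeta> \<Lambda> \<omega> x - x)) \<partial>M) = (\<integral>\<^sup>+\<sigma>. ennreal (V (\<sigma> x - x)) \<partial>Gibbs_fin V \<alpha> \<Lambda> id)"
      unfolding law[OF L, symmetric] by (subst nn_integral_distr) auto
    also have "\<dots> = (\<Sum>\<sigma> | \<sigma> permutes \<Lambda>. ennreal (W \<sigma> / Z \<Lambda>) * ennreal (V (\<sigma> x - x)))"
      unfolding nn_integral_Gibbs_fin[OF L bij_id \<open>(\<lambda>\<sigma>. V (\<sigma> x - x)) \<in> borel_measurable Sspace\<close>[THEN measurable_compose, OF measurable_ennreal]]
      using Gibbs_weight[OF L] by (intro sum.cong) auto
    also have "\<dots> = ennreal ((\<Sum>\<sigma> | \<sigma> permutes \<Lambda>. W \<sigma> * V (cyc \<sigma> x x - x)) / Z \<Lambda>)"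
      unfolding sum_divide_distrib
      using V_nonneg Z_pos[OF L] W_pos cyc_self[OF permutes_permutation[OF L]]
      by (subst sum_ennreal[symmetric]) (auto simp: ennreal_mult[symmetric] less_imp_le intro!: sum.cong)
    also have "\<dots> \<le> ennreal C"
    proof (rule ennreal_leI)
      have "(\<Sum>\<sigma> | \<sigma> permutes \<Lambda>. W \<sigma> * V (cyc \<sigma> x x - x)) \<le>
        (\<Sum>\<gamma> | \<gamma> \<in> cycles_at x \<and> csupp \<gamma> \<subseteq> \<Lambda>. V (\<gamma> x - x) * W \<gamma>) * Z \<Lambda>"
        using V_nonneg V_zero by (intro sum_W_cyc_le[OF L, where g="\<lambda>\<gamma>. V (\<gamma> x - x)"]) auto
      also have "\<dots> \<le> C * Z \<Lambda>"
        using finite_cycles_within[OF L, of x] Z_pos[OF L] by (intro mult_right_mono C) auto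
      finally show "(\<Sum>\<sigma> | \<sigma> permutes \<Lambda>. W \<sigma> * V (cyc \<sigma> x x - x)) / Z \<Lambda> \<le> C"
        using Z_pos[OF L] by (simp add: pos_divide_le_eq)
    qed
    finally show ?thesis .
  qed
  have "(\<integral>\<^sup>+\<sigma>. ennreal (V (\<sigma> x - x)) \<partial>\<mu>) = (\<integral>\<^sup>+\<omega>. ennreal (V (\<zeta> UNIV \<omega> x - x)) \<partial>M)"
    unfolding \<mu>_def by (subst nn_integral_distr) auto
  also have "\<dots> = (\<integral>\<^sup>+\<omega>. liminf (\<lambda>n. ennreal (V (\<zeta> (sites n) \<omega> x - x))) \<partial>M)"
  proof (rule nn_integral_cong_AE)
    show "AE \<omega> in M. ennreal (V (\<zeta> UNIV \<omega> x - x)) = liminf (\<lambda>n. ennreal (V (\<zeta> (sites n) \<omega> x - x)))"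
      using conv
    proof eventually_elim
      case (elim \<omega>)
      have "eventually (\<lambda>n. \<zeta> (sites n) \<omega> x = \<zeta> UNIV \<omega> x) sequentially"
        using elim filterlim_sites by (auto simp: filterlim_iff)
      then have "(\<lambda>n. ennreal (V (\<zeta> (sites n) \<omega> x - x))) \<longlonglongrightarrow> ennreal (V (\<zeta> UNIV \<omega> x - x))"
        by (intro tendsto_eventually) (auto elim: eventually_mono)
      then show ?case by (intro lim_imp_Liminf[symmetric]) auto
    qed
  qed
  also have "\<dots> \<le> liminf (\<lambda>n. \<integral>\<^sup>+\<omega>. ennreal (V (\<zeta> (sites n) \<omega> x - x)) \<partial>M)"
    by (rule nn_integral_liminf) measurable
  also have "\<dots> \<le> ennreal C" by (rule Liminf_le) (auto simp: fin)
  finally show ?thesis .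
qed

end

section \<open>The bound on the critical value\<close>

text \<open>The expression is the sum of k r^k over k >= 2; the proof factors it as r (1/(1-r)^2 -
  1).\<close>

lemma cycle_series_strict_mono:
  fixes r s :: real
  assumes "0 \<le> r" "r < s" "s < 1"
  shows "r / (1 - r)^2 - r < s / (1 - s)^2 - s"
proof -
  have sq: "(1 - s)^2 \<le> (1 - r)^2" "0 < (1 - s)^2" "(1 - s)^2 < 1"
    using assms by (auto intro!: power_mono simp: power_less_one_iff)
  then have a: "1 / (1 - r)^2 \<le> 1 / (1 - s)^2" "1 < 1 / (1 - s)^2"
    by (auto intro!: divide_left_mono simp: zero_less_mult_iff)
  have "r * (1 / (1 - r)^2 - 1) \<le> r * (1 / (1 - s)^2 - 1)" using a assms by (intro mult_left_mono) auto
  also have "\<dots> < s * (1 / (1 - s)^2 - 1)" using a assms by (intro mult_strict_right_mono) auto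
  finally show ?thesis by (simp add: algebra_simps)
qed

lemma ex1_rho: "\<exists>!r::real. 0 \<le> r \<and> r \<le> 1 \<and> r / (1 - r)^2 - r = 1"
proof (rule ex_ex1I)
  \<comment> \<open>Clearing denominators in the equation, r = (1 + r)(1 - r)^2, gives this cubic;
    it is 1 at 0 and -1 at 1.\<close>
  let ?h = "\<lambda>r::real. r^3 - r^2 - 2 * r + 1"
  have "\<exists>r\<ge>0. r \<le> 1 \<and> ?h r = 0"
    by (rule IVT2') (auto intro!: continuous_intros)
  then obtain r where r: "0 \<le> r" "r \<le> 1" "?h r = 0" by blast
  have "r \<noteq> 1" using r(3) by auto
  then have "r / (1 - r)^2 - r = 1"
  proof -
    have "r = (1 + r) * (1 - r)^2" using r(3) by (simp add: algebra_simps power2_eq_square power3_eq_cube)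
    moreover have "(1 - r)^2 \<noteq> 0" using \<open>r \<noteq> 1\<close> by simp
    ultimately have "r / (1 - r)^2 = 1 + r" by (metis nonzero_mult_div_cancel_right)
    then show ?thesis by simp
  qed
  then show "\<exists>r::real. 0 \<le> r \<and> r \<le> 1 \<and> r / (1 - r)^2 - r = 1" using r by blast
next
  fix r s :: real
  assume "0 \<le> r \<and> r \<le> 1 \<and> r / (1 - r)^2 - r = 1" "0 \<le> s \<and> s \<le> 1 \<and> s / (1 - s)^2 - s = 1"
  \<comment> \<open>At 1 the division by zero yields 0, so the left side would be -1.\<close>
  moreover from this have "r \<noteq> 1" "s \<noteq> 1" by auto
  ultimately show "r = s"
    using cycle_series_strict_mono[of r s] cycle_series_strict_mono[of s r]
    by (cases r s rule: linorder_cases) auto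
qed

section \<open>Theta sums and Gaussian integrals\<close>

lemma nn_integral_gaussian:
  assumes "0 < (\<alpha>::real)"
  shows "(\<integral>\<^sup>+x. ennreal (exp (- \<alpha> * x^2)) \<partial>lborel) = ennreal (sqrt (pi / \<alpha>))"
proof -
  define s where "s = sqrt (1 / (2 * \<alpha>))"
  have s: "0 < s" "s^2 = 1 / (2 * \<alpha>)" using assms by (auto simp: s_def)
  have eq: "exp (- \<alpha> * x^2) = sqrt (pi / \<alpha>) * normal_density 0 s x" for x
    using assms by (simp add: normal_density_def s(2) field_simps real_sqrt_divide real_sqrt_mult)
  have "(\<integral>\<^sup>+x. ennreal (exp (- \<alpha> * x^2)) \<partial>lborel) = (\<integral>\<^sup>+x. ennreal (sqrt (pi / \<alpha>)) * ennreal (normal_density 0 s x) \<partial>lborel)"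
    unfolding eq using assms by (intro nn_integral_cong ennreal_mult) (auto simp: normal_density_nonneg)
  also have "\<dots> = ennreal (sqrt (pi / \<alpha>)) * (\<integral>\<^sup>+x. ennreal (normal_density 0 s x) \<partial>lborel)"
    by (rule nn_integral_cmult) simp
  also have "(\<integral>\<^sup>+x. ennreal (normal_density 0 s x) \<partial>lborel) = ennreal (\<integral>x. normal_density 0 s x \<partial>lborel)"
    using s by (intro nn_integral_eq_integral integrable_normal_density) (auto simp: normal_density_nonneg)
  finally show ?thesis using s by (simp add: integral_normal_density)
qed

text \<open>Each nonzero n is charged to the unit interval next to it on the side of the origin,
  where the Gaussian is at least its value at n. These intervals are disjoint, and n = 0 contributes
  the 1.\<close>

lemma theta_sum_le:
  fixes N :: "int set"
  assumes "finite N" "0 < \<alpha>"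
  shows "(\<Sum>n\<in>N. exp (- \<alpha> * (real_of_int n)^2)) \<le> 1 + sqrt (pi / \<alpha>)"
proof -
  \<comment> \<open>Rounding away from the origin, so that x never exceeds \<open>J x\<close> in
    absolute value.\<close>
  define J :: "real \<Rightarrow> int" where "J x = (if 0 < x then \<lceil>x\<rceil> else \<lfloor>x\<rfloor>)" for x
  have Jset: "{x. J x = n} = (if 0 < n then {real_of_int n - 1<..real_of_int n} else {real_of_int n..<real_of_int n + 1})"
    if "n \<noteq> 0" for n
  proof (cases "0 < n")
    case True
    have "J x = n \<longleftrightarrow> real_of_int n - 1 < x \<and> x \<le> real_of_int n" for x
    proof (cases "0 < x")
      case True
      then show ?thesis by (simp add: J_def ceiling_eq_iff)
    next
      case False
      have "1 \<le> real_of_int n" using \<open>0 < n\<close> by linarith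
      moreover have "\<lfloor>x\<rfloor> \<noteq> n"
      proof
        assume "\<lfloor>x\<rfloor> = n"
        then have "real_of_int n \<le> x" by linarith
        then show False using False \<open>1 \<le> real_of_int n\<close> by linarith
      qed
      ultimately show ?thesis using False by (auto simp: J_def)
    qed
    then show ?thesis using True by (simp only: if_True greaterThanAtMost_def greaterThan_def atMost_def Int_def mem_Collect_eq)
  next
    case False
    then have n: "real_of_int n \<le> -1" using that by linarith
    have "J x = n \<longleftrightarrow> real_of_int n \<le> x \<and> x < real_of_int n + 1" for x
    proof (cases "0 < x")
      case True
      have "\<lceil>x\<rceil> \<noteq> n"
      proof
        assume "\<lceil>x\<rceil> = n"
        then have "x \<le> real_of_int n" by linarith
        then show False using True n by linarith
      qed
      then show ?thesis using True n by (auto simp: J_def)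
    next
      case False
      then show ?thesis by (auto simp: J_def floor_eq_iff)
    qed
    then show ?thesis
      using False by (simp only: if_False atLeastLessThan_def atLeast_def lessThan_def Int_def mem_Collect_eq)
  qed
  have Jm: "{x. J x = n} \<in> sets lborel" "emeasure lborel {x. J x = n} = 1" if "n \<noteq> 0" for n
    using that by (auto simp: Jset)
  have J_abs: "\<bar>x\<bar> \<le> \<bar>real_of_int (J x)\<bar>" for x
    unfolding J_def by (auto; linarith)
  have "ennreal (\<Sum>n\<in>N - {0}. exp (- \<alpha> * (real_of_int n)^2)) = (\<Sum>n\<in>N - {0}. ennreal (exp (- \<alpha> * (real_of_int n)^2)))"
    by (subst sum_ennreal) auto
  also have "\<dots> = (\<Sum>n\<in>N - {0}. \<integral>\<^sup>+x. ennreal (exp (- \<alpha> * (real_of_int n)^2)) * indicator {x. J x = n} x \<partial>lborel)"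
    using Jm by (intro sum.cong) (auto simp: nn_integral_cmult)
  also have "\<dots> = (\<integral>\<^sup>+x. (\<Sum>n\<in>N - {0}. ennreal (exp (- \<alpha> * (real_of_int n)^2)) * indicator {x. J x = n} x) \<partial>lborel)"
    using Jm by (intro nn_integral_sum[symmetric]) auto
  also have "\<dots> \<le> (\<integral>\<^sup>+x. ennreal (exp (- \<alpha> * x^2)) \<partial>lborel)"
  proof (rule nn_integral_mono)
    fix x :: real
    have "(\<Sum>n\<in>N - {0}. ennreal (exp (- \<alpha> * (real_of_int n)^2)) * indicator {x. J x = n} x) =
      (\<Sum>n\<in>N - {0}. if n = J x then ennreal (exp (- \<alpha> * (real_of_int n)^2)) else 0)"
      by (intro sum.cong) (auto simp: indicator_def)
    also have "\<dots> \<le> ennreal (exp (- \<alpha> * (real_of_int (J x))^2))" using assms(1) by (simp add: sum.delta)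
    also have "\<dots> \<le> ennreal (exp (- \<alpha> * x^2))"
      using assms(2) J_abs[of x] by (intro ennreal_leI) (simp add: abs_le_square_iff)
    finally show "(\<Sum>n\<in>N - {0}. ennreal (exp (- \<alpha> * (real_of_int n)^2)) * indicator {x. J x = n} x) \<le> ennreal (exp (- \<alpha> * x^2))" .
  qed
  also have "\<dots> = ennreal (sqrt (pi / \<alpha>))" by (rule nn_integral_gaussian[OF assms(2)])
  finally have "(\<Sum>n\<in>N - {0}. exp (- \<alpha> * (real_of_int n)^2)) \<le> sqrt (pi / \<alpha>)"
    using assms(2) by simp
  moreover have "(\<Sum>n\<in>N. exp (- \<alpha> * (real_of_int n)^2)) \<le> (\<Sum>n\<in>insert 0 (N - {0}). exp (- \<alpha> * (real_of_int n)^2))"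
    using assms(1) by (intro sum_mono2) auto
  ultimately show ?thesis using assms(1) by (subst (asm) sum.insert) auto
qed

text \<open>The weight factorizes over coordinates, so enlarging S to a box turns the sum into a
  product of d one-dimensional theta sums.\<close>

lemma sqnorm_sum_le:
  fixes S :: "('d::finite) zd set"
  assumes "finite S" "0 < \<alpha>"
  shows "(\<Sum>v\<in>S. exp (- \<alpha> * sqnorm v)) \<le> (1 + sqrt (pi / \<alpha>)) ^ CARD('d)"
proof -
  define N where "N = (\<Union>i. (\<lambda>v. v $ i) ` S)"
  have finN: "finite N" unfolding N_def using assms(1) by auto
  let ?F = "\<lambda>g :: 'd \<Rightarrow> int. \<Prod>i\<in>UNIV. exp (- \<alpha> * (real_of_int (g i))^2)"
  have inj: "inj_on vec_nth S" by (auto intro!: inj_onI simp: vec_eq_iff)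
  have "(\<Sum>v\<in>S. exp (- \<alpha> * sqnorm v)) = (\<Sum>v\<in>S. ?F (vec_nth v))"
    by (intro sum.cong) (auto simp: sqnorm_def sum_distrib_left exp_sum[symmetric])
  also have "\<dots> = sum ?F (vec_nth ` S)" by (simp add: sum.reindex[OF inj])
  also have "\<dots> \<le> sum ?F (PiE UNIV (\<lambda>_. N))"
    using finN by (intro sum_mono2 finite_PiE) (auto simp: N_def intro!: prod_nonneg)
  also have "\<dots> = (\<Prod>i\<in>(UNIV :: 'd set). \<Sum>n\<in>N. exp (- \<alpha> * (real_of_int n)^2))"
    using finN by (intro prod_sum_PiE[symmetric]) auto
  also have "\<dots> = (\<Sum>n\<in>N. exp (- \<alpha> * (real_of_int n)^2)) ^ CARD('d)" by simp
  also have "\<dots> \<le> (1 + sqrt (pi / \<alpha>)) ^ CARD('d)"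
    using theta_sum_le[OF finN assms(2)] by (intro power_mono sum_nonneg) auto
  finally show ?thesis .
qed

lemma fcycle_path:
  assumes "\<gamma> \<in> cycles_at x"
  shows "csupp \<gamma> = (\<lambda>n. (\<gamma> ^^ n) x) ` {..<card (csupp \<gamma>)}" "inj_on (\<lambda>n. (\<gamma> ^^ n) x) {..<card (csupp \<gamma>)}"
proof -
  have self: "x \<in> orbit \<gamma> x" using permutation_self_in_orbit[OF cycles_atD(1)[OF assms]] .
  have o: "csupp \<gamma> = (\<lambda>n. (\<gamma> ^^ n) x) ` {0..<funpow_dist1 \<gamma> x x}"
    using orbit_conv_funpow_dist1[OF self] orbit_fcycle[OF assms] by simp
  have i: "inj_on (\<lambda>n. (\<gamma> ^^ n) x) {0..<funpow_dist1 \<gamma> x x}" using inj_on_funpow_dist1[OF self] .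
  have "card (csupp \<gamma>) = funpow_dist1 \<gamma> x x" unfolding o by (simp only: card_image[OF i]) simp
  then show "csupp \<gamma> = (\<lambda>n. (\<gamma> ^^ n) x) ` {..<card (csupp \<gamma>)}" "inj_on (\<lambda>n. (\<gamma> ^^ n) x) {..<card (csupp \<gamma>)}"
    using o i by (simp_all add: lessThan_atLeast0)
qed

text \<open>A cycle of length \<open>k\<close> through the origin is determined by its \<open>k\<close> nonzero jumps.\<close>

lemma sum_cycles_of_length_le:
  fixes \<Gamma> :: "(('d::finite) zd \<Rightarrow> 'd zd) set"
  assumes "finite \<Gamma>" "\<Gamma> \<subseteq> cycles_at 0" "\<And>\<gamma>. \<gamma> \<in> \<Gamma> \<Longrightarrow> card (csupp \<gamma>) = k" "0 < \<alpha>"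
  shows "(\<Sum>\<gamma>\<in>\<Gamma>. cweight sqnorm \<alpha> \<gamma>) \<le> ((1 + sqrt (pi / \<alpha>)) ^ CARD('d) - 1) ^ k"
proof -
  let ?w = "\<lambda>v :: 'd zd. exp (- \<alpha> * sqnorm v)"
  define \<Phi> where "\<Phi> \<gamma> = restrict (\<lambda>i. (\<gamma> ^^ Suc i) 0 - (\<gamma> ^^ i) 0) {..<k}" for \<gamma> :: "'d zd \<Rightarrow> 'd zd"
  define S where "S = (\<Union>\<gamma>\<in>\<Gamma>. \<Phi> \<gamma> ` {..<k})"
  have finS: "finite S" unfolding S_def using assms(1) by auto
  have supp: "csupp \<gamma> = (\<lambda>n. (\<gamma> ^^ n) 0) ` {..<k}" "inj_on (\<lambda>n. (\<gamma> ^^ n) 0) {..<k}" if "\<gamma> \<in> \<Gamma>" for \<gamma>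
  proof -
    have g: "\<gamma> \<in> cycles_at 0" using that assms(2) by blast
    show "csupp \<gamma> = (\<lambda>n. (\<gamma> ^^ n) 0) ` {..<k}" "inj_on (\<lambda>n. (\<gamma> ^^ n) 0) {..<k}"
      using fcycle_path[OF g] unfolding assms(3)[OF that] .
  qed
  have S0: "0 \<notin> S"
  proof
    assume "0 \<in> S"
    then obtain \<gamma> i where g: "\<gamma> \<in> \<Gamma>" "i < k" "\<gamma> ((\<gamma> ^^ i) 0) = (\<gamma> ^^ i) 0" by (auto simp: S_def \<Phi>_def)
    moreover have "(\<gamma> ^^ i) 0 \<in> csupp \<gamma>" using supp(1)[OF g(1)] g(2) by auto
    ultimately show False by (simp add: csupp_def)
  qed
  \<comment> \<open>Partial sums of the jumps recover the path from the origin, and the path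
    recovers both support and values.\<close>
  have inj: "inj_on \<Phi> \<Gamma>"
  proof (rule inj_onI)
    fix \<gamma> \<gamma>' assume g: "\<gamma> \<in> \<Gamma>" "\<gamma>' \<in> \<Gamma>" "\<Phi> \<gamma> = \<Phi> \<gamma>'"
    have eq: "(\<gamma> ^^ i) 0 = (\<gamma>' ^^ i) 0" if "i \<le> k" for i
      using that
    proof (induction i)
      case (Suc i)
      then have "\<Phi> \<gamma> i = \<Phi> \<gamma>' i" "i < k" using g(3) by auto
      then show ?case using Suc by (auto simp: \<Phi>_def)
    qed simp
    have supp_eq: "csupp \<gamma> = csupp \<gamma>'"
      unfolding supp(1)[OF g(1)] supp(1)[OF g(2)] using eq by (intro image_cong) auto
    show "\<gamma> = \<gamma>'"
    proof
      fix y
      show "\<gamma> y = \<gamma>' y"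
      proof (cases "y \<in> csupp \<gamma>")
        case True
        then obtain i where "i < k" "y = (\<gamma> ^^ i) 0" using supp(1)[OF g(1)] by auto
        then show ?thesis using eq[of i] eq[of "Suc i"] by simp
      next
        case False
        then show ?thesis using supp_eq by (simp add: csupp_def set_eq_iff)
      qed
    qed
  qed
  have "cweight sqnorm \<alpha> \<gamma> = (\<Prod>i<k. ?w (\<Phi> \<gamma> i))" if "\<gamma> \<in> \<Gamma>" for \<gamma>
  proof -
    have "(\<Sum>x\<in>csupp \<gamma>. sqnorm (\<gamma> x - x)) = (\<Sum>i<k. sqnorm (\<Phi> \<gamma> i))"
      unfolding supp(1)[OF that] sum.reindex[OF supp(2)[OF that]] by (intro sum.cong) (auto simp: \<Phi>_def)
    then show ?thesis by (simp add: cweight_def sum_distrib_left exp_sum)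
  qed
  then have "(\<Sum>\<gamma>\<in>\<Gamma>. cweight sqnorm \<alpha> \<gamma>) = (\<Sum>g\<in>\<Phi> ` \<Gamma>. \<Prod>i<k. ?w (g i))"
    by (simp add: sum.reindex[OF inj])
  \<comment> \<open>The constraints that the path is closed and self-avoiding are dropped; only
    nonzero jumps are retained.\<close>
  also have "\<dots> \<le> (\<Sum>g\<in>PiE {..<k} (\<lambda>_. S). \<Prod>i<k. ?w (g i))"
  proof (rule sum_mono2)
    show "finite (PiE {..<k} (\<lambda>_. S))" using finS by (intro finite_PiE) auto
    show "\<Phi> ` \<Gamma> \<subseteq> PiE {..<k} (\<lambda>_. S)"
    proof (rule image_subsetI)
      fix \<gamma> assume "\<gamma> \<in> \<Gamma>"
      then have "\<Phi> \<gamma> i \<in> S" if "i < k" for i using that by (auto simp: S_def)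
      moreover have "\<Phi> \<gamma> \<in> extensional {..<k}" by (simp add: \<Phi>_def)
      ultimately show "\<Phi> \<gamma> \<in> PiE {..<k} (\<lambda>_. S)" by (auto simp: PiE_def)
    qed
  qed (auto intro!: prod_nonneg)
  also have "\<dots> = (\<Prod>i<k. \<Sum>v\<in>S. ?w v)"
    using finS by (intro prod_sum_PiE[symmetric]) auto
  also have "\<dots> = (\<Sum>v\<in>S. ?w v) ^ k" by simp
  also have "\<dots> \<le> ((1 + sqrt (pi / \<alpha>)) ^ CARD('d) - 1) ^ k"
  proof (rule power_mono)
    \<comment> \<open>The jump 0 has weight 1, and removing it gives the -1 in the bound.\<close>
    have "(\<Sum>v\<in>insert 0 S. ?w v) \<le> (1 + sqrt (pi / \<alpha>)) ^ CARD('d)"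
      using finS by (intro sqnorm_sum_le assms) auto
    then show "(\<Sum>v\<in>S. ?w v) \<le> (1 + sqrt (pi / \<alpha>)) ^ CARD('d) - 1"
      using finS S0 by (simp add: sqnorm_def)
  qed (auto intro: sum_nonneg)
  finally show ?thesis .
qed

text \<open>Grouping by length bounds \<open>beta\<close> by the sum of k r^k over k >= 2, that is,
  the differentiated geometric series without its term r for k = 1.\<close>

lemma beta_sqnorm_le:
  assumes "0 < \<alpha>" and r: "r = (1 + sqrt (pi / \<alpha>)) ^ CARD('d) - 1" "r < 1"
  shows "beta (sqnorm :: ('d::finite) zd \<Rightarrow> real) \<alpha> \<le> ennreal (r / (1 - r)^2 - r)"
proof -
  have r0: "0 \<le> r" unfolding r(1) using assms(1) by simp
  have sums: "(\<lambda>k. real k * r ^ k) sums (r / (1 - r)^2)"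
  proof -
    have "(\<lambda>n. r * (real (Suc n) * r ^ n)) sums (r * (1 / (1 - r)^2))"
      using r0 r(2) geometric_deriv_sums[of r] by (intro sums_mult) simp
    then have "(\<lambda>n. real (Suc n) * r ^ Suc n) sums (r / (1 - r)^2)" by (simp add: mult_ac)
    then show ?thesis using sums_Suc[of "\<lambda>k. real k * r ^ k"] by simp
  qed
  have fin: "(\<Sum>\<gamma>\<in>\<Gamma>. real (card (csupp \<gamma>)) * cweight sqnorm \<alpha> \<gamma>) \<le> r / (1 - r)^2 - r"
    if G: "finite \<Gamma>" "\<Gamma> \<subseteq> cycles_at 0" for \<Gamma> :: "('d zd \<Rightarrow> 'd zd) set"
  proof -
    let ?K = "(\<lambda>\<gamma>. card (csupp \<gamma>)) ` \<Gamma>"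
    have K: "finite ?K" "1 \<notin> ?K" using G cycles_atD(5) by fastforce+
    have "(\<Sum>\<gamma>\<in>\<Gamma>. real (card (csupp \<gamma>)) * cweight sqnorm \<alpha> \<gamma>) =
      (\<Sum>k\<in>?K. \<Sum>\<gamma> | \<gamma> \<in> \<Gamma> \<and> card (csupp \<gamma>) = k. real (card (csupp \<gamma>)) * cweight sqnorm \<alpha> \<gamma>)"
      by (rule sum.group[symmetric]) (use G in auto)
    also have "\<dots> = (\<Sum>k\<in>?K. real k * (\<Sum>\<gamma> | \<gamma> \<in> \<Gamma> \<and> card (csupp \<gamma>) = k. cweight sqnorm \<alpha> \<gamma>))"
      by (intro sum.cong) (auto simp: sum_distrib_left)
    also have "\<dots> \<le> (\<Sum>k\<in>?K. real k * r ^ k)"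
      using G assms(1) unfolding r(1)
      by (intro sum_mono mult_left_mono sum_cycles_of_length_le) auto
    also have "\<dots> = (\<Sum>k\<in>insert 1 ?K. real k * r ^ k) - r" using K by simp
    also have "(\<Sum>k\<in>insert 1 ?K. real k * r ^ k) \<le> (\<Sum>k. real k * r ^ k)"
      using K r0 by (intro sum_le_suminf sums_summable[OF sums]) auto
    also have "\<dots> = r / (1 - r)^2" using sums_unique[OF sums] by simp
    finally show ?thesis by simp
  qed
  have "beta (sqnorm :: 'd zd \<Rightarrow> real) \<alpha> = (SUP \<Gamma>\<in>{\<Gamma>. finite \<Gamma> \<and> \<Gamma> \<subseteq> {\<gamma> :: 'd zd \<Rightarrow> 'd zd. is_fcycle \<gamma> \<and> 0 \<in> csupp \<gamma>}}.
    \<Sum>\<gamma>\<in>\<Gamma>. ennreal (real (card (csupp \<gamma>)) * cweight sqnorm \<alpha> \<gamma>))"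
    unfolding beta_def by (subst nonneg_infsum_complete) auto
  also have "\<dots> \<le> ennreal (r / (1 - r)^2 - r)"
  proof (rule SUP_least)
    fix \<Gamma> :: "('d zd \<Rightarrow> 'd zd) set"
    assume "\<Gamma> \<in> {\<Gamma>. finite \<Gamma> \<and> \<Gamma> \<subseteq> {\<gamma>. is_fcycle \<gamma> \<and> 0 \<in> csupp \<gamma>}}"
    then have "finite \<Gamma>" "\<Gamma> \<subseteq> cycles_at 0" by (auto simp: cycles_at_def)
    from fin[OF this] show "(\<Sum>\<gamma>\<in>\<Gamma>. ennreal (real (card (csupp \<gamma>)) * cweight sqnorm \<alpha> \<gamma>)) \<le> ennreal (r / (1 - r)^2 - r)"
      by (subst sum_ennreal) (auto intro: ennreal_leI simp: cweight_def)
  qed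
  finally show ?thesis .
qed

text \<open>With c the d-th root of 1 + \<rho> minus 1, every \<alpha> > pi/c^2 gives r < \<rho> and
  hence \<open>beta\<close> < 1 by strict monotonicity. The estimate is made at pi/c^2 + e because
  at e = 0 it only yields the bound 1.\<close>

lemma alpha_star_sqnorm_le:
  fixes \<rho> :: real
  assumes "0 \<le> \<rho>" "\<rho> \<le> 1" "\<rho> / (1 - \<rho>)^2 - \<rho> = 1"
  shows "alpha_star (sqnorm :: ('d::finite) zd \<Rightarrow> real) \<le> ereal (pi / ((1 + \<rho>) powr (1 / real CARD('d)) - 1)^2)"
proof -
  let ?n = "real CARD('d)"
  define c where "c = (1 + \<rho>) powr (1 / ?n) - 1"
  have n: "0 < ?n" by simp
  have \<rho>: "0 < \<rho>" "\<rho> < 1" using assms by (auto simp: less_le)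
  have c: "0 < c" unfolding c_def using \<rho> by (simp add: gr_one_powr)
  have cn: "(1 + c) ^ CARD('d) = 1 + \<rho>"
    using \<rho> by (simp add: c_def powr_realpow[symmetric] powr_powr)
  have "alpha_star (sqnorm :: 'd zd \<Rightarrow> real) \<le> ereal (pi / c^2) + ereal e" if e: "0 < e" for e
  proof -
    define \<alpha> where "\<alpha> = pi / c^2 + e"
    have \<alpha>: "0 < \<alpha>" "pi / c^2 < \<alpha>" using c e by (auto simp: \<alpha>_def add_pos_pos)
    have "pi < \<alpha> * c^2" using \<alpha>(2) c by (simp add: pos_divide_less_eq)
    then have "pi / \<alpha> < c^2" using \<alpha>(1) by (simp add: pos_divide_less_eq mult.commute)
    then have "sqrt (pi / \<alpha>) < c" using c by (metis real_sqrt_less_iff real_sqrt_unique less_imp_le)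
    then have lt: "(1 + sqrt (pi / \<alpha>)) ^ CARD('d) < (1 + c) ^ CARD('d)"
      using \<alpha>(1) by (intro power_strict_mono) auto
    define r where "r = (1 + sqrt (pi / \<alpha>)) ^ CARD('d) - 1"
    have r: "0 \<le> r" "r < \<rho>" using lt cn \<alpha>(1) by (auto simp: r_def)
    have "beta (sqnorm :: 'd zd \<Rightarrow> real) \<alpha> \<le> ennreal (r / (1 - r)^2 - r)"
      by (rule beta_sqnorm_le[OF \<alpha>(1) r_def]) (use r \<rho> in simp)
    also have "\<dots> < 1"
      using cycle_series_strict_mono[OF r \<rho>(2)] assms(3) by (simp add: ennreal_less_one_iff)
    finally have "beta (sqnorm :: 'd zd \<Rightarrow> real) \<alpha> < 1" .
    then have "alpha_star (sqnorm :: 'd zd \<Rightarrow> real) \<le> ereal \<alpha>"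
      unfolding alpha_star_def by (intro Inf_lower) auto
    then show ?thesis by (simp add: \<alpha>_def)
  qed
  then show ?thesis unfolding c_def[symmetric] by (rule ereal_le_epsilon2)
qed

section \<open>Assembling the family of random permutations\<close>

context subcritical
begin

text \<open>Infinite volumes other than the whole lattice carry no law or convergence requirement;
  the identity is an admissible member of their \<open>Scond\<close>.\<close>

definition zfamily :: "'a zd set \<Rightarrow> real \<Rightarrow> 'a zd \<Rightarrow> 'a zd" where
  "zfamily \<Lambda> u = (if finite \<Lambda> then zfin \<Lambda> u else if \<Lambda> = UNIV then zinf u else id)"

lemma zfamily_measurable: "zfamily \<Lambda> \<in> unit_uniform \<rightarrow>\<^sub>M Sspace"
proof -
  have "(\<lambda>u. id :: 'a zd \<Rightarrow> 'a zd) \<in> unit_uniform \<rightarrow>\<^sub>M Sspace" by (simp add: space_Sspace)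
  moreover have "zfamily \<Lambda> = (if finite \<Lambda> then zfin \<Lambda> else if \<Lambda> = UNIV then zinf else (\<lambda>u. id))"
    by (auto simp: zfamily_def fun_eq_iff)
  ultimately show ?thesis using zfin_measurable[of \<Lambda>] zinf_measurable by simp
qed

lemma zfamily_Scond:
  assumes "u \<in> space unit_uniform"
  shows "zfamily \<Lambda> u \<in> Scond \<Lambda> id"
proof (cases "finite \<Lambda>")
  case True
  then show ?thesis
    using zfin_props(1)[of \<Lambda> u] assms by (auto simp: zfamily_def Scond_id space_restrict_space)
next
  case False
  then show ?thesis using bij_zinf[of u] by (auto simp: zfamily_def Scond_def)
qed

lemma coupling_exists:
  "\<exists>(P :: ('a zd set \<Rightarrow> 'a zd \<Rightarrow> 'a zd) measure) \<zeta>. prob_space P \<and>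
    (\<forall>\<Lambda>. \<zeta> \<Lambda> \<in> P \<rightarrow>\<^sub>M Sspace) \<and> (\<forall>\<Lambda> \<omega>. \<omega> \<in> space P \<longrightarrow> \<zeta> \<Lambda> \<omega> \<in> Scond \<Lambda> id) \<and>
    (\<forall>\<Lambda>. finite \<Lambda> \<longrightarrow> distr P Sspace (\<zeta> \<Lambda>) = Gibbs_fin V \<alpha> \<Lambda> id) \<and>
    (AE \<omega> in P. \<forall>x. eventually (\<lambda>\<Lambda>. \<zeta> \<Lambda> \<omega> x = \<zeta> UNIV \<omega> x) (finite_subsets_at_top UNIV))"
proof -
  \<comment> \<open>The required sample space consists of families of permutations, so the law of
    the family is pushed forward and \<zeta> becomes evaluation. Restricting each factor to
    \<open>Scond\<close> makes membership hold for every sample point, not just almost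
    surely.\<close>
  define N where "N = Pi\<^sub>M UNIV (\<lambda>\<Lambda> :: 'a zd set. restrict_space Sspace (Scond \<Lambda> id))"
  define f where "f = (\<lambda>u \<Lambda>. zfamily \<Lambda> u)"
  define P where "P = distr unit_uniform N f"
  have spr: "space (restrict_space Sspace (Scond \<Lambda> id)) = Scond \<Lambda> id" for \<Lambda> :: "'a zd set"
    by (auto simp: space_restrict_space space_Sspace Scond_def)
  have f: "f \<in> unit_uniform \<rightarrow>\<^sub>M N"
    unfolding f_def N_def
  proof (rule measurable_PiM_single')
    show "zfamily \<Lambda> \<in> unit_uniform \<rightarrow>\<^sub>M restrict_space Sspace (Scond \<Lambda> id)" for \<Lambda>
      using zfamily_measurable zfamily_Scond by (intro measurable_restrict_space2) auto
    show "(\<lambda>u \<Lambda>. zfamily \<Lambda> u) \<in> space unit_uniform \<rightarrow> (\<Pi>\<^sub>E \<Lambda>\<in>UNIV. space (restrict_space Sspace (Scond \<Lambda> id)))"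
      unfolding spr using zfamily_Scond by (simp add: Pi_iff PiE_iff)
  qed
  have comp: "(\<lambda>\<omega>. \<omega> \<Lambda>) \<in> N \<rightarrow>\<^sub>M Sspace" for \<Lambda>
  proof -
    have "(\<lambda>\<omega>. \<omega> \<Lambda>) \<in> N \<rightarrow>\<^sub>M restrict_space Sspace (Scond \<Lambda> id)"
      unfolding N_def by (rule measurable_component_singleton) simp
    then show ?thesis by (simp add: measurable_restrict_space2_iff)
  qed
  have evalm: "(\<lambda>\<omega>. \<omega> \<Lambda> x) \<in> N \<rightarrow>\<^sub>M count_space UNIV" for \<Lambda> x
    by (rule measurable_compose[OF comp measurable_eval])
  have prob: "prob_space P"
    unfolding P_def by (rule prob_space.prob_space_distr[OF prob_space_unit_uniform f])
  have law: "distr P Sspace (\<lambda>\<omega>. \<omega> \<Lambda>) = distr unit_uniform Sspace (zfamily \<Lambda>)" for \<Lambda>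
    unfolding P_def distr_distr[OF comp f] by (simp add: f_def comp_def)
  \<comment> \<open>Convergence is spelled out with quantifiers over finite sets, of which there are
    countably many; this makes it measurable, so the almost sure statement transfers to the image
    measure.\<close>
  let ?conv = "\<lambda>\<omega> :: 'a zd set \<Rightarrow> 'a zd \<Rightarrow> 'a zd. \<forall>x. \<exists>K\<in>{K. finite K}. \<forall>\<Lambda>\<in>{\<Lambda>. finite \<Lambda> \<and> K \<subseteq> \<Lambda>}. \<omega> \<Lambda> x = \<omega> UNIV x"
  have conv_iff: "?conv \<omega> \<longleftrightarrow> (\<forall>x. eventually (\<lambda>\<Lambda>. \<omega> \<Lambda> x = \<omega> UNIV x) (finite_subsets_at_top UNIV))" for \<omega>
    by (simp add: eventually_finite_subsets_at_top)
  have eqm: "{\<omega> \<in> space N. \<omega> \<Lambda> x = \<omega> UNIV x} \<in> sets N" for \<Lambda> x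
  proof -
    have "{\<omega> \<in> space N. \<omega> \<Lambda>' x = y} \<in> sets N" for \<Lambda>' y
      using measurable_sets_Collect[OF evalm[of \<Lambda>' x], of "\<lambda>z. z = y"] by simp
    then have "{\<omega> \<in> space N. \<exists>y. \<omega> \<Lambda> x = y \<and> \<omega> UNIV x = y} \<in> sets N"
      by (intro sets.sets_Collect_countable_Ex sets.sets_Collect_conj)
    moreover have "(\<exists>y. \<omega> \<Lambda> x = y \<and> \<omega> UNIV x = y) \<longleftrightarrow> \<omega> \<Lambda> x = \<omega> UNIV x"
      for \<omega> :: "'a zd set \<Rightarrow> 'a zd \<Rightarrow> 'a zd" by auto
    ultimately show ?thesis by (simp only:)
  qed
  have "countable {\<Lambda> :: 'a zd set. finite \<Lambda> \<and> K \<subseteq> \<Lambda>}" for K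
    by (rule countable_subset[OF _ countable_Collect_finite]) auto
  then have "{\<omega> \<in> space N. \<forall>\<Lambda>\<in>{\<Lambda>. finite \<Lambda> \<and> K \<subseteq> \<Lambda>}. \<omega> \<Lambda> x = \<omega> UNIV x} \<in> sets N" for K x
    using eqm by (intro sets.sets_Collect_countable_All')
  then have "{\<omega> \<in> space N. \<exists>K\<in>{K. finite K}. \<forall>\<Lambda>\<in>{\<Lambda>. finite \<Lambda> \<and> K \<subseteq> \<Lambda>}. \<omega> \<Lambda> x = \<omega> UNIV x} \<in> sets N" for x
    by (intro sets.sets_Collect_countable_Ex' countable_Collect_finite)
  then have "{\<omega> \<in> space N. ?conv \<omega>} \<in> sets N"
    by (rule sets.sets_Collect_countable_All)
  moreover have "AE u in unit_uniform. ?conv (f u)"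
    using AE_good
  proof eventually_elim
    case (elim u)
    have "eventually (\<lambda>\<Lambda>. f u \<Lambda> x = f u UNIV x) (finite_subsets_at_top UNIV)" for x
      using zfin_eventually_zinf[OF elim, of x]
      by (rule eventually_mono) (simp add: f_def zfamily_def infinite_UNIV_char_0)
    then show ?case unfolding conv_iff by blast
  qed
  ultimately have "AE \<omega> in P. ?conv \<omega>"
    unfolding P_def by (subst AE_distr_iff[OF f]) auto
  then have conv: "AE \<omega> in P. \<forall>x. eventually (\<lambda>\<Lambda>. \<omega> \<Lambda> x = \<omega> UNIV x) (finite_subsets_at_top UNIV)"
    unfolding conv_iff .
  show ?thesis
  proof (rule exI[of _ P], rule exI[of _ "\<lambda>\<Lambda> \<omega>. \<omega> \<Lambda>"], intro conjI prob conv allI impI)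
    show "(\<lambda>\<omega>. \<omega> \<Lambda>) \<in> P \<rightarrow>\<^sub>M Sspace" for \<Lambda> unfolding P_def using comp[of \<Lambda>] by simp
    show "\<omega> \<Lambda> \<in> Scond \<Lambda> id" if "\<omega> \<in> space P" for \<Lambda> \<omega>
      using that by (auto simp: P_def N_def space_PiM spr PiE_iff)
    show "distr P Sspace (\<lambda>\<omega>. \<omega> \<Lambda>) = Gibbs_fin V \<alpha> \<Lambda> id" if "finite \<Lambda>" for \<Lambda>
      using distr_zfin[OF that] that unfolding law by (simp add: zfamily_def[abs_def])
  qed
qed

end

section \<open>Composition with translations\<close>

lemma sqnorm_zero: "sqnorm 0 = 0"
  by (simp add: sqnorm_def)

lemma sqnorm_nonneg: "0 \<le> sqnorm x"
  by (simp add: sqnorm_def sum_nonneg)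

lemma sqnorm_minus_commute: "sqnorm (x - y) = sqnorm (y - x)"
  by (simp add: sqnorm_def power2_commute)

lemma abs_component_le_sqnorm: "\<bar>real_of_int (x $ i)\<bar> \<le> sqnorm x"
proof -
  have "\<bar>x $ i\<bar> \<le> (x $ i)^2"
  proof (cases "x $ i = 0")
    case False
    then have "1 * \<bar>x $ i\<bar> \<le> \<bar>x $ i\<bar> * \<bar>x $ i\<bar>" by (intro mult_right_mono) auto
    then show ?thesis by (simp add: power2_eq_square)
  qed simp
  also have "\<dots> \<le> (\<Sum>i\<in>UNIV. (x $ i)^2)" by (rule member_le_sum) auto
  finally show ?thesis unfolding sqnorm_def by linarith
qed

text \<open>Translating the image changes the energy by \<open>2 v \<cdot> (\<xi>(x) - x) + \<parallel>v\<parallel>\<^sup>2\<close> summed over \<open>\<Lambda>\<close>,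
  which only depends on the image set \<open>\<xi> ` \<Lambda>\<close>.\<close>

lemma Ham_tau_comp:
  assumes "\<pi> permutes \<Lambda>"
  shows "Ham sqnorm \<Lambda> (tau v \<circ> (\<xi> \<circ> \<pi>)) - Ham sqnorm \<Lambda> (\<xi> \<circ> \<pi>) = Ham sqnorm \<Lambda> (tau v \<circ> \<xi>) - Ham sqnorm \<Lambda> \<xi>"
proof -
  define dot :: "int ^ 'a \<Rightarrow> real" where "dot y = real_of_int (\<Sum>i\<in>UNIV. y $ i * v $ i)" for y
  have dot_diff: "dot (y - z) = dot y - dot z" for y z
    by (simp add: dot_def left_diff_distrib sum_subtractf)
  have sq: "sqnorm (tau v y - z) - sqnorm (y - z) = 2 * (dot y - dot z) + sqnorm v" for y z
  proof -
    have "((tau v y - z) $ i)^2 = ((y - z) $ i)^2 + 2 * ((y - z) $ i * v $ i) + (v $ i)^2" for i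
      by (simp add: tau_def power2_eq_square algebra_simps)
    then have "sqnorm (tau v y - z) = sqnorm (y - z) + 2 * dot (y - z) + sqnorm v"
      by (simp only: sqnorm_def dot_def sum.distrib sum_distrib_left[symmetric] of_int_add of_int_mult of_int_numeral)
    then show ?thesis by (simp add: dot_diff)
  qed
  have H: "Ham sqnorm \<Lambda> (tau v \<circ> \<eta>) - Ham sqnorm \<Lambda> \<eta> = (\<Sum>x\<in>\<Lambda>. 2 * (dot (\<eta> x) - dot x) + sqnorm v)" for \<eta>
    unfolding Ham_def sum_subtractf[symmetric] by (simp add: sq)
  have "(\<Sum>x\<in>\<Lambda>. dot (\<xi> (\<pi> x))) = (\<Sum>x\<in>\<Lambda>. dot (\<xi> x))"
    using sum.permute[OF assms, of "\<lambda>x. dot (\<xi> x)"] by (simp add: comp_def)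
  then show ?thesis
    unfolding H by (simp add: sum.distrib sum_subtractf sum_distrib_left[symmetric])
qed

text \<open>The energy change under \<open>tau v\<close> is the same for all permutations of
  \<Lambda>, so it contributes a common factor c that cancels in the normalization.\<close>

lemma rmul_Gibbs_fin:
  assumes L: "finite \<Lambda>"
  shows "rmul (Gibbs_fin sqnorm \<alpha> \<Lambda> id) (tau v) = Gibbs_fin sqnorm \<alpha> \<Lambda> (tau v)"
proof (rule measure_eqI)
  show "sets (rmul (Gibbs_fin sqnorm \<alpha> \<Lambda> id) (tau v)) = sets (Gibbs_fin sqnorm \<alpha> \<Lambda> (tau v))"
    by (simp add: rmul_def)
  fix A assume "A \<in> sets (rmul (Gibbs_fin sqnorm \<alpha> \<Lambda> id) (tau v))"
  then have A: "A \<in> sets Sspace" by (simp add: rmul_def)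
  define c where "c = exp (- \<alpha> * (Ham sqnorm \<Lambda> (tau v \<circ> id) - Ham sqnorm \<Lambda> id))"
  have c: "0 < c" by (simp add: c_def)
  have w: "exp (- \<alpha> * Ham sqnorm \<Lambda> (tau v \<circ> \<pi>)) = c * exp (- \<alpha> * Ham sqnorm \<Lambda> (id \<circ> \<pi>))" if "\<pi> permutes \<Lambda>" for \<pi>
  proof -
    have "Ham sqnorm \<Lambda> (tau v \<circ> \<pi>) = (Ham sqnorm \<Lambda> (tau v \<circ> id) - Ham sqnorm \<Lambda> id) + Ham sqnorm \<Lambda> (id \<circ> \<pi>)"
      using Ham_tau_comp[OF that, of v id] by simp
    then show ?thesis unfolding c_def by (simp only: distrib_left exp_add)
  qed
  have Zc: "Zpart sqnorm \<alpha> \<Lambda> (tau v) = c * Zpart sqnorm \<alpha> \<Lambda> id"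
    unfolding Zpart_eq[OF bij_tau] Zpart_eq[OF bij_id] sum_distrib_left using w by (intro sum.cong) auto
  have m: "(\<lambda>\<sigma>. tau v \<circ> \<sigma>) \<in> Gibbs_fin sqnorm \<alpha> \<Lambda> id \<rightarrow>\<^sub>M Sspace"
    using measurable_comp_left[OF bij_tau] by (simp cong: measurable_cong_sets)
  have "emeasure (rmul (Gibbs_fin sqnorm \<alpha> \<Lambda> id) (tau v)) A = (\<integral>\<^sup>+\<sigma>. indicator A \<sigma> \<partial>rmul (Gibbs_fin sqnorm \<alpha> \<Lambda> id) (tau v))"
    using A by (simp add: rmul_def)
  also have "\<dots> = (\<integral>\<^sup>+\<sigma>. indicator A (tau v \<circ> \<sigma>) \<partial>Gibbs_fin sqnorm \<alpha> \<Lambda> id)"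
    unfolding rmul_def by (rule nn_integral_distr[OF m]) (use A in simp)
  also have "\<dots> = (\<Sum>\<pi> | \<pi> permutes \<Lambda>. ennreal (exp (- \<alpha> * Ham sqnorm \<Lambda> (id \<circ> \<pi>)) / Zpart sqnorm \<alpha> \<Lambda> id) * indicator A (tau v \<circ> (id \<circ> \<pi>)))"
    using A measurable_compose[OF measurable_comp_left[OF bij_tau], of "indicator A" borel v]
    by (intro nn_integral_Gibbs_fin[OF L bij_id]) simp
  also have "\<dots> = emeasure (Gibbs_fin sqnorm \<alpha> \<Lambda> (tau v)) A"
    unfolding emeasure_Gibbs_fin[OF L bij_tau A] Zc using c w by (intro sum.cong) auto
  finally show "emeasure (rmul (Gibbs_fin sqnorm \<alpha> \<Lambda> id) (tau v)) A = emeasure (Gibbs_fin sqnorm \<alpha> \<Lambda> (tau v)) A" .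
qed

text \<open>Left composition with \<open>tau v\<close> commutes with every \<open>shift\<close>,
  because translations commute; it therefore preserves shift invariance of laws and of
  events.\<close>

lemma ergodic_rmul_tau:
  fixes \<mu> :: "('d::finite zd \<Rightarrow> 'd zd) measure"
  assumes "ergodic \<mu>"
  shows "ergodic (rmul \<mu> (tau v))"
proof -
  have \<mu>: "prob_space \<mu>" and sets [simp, measurable_cong]: "sets \<mu> = sets Sspace"
    and inv: "\<And>u. distr \<mu> Sspace (shift u) = \<mu>"
    and erg: "\<And>A. A \<in> sets Sspace \<Longrightarrow> (\<forall>u. shift u -` A \<inter> space Sspace = A) \<Longrightarrow> measure \<mu> A = 0 \<or> measure \<mu> A = 1"
    using assms by (auto simp: ergodic_def)
  have sp: "space \<mu> = space Sspace" using sets_eq_imp_space_eq[OF sets] .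
  have m: "(\<lambda>\<sigma> :: 'd zd \<Rightarrow> 'd zd. tau v \<circ> \<sigma>) \<in> Sspace \<rightarrow>\<^sub>M Sspace"
    by (rule measurable_comp_left[OF bij_tau])
  have m\<mu>: "(\<lambda>\<sigma>. tau v \<circ> \<sigma>) \<in> \<mu> \<rightarrow>\<^sub>M Sspace" using m by (simp cong: measurable_cong_sets)
  have sh: "shift u \<in> Sspace \<rightarrow>\<^sub>M Sspace" for u
    unfolding shift_eq_conj_by by (rule measurable_conj_by[OF bij_tau])
  have sh\<mu>: "shift u \<in> \<mu> \<rightarrow>\<^sub>M Sspace" for u using sh by (simp cong: measurable_cong_sets)
  have comm: "shift u (tau v \<circ> \<sigma>) = tau v \<circ> shift u \<sigma>" for u \<sigma>
    by (rule ext) (simp add: shift_def tau_def algebra_simps)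
  show ?thesis
    unfolding ergodic_def
  proof (intro conjI allI ballI impI)
    show "prob_space (rmul \<mu> (tau v))" unfolding rmul_def by (rule prob_space.prob_space_distr[OF \<mu> m\<mu>])
    show "sets (rmul \<mu> (tau v)) = sets Sspace" by (simp add: rmul_def)
    show "distr (rmul \<mu> (tau v)) Sspace (shift u) = rmul \<mu> (tau v)" for u
    proof -
      have "distr (rmul \<mu> (tau v)) Sspace (shift u) = distr \<mu> Sspace ((\<lambda>\<sigma>. tau v \<circ> \<sigma>) \<circ> shift u)"
        unfolding rmul_def by (subst distr_distr[OF sh m\<mu>]) (simp add: comp_def[of "shift u"] comm comp_def[of "\<lambda>\<sigma>. tau v \<circ> \<sigma>"])
      also have "\<dots> = distr (distr \<mu> Sspace (shift u)) Sspace (\<lambda>\<sigma>. tau v \<circ> \<sigma>)"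
        by (rule distr_distr[OF m sh\<mu>, symmetric])
      finally show ?thesis by (simp add: inv rmul_def)
    qed
    fix A :: "('d zd \<Rightarrow> 'd zd) set" assume A: "A \<in> sets Sspace" and invA: "\<forall>u. shift u -` A \<inter> space Sspace = A"
    let ?A = "(\<lambda>\<sigma>. tau v \<circ> \<sigma>) -` A \<inter> space Sspace"
    have "measure (rmul \<mu> (tau v)) A = measure \<mu> ?A"
      unfolding rmul_def using measure_distr[OF m\<mu> A] by (simp add: sp)
    moreover have "?A \<in> sets Sspace" using measurable_sets[OF m A] .
    moreover have "shift u -` ?A \<inter> space Sspace = ?A" for u
    proof (rule set_eqI)
      fix \<sigma>
      have iff: "shift u \<tau> \<in> A \<longleftrightarrow> \<tau> \<in> A" if "\<tau> \<in> space Sspace" for \<tau>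
        using invA that by (metis IntI IntD1 vimageI vimageD)
      have "\<sigma> \<in> space Sspace \<Longrightarrow> tau v \<circ> \<sigma> \<in> space Sspace" using measurable_space[OF m] .
      moreover have "\<sigma> \<in> space Sspace \<Longrightarrow> shift u \<sigma> \<in> space Sspace" using measurable_space[OF sh] .
      ultimately show "\<sigma> \<in> shift u -` ?A \<inter> space Sspace \<longleftrightarrow> \<sigma> \<in> ?A"
        using iff[of "tau v \<circ> \<sigma>"] by (auto simp: comm)
    qed
    ultimately show "measure (rmul \<mu> (tau v)) A = 0 \<or> measure (rmul \<mu> (tau v)) A = 1"
      using erg[of ?A] by simp
  qed
qed

lemma tendsto_fun_zd:
  fixes s :: "'i \<Rightarrow> 'd::finite zd \<Rightarrow> 'd zd"
  assumes "\<And>x. eventually (\<lambda>n. s n x = \<sigma> x) F"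
  shows "(s \<longlongrightarrow> \<sigma>) F"
proof -
  have "limitin (product_topology (\<lambda>_. euclidean) UNIV) s \<sigma> F"
    unfolding limitin_componentwise using assms by (auto intro: tendsto_eventually)
  then show ?thesis by (simp add: euclidean_product_topology)
qed

lemma beta_antimono:
  assumes "\<And>x. 0 \<le> V x" "\<alpha>' \<le> \<alpha>"
  shows "beta V \<alpha> \<le> beta V \<alpha>'"
proof -
  have "cweight V \<alpha> \<gamma> \<le> cweight V \<alpha>' \<gamma>" for \<gamma>
    unfolding cweight_def using assms by (auto intro!: mult_right_mono sum_nonneg)
  then show ?thesis
    unfolding beta_def by (intro infsum_mono nonneg_summable_on_complete ennreal_leI mult_left_mono) auto
qed

text \<open>One jump costs at most the total energy S of the cycle, and S exp(-\<alpha> S) <=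
  exp(-\<alpha>' S) / (\<alpha> - \<alpha>') trades that factor for the smaller parameter, at which
  the weights still sum to less than 1.\<close>

lemma sum_jump_cweight_le:
  assumes "subcritical V \<alpha>'" "\<alpha>' < \<alpha>" "finite \<Gamma>" "\<Gamma> \<subseteq> cycles_at x"
  shows "(\<Sum>\<gamma>\<in>\<Gamma>. V (\<gamma> x - x) * cweight V \<alpha> \<gamma>) \<le> 1 / (\<alpha> - \<alpha>')"
proof -
  interpret s: subcritical V \<alpha>' by fact
  have "V (\<gamma> x - x) * cweight V \<alpha> \<gamma> \<le> cweight V \<alpha>' \<gamma> / (\<alpha> - \<alpha>')" if "\<gamma> \<in> \<Gamma>" for \<gamma>
  proof -
    define S where "S = (\<Sum>y\<in>csupp \<gamma>. V (\<gamma> y - y))"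
    have g: "\<gamma> \<in> cycles_at x" using that assms(4) by blast
    have "V (\<gamma> x - x) \<le> S"
      unfolding S_def using cycles_atD(2,3)[OF g] s.V_nonneg by (intro member_le_sum) auto
    moreover have "(\<alpha> - \<alpha>') * S \<le> exp ((\<alpha> - \<alpha>') * S)"
      using exp_ge_add_one_self[of "(\<alpha> - \<alpha>') * S"] by linarith
    then have "S \<le> exp ((\<alpha> - \<alpha>') * S) / (\<alpha> - \<alpha>')"
      using assms(2) by (simp add: pos_le_divide_eq mult.commute)
    ultimately have "V (\<gamma> x - x) * exp (- \<alpha> * S) \<le> exp ((\<alpha> - \<alpha>') * S) / (\<alpha> - \<alpha>') * exp (- \<alpha> * S)"
      by (intro mult_right_mono) auto
    also have "\<dots> = exp (- \<alpha>' * S) / (\<alpha> - \<alpha>')"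
      by (simp add: exp_add[symmetric] algebra_simps)
    finally show ?thesis by (simp add: cweight_def S_def)
  qed
  then have "(\<Sum>\<gamma>\<in>\<Gamma>. V (\<gamma> x - x) * cweight V \<alpha> \<gamma>) \<le> (\<Sum>\<gamma>\<in>\<Gamma>. cweight V \<alpha>' \<gamma>) / (\<alpha> - \<alpha>')"
    unfolding sum_divide_distrib by (rule sum_mono)
  also have "\<dots> \<le> 1 / (\<alpha> - \<alpha>')"
    using s.sum_W_cycles_le_b[OF assms(3,4)] s.b_less_1 assms(2) by (intro divide_right_mono) auto
  finally show ?thesis .
qed

text \<open>The second parameter \<alpha>' records room below \<alpha>, which is used for the
  integrability of jumps.\<close>

locale square_gibbs_limit = gibbs_limit "sqnorm :: 'd::finite zd \<Rightarrow> real" \<alpha> M \<zeta>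
  for \<alpha> and M :: "'w measure" and \<zeta> +
  fixes \<alpha>' :: real
  assumes \<alpha>': "\<alpha>' < \<alpha>" "beta (sqnorm :: 'd::finite zd \<Rightarrow> real) \<alpha>' < 1"
begin

lemma measurable_tau_\<mu> [measurable]: "(\<lambda>\<sigma>. tau v \<circ> \<sigma>) \<in> \<mu> \<rightarrow>\<^sub>M Sspace"
  using measurable_comp_left[OF bij_tau] by (simp cong: measurable_cong_sets)

text \<open>Transported to \<mu>, the energies acquire the correction \<open>D\<close>, which is
  unchanged when \<xi> is rearranged within \<Lambda>. It is absorbed into the test function, and
  the quasi-invariance of \<mu> applies.\<close>

lemma is_Gibbs_rmul: "is_Gibbs sqnorm \<alpha> (rmul \<mu> (tau v))"
proof (rule is_Gibbs_if_quasi_invariant)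
  show "prob_space (rmul \<mu> (tau v))"
    unfolding rmul_def by (rule prob_space.prob_space_distr[OF prob_space_\<mu>]) measurable
  show "sets (rmul \<mu> (tau v)) = sets Sspace" by (simp add: rmul_def)
  fix \<Lambda> and \<pi> :: "'d zd \<Rightarrow> 'd zd" and f :: "('d zd \<Rightarrow> 'd zd) \<Rightarrow> ennreal"
  assume L: "finite \<Lambda>" and \<pi>: "\<pi> permutes \<Lambda>" and f [measurable]: "f \<in> borel_measurable Sspace"
  note [measurable] = measurable_comp_left[OF bij_tau, of v] measurable_comp_right[OF permutes_bij[OF \<pi>]]
    measurable_comp_right[OF permutes_bij[OF permutes_inv[OF \<pi>]]]
  define D where "D \<xi> = Ham sqnorm \<Lambda> (tau v \<circ> \<xi>) - Ham sqnorm \<Lambda> \<xi>" for \<xi>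
  have [measurable]: "D \<in> borel_measurable Sspace" unfolding D_def[abs_def] by measurable
  define F where "F \<xi> = ennreal (exp (- \<alpha> * D \<xi>)) * f (tau v \<circ> \<xi>)" for \<xi>
  have [measurable]: "F \<in> borel_measurable Sspace" unfolding F_def[abs_def] by measurable
  have split: "ennreal (exp (- \<alpha> * Ham sqnorm \<Lambda> (tau v \<circ> \<eta>))) =
    ennreal (exp (- \<alpha> * Ham sqnorm \<Lambda> \<eta>)) * ennreal (exp (- \<alpha> * D \<eta>))" for \<eta>
    by (simp add: D_def ennreal_mult[symmetric] exp_add[symmetric] algebra_simps)
  have Dinv: "D (\<xi> \<circ> inv \<pi>) = D \<xi>" for \<xi>
    unfolding D_def by (rule Ham_tau_comp[OF permutes_inv[OF \<pi>]])
  have "(\<integral>\<^sup>+\<xi>. ennreal (exp (- \<alpha> * Ham sqnorm \<Lambda> (\<xi> \<circ> \<pi>))) * f (\<xi> \<circ> \<pi>) \<partial>rmul \<mu> (tau v)) =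
    (\<integral>\<^sup>+\<xi>. ennreal (exp (- \<alpha> * Ham sqnorm \<Lambda> (tau v \<circ> (\<xi> \<circ> \<pi>)))) * f (tau v \<circ> (\<xi> \<circ> \<pi>)) \<partial>\<mu>)"
    unfolding rmul_def by (subst nn_integral_distr) (simp_all add: comp_assoc)
  also have "\<dots> = (\<integral>\<^sup>+\<xi>. ennreal (exp (- \<alpha> * Ham sqnorm \<Lambda> (\<xi> \<circ> \<pi>))) * F (\<xi> \<circ> \<pi>) \<partial>\<mu>)"
    unfolding split F_def by (simp add: mult.assoc)
  also have "\<dots> = (\<integral>\<^sup>+\<xi>. ennreal (exp (- \<alpha> * Ham sqnorm \<Lambda> (\<xi> \<circ> inv \<pi>))) * F \<xi> \<partial>\<mu>)"
    by (rule quasi_invariant[OF L \<pi>]) measurable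
  also have "\<dots> = (\<integral>\<^sup>+\<xi>. ennreal (exp (- \<alpha> * Ham sqnorm \<Lambda> (tau v \<circ> (\<xi> \<circ> inv \<pi>)))) * f (tau v \<circ> \<xi>) \<partial>\<mu>)"
    unfolding split F_def Dinv by (simp add: mult.assoc)
  also have "\<dots> = (\<integral>\<^sup>+\<xi>. ennreal (exp (- \<alpha> * Ham sqnorm \<Lambda> (\<xi> \<circ> inv \<pi>))) * f \<xi> \<partial>rmul \<mu> (tau v))"
    unfolding rmul_def by (subst nn_integral_distr) (simp_all add: comp_assoc)
  finally show "(\<integral>\<^sup>+\<xi>. ennreal (exp (- \<alpha> * Ham sqnorm \<Lambda> (\<xi> \<circ> \<pi>))) * f (\<xi> \<circ> \<pi>) \<partial>rmul \<mu> (tau v)) =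
    (\<integral>\<^sup>+\<xi>. ennreal (exp (- \<alpha> * Ham sqnorm \<Lambda> (\<xi> \<circ> inv \<pi>))) * f \<xi> \<partial>rmul \<mu> (tau v))" .
qed

lemma measurable_jump [measurable]: "(\<lambda>\<sigma>. real_of_int ((\<sigma> x - x) $ i)) \<in> borel_measurable Sspace"
  by (rule measurable_compose[OF measurable_eval, of "\<lambda>y. real_of_int ((y - x) $ i)" borel x]) simp

lemma integrable_jump: "integrable \<mu> (\<lambda>\<sigma>. real_of_int ((\<sigma> x - x) $ i))"
proof (rule integrableI_bounded)
  have "subcritical (sqnorm :: 'd zd \<Rightarrow> real) \<alpha>'"
    using \<alpha>'(2) by unfold_locales (auto simp: sqnorm_zero sqnorm_nonneg)
  then have "(\<integral>\<^sup>+\<sigma>. ennreal (sqnorm (\<sigma> x - x)) \<partial>\<mu>) \<le> ennreal (1 / (\<alpha> - \<alpha>'))"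
    using \<alpha>'(1) by (intro jump_moment sum_jump_cweight_le)
  moreover have "(\<integral>\<^sup>+\<sigma>. ennreal (norm (real_of_int ((\<sigma> x - x) $ i))) \<partial>\<mu>) \<le> (\<integral>\<^sup>+\<sigma>. ennreal (sqnorm (\<sigma> x - x)) \<partial>\<mu>)"
    by (intro nn_integral_mono ennreal_leI) (simp only: real_norm_def abs_component_le_sqnorm)
  ultimately show "(\<integral>\<^sup>+\<sigma>. ennreal (norm (real_of_int ((\<sigma> x - x) $ i))) \<partial>\<mu>) < \<infinity>"
    by (metis (no_types, lifting) ennreal_less_top infinity_ennreal_def order_le_less_trans)
qed measurable

text \<open>Conjugation by the point reflection in x preserves \<mu> and reverses the sign of the
  jump at x.\<close>

lemma integral_jump: "(\<integral>\<sigma>. real_of_int ((\<sigma> x - x) $ i) \<partial>\<mu>) = 0"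
proof -
  define g :: "'d zd \<Rightarrow> 'd zd" where "g y = x + x - y" for y
  have gg: "g (g y) = y" for y by (simp add: g_def)
  have g: "bij g" by (rule bij_betw_byWitness[where f'=g]) (auto simp: gg)
  have inv_g: "inv g = g" by (rule inv_equality) (simp_all add: gg)
  note [measurable] = measurable_conj_by[OF g]
  have "distr \<mu> Sspace (conj_by g) = \<mu>"
    by (rule distr_conj_by[OF g]) (simp add: g_def sqnorm_minus_commute)
  then have "(\<integral>\<sigma>. real_of_int ((\<sigma> x - x) $ i) \<partial>\<mu>) = (\<integral>\<sigma>. real_of_int ((\<sigma> x - x) $ i) \<partial>distr \<mu> Sspace (conj_by g))"
    by simp
  also have "\<dots> = (\<integral>\<sigma>. real_of_int ((conj_by g \<sigma> x - x) $ i) \<partial>\<mu>)"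
    by (rule integral_distr) measurable
  also have "\<dots> = (\<integral>\<sigma>. - real_of_int ((\<sigma> x - x) $ i) \<partial>\<mu>)"
    by (simp add: conj_by_def inv_g g_def)
  also have "\<dots> = - (\<integral>\<sigma>. real_of_int ((\<sigma> x - x) $ i) \<partial>\<mu>)" by (rule Bochner_Integration.integral_minus)
  finally show ?thesis by linarith
qed

lemma mean_jump_rmul: "mean_jump (rmul \<mu> (tau v)) v"
  unfolding mean_jump_def
proof (intro allI conjI)
  fix x i
  interpret mu: prob_space \<mu> by (rule prob_space_\<mu>)
  have eq: "real_of_int (((tau v \<circ> \<sigma>) x - x) $ i) = real_of_int ((\<sigma> x - x) $ i) + real_of_int (v $ i)" for \<sigma>
    by (simp add: tau_def)
  have int: "integrable \<mu> (\<lambda>\<sigma>. real_of_int (((tau v \<circ> \<sigma>) x - x) $ i))"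
    unfolding eq by (intro Bochner_Integration.integrable_add integrable_jump) simp
  then show "integrable (rmul \<mu> (tau v)) (\<lambda>\<sigma>. real_of_int ((\<sigma> x - x) $ i))"
    unfolding rmul_def by (subst integrable_distr_eq) auto
  have "(\<integral>\<sigma>. real_of_int ((\<sigma> x - x) $ i) \<partial>rmul \<mu> (tau v)) = (\<integral>\<sigma>. real_of_int (((tau v \<circ> \<sigma>) x - x) $ i) \<partial>\<mu>)"
    unfolding rmul_def by (rule integral_distr) measurable
  also have "\<dots> = (\<integral>\<sigma>. real_of_int ((\<sigma> x - x) $ i) \<partial>\<mu>) + real_of_int (v $ i)"
    unfolding eq by (subst Bochner_Integration.integral_add[OF integrable_jump]) (use mu.prob_space in auto)
  finally show "(\<integral>\<sigma>. real_of_int ((\<sigma> x - x) $ i) \<partial>rmul \<mu> (tau v)) = real_of_int (v $ i)"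
    using integral_jump[of x i] by linarith
qed

text \<open>Both sides are rewritten as integrals of f composed with \<open>tau v\<close>, against
  the untranslated Gibbs measures and \<mu>; pointwise convergence of bijections is convergence in
  the product topology, so continuity of f applies.\<close>

lemma weak_convergence:
  fixes f :: "('d zd \<Rightarrow> 'd zd) \<Rightarrow> real"
  assumes "continuous_on {\<sigma>. bij \<sigma>} f" "bounded (f ` {\<sigma>. bij \<sigma>})" and f [measurable]: "f \<in> borel_measurable Sspace"
  shows "((\<lambda>\<Lambda>. \<integral>\<sigma>. f \<sigma> \<partial>Gibbs_fin sqnorm \<alpha> \<Lambda> (tau v)) \<longlongrightarrow> (\<integral>\<sigma>. f \<sigma> \<partial>rmul \<mu> (tau v))) (finite_subsets_at_top UNIV)"
proof -
  note [measurable] = measurable_comp_left[OF bij_tau, of v]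
  obtain B where B: "\<And>\<sigma>. bij \<sigma> \<Longrightarrow> \<bar>f \<sigma>\<bar> \<le> B" using assms(2) by (auto simp: bounded_iff)
  have lim: "((\<lambda>\<Lambda>. \<integral>\<sigma>. f (tau v \<circ> \<sigma>) \<partial>Gibbs_fin sqnorm \<alpha> \<Lambda> id) \<longlongrightarrow> (\<integral>\<sigma>. f (tau v \<circ> \<sigma>) \<partial>\<mu>)) (finite_subsets_at_top UNIV)"
  proof (rule Gibbs_tendsto[where B=B])
    show "\<bar>f (tau v \<circ> \<sigma>)\<bar> \<le> B" if "bij \<sigma>" for \<sigma> using that by (intro B bij_comp bij_tau)
    fix s :: "nat \<Rightarrow> 'd zd \<Rightarrow> 'd zd" and \<sigma>
    assume s: "\<And>n. bij (s n)" "bij \<sigma>" "\<And>x. eventually (\<lambda>n. s n x = \<sigma> x) sequentially"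
    show "(\<lambda>n. f (tau v \<circ> s n)) \<longlonglongrightarrow> f (tau v \<circ> \<sigma>)"
    proof (rule continuous_on_tendsto_compose[OF assms(1)])
      show "(\<lambda>n. tau v \<circ> s n) \<longlonglongrightarrow> (tau v \<circ> \<sigma>)"
      proof (rule tendsto_fun_zd)
        show "eventually (\<lambda>n. (tau v \<circ> s n) x = (tau v \<circ> \<sigma>) x) sequentially" for x
          using s(3)[of x] by eventually_elim simp
      qed
      show "tau v \<circ> \<sigma> \<in> {\<sigma>. bij \<sigma>}" using bij_comp[OF s(2) bij_tau] by simp
      show "eventually (\<lambda>n. tau v \<circ> s n \<in> {\<sigma>. bij \<sigma>}) sequentially"
        using bij_comp[OF s(1) bij_tau] by (intro always_eventually) simp
    qed
  qed measurable
  have eq: "(\<integral>\<sigma>. f (tau v \<circ> \<sigma>) \<partial>\<mu>) = (\<integral>\<sigma>. f \<sigma> \<partial>rmul \<mu> (tau v))"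
    unfolding rmul_def by (rule integral_distr[symmetric]) measurable
  have "eventually (\<lambda>\<Lambda>. (\<integral>\<sigma>. f (tau v \<circ> \<sigma>) \<partial>Gibbs_fin sqnorm \<alpha> \<Lambda> id) = (\<integral>\<sigma>. f \<sigma> \<partial>Gibbs_fin sqnorm \<alpha> \<Lambda> (tau v))) (finite_subsets_at_top UNIV)"
  proof (rule eventually_finite_subsets_at_top_weakI)
    fix \<Lambda> :: "'d zd set" assume L: "finite \<Lambda>"
    have "(\<lambda>\<sigma>. tau v \<circ> \<sigma>) \<in> Gibbs_fin sqnorm \<alpha> \<Lambda> id \<rightarrow>\<^sub>M Sspace" by measurable
    then show "(\<integral>\<sigma>. f (tau v \<circ> \<sigma>) \<partial>Gibbs_fin sqnorm \<alpha> \<Lambda> id) = (\<integral>\<sigma>. f \<sigma> \<partial>Gibbs_fin sqnorm \<alpha> \<Lambda> (tau v))"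
      unfolding rmul_Gibbs_fin[OF L, symmetric] rmul_def by (rule integral_distr[symmetric]) measurable
  qed
  then show ?thesis unfolding eq[symmetric] by (rule Lim_transform_eventually[OF lim])
qed

end

theorem theorem2p4:
  shows "(\<exists>!r::real. 0 \<le> r \<and> r \<le> 1 \<and> r / (1 - r)^2 - r = 1)
    \<and> (\<forall>\<rho>0::real. 0 \<le> \<rho>0 \<and> \<rho>0 \<le> 1 \<and> \<rho>0 / (1 - \<rho>0)^2 - \<rho>0 = 1 \<longrightarrow>
         alpha_star (sqnorm :: ('d::finite) zd \<Rightarrow> real)
           \<le> ereal (pi / ((1 + \<rho>0) powr (1 / real CARD('d)) - 1)^2))
    \<and> (\<forall>\<alpha>::real. ereal \<alpha> > alpha_star (sqnorm :: ('d::finite) zd \<Rightarrow> real) \<longrightarrow>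
        (\<exists>(P :: ('d zd set \<Rightarrow> 'd zd \<Rightarrow> 'd zd) measure)
           (\<zeta> :: 'd zd set \<Rightarrow> ('d zd set \<Rightarrow> 'd zd \<Rightarrow> 'd zd) \<Rightarrow> 'd zd \<Rightarrow> 'd zd).
          prob_space P \<and>
          (\<forall>\<Lambda>. \<zeta> \<Lambda> \<in> measurable P Sspace) \<and>
          (\<forall>\<Lambda> \<omega>. \<omega> \<in> space P \<longrightarrow> \<zeta> \<Lambda> \<omega> \<in> Scond \<Lambda> id) \<and>
          (\<forall>\<Lambda>. finite \<Lambda> \<longrightarrow> distr P Sspace (\<zeta> \<Lambda>) = Gibbs_fin sqnorm \<alpha> \<Lambda> id) \<and>
          (AE \<omega> in P. \<forall>x. ((\<lambda>\<Lambda>. \<zeta> \<Lambda> \<omega> x) \<longlongrightarrow> \<zeta> UNIV \<omega> x) (finite_subsets_at_top UNIV)) \<and>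
          is_Gibbs sqnorm \<alpha> (distr P Sspace (\<zeta> UNIV)) \<and>
          ergodic (distr P Sspace (\<zeta> UNIV)) \<and>
          (\<forall>v. let \<mu> = distr P Sspace (\<zeta> UNIV) in
             \<comment> \<open>(i)\<close>
             (\<forall>\<Lambda>. finite \<Lambda> \<longrightarrow>
                rmul (Gibbs_fin sqnorm \<alpha> \<Lambda> id) (tau v) = Gibbs_fin sqnorm \<alpha> \<Lambda> (tau v) \<and>
                distr P Sspace (\<lambda>\<omega>. tau v \<circ> \<zeta> \<Lambda> \<omega>) = Gibbs_fin sqnorm \<alpha> \<Lambda> (tau v)) \<and>
             \<comment> \<open>(ii)\<close>
             (AE \<omega> in P. \<forall>x. ((\<lambda>\<Lambda>. (tau v \<circ> \<zeta> \<Lambda> \<omega>) x) \<longlongrightarrow> (tau v \<circ> \<zeta> UNIV \<omega>) x)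
                                (finite_subsets_at_top UNIV)) \<and>
             (\<forall>f :: ('d zd \<Rightarrow> 'd zd) \<Rightarrow> real.
                continuous_on {\<sigma>. bij \<sigma>} f \<and> bounded (f ` {\<sigma>. bij \<sigma>}) \<and> f \<in> borel_measurable Sspace \<longrightarrow>
                ((\<lambda>\<Lambda>. \<integral>\<sigma>. f \<sigma> \<partial>Gibbs_fin sqnorm \<alpha> \<Lambda> (tau v))
                   \<longlongrightarrow> (\<integral>\<sigma>. f \<sigma> \<partial>rmul \<mu> (tau v))) (finite_subsets_at_top UNIV)) \<and>
             \<comment> \<open>(iii)\<close>
             ergodic (rmul \<mu> (tau v)) \<and> is_Gibbs sqnorm \<alpha> (rmul \<mu> (tau v)) \<and>
             mean_jump (rmul \<mu> (tau v)) v)))"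
    (is "_ \<and> _ \<and> (\<forall>\<alpha>. _ \<longrightarrow> ?family \<alpha>)")
proof (intro conjI allI impI)
  show "\<exists>!r::real. 0 \<le> r \<and> r \<le> 1 \<and> r / (1 - r)^2 - r = 1" by (rule ex1_rho)
next
  fix \<rho>0 :: real
  assume "0 \<le> \<rho>0 \<and> \<rho>0 \<le> 1 \<and> \<rho>0 / (1 - \<rho>0)^2 - \<rho>0 = 1"
  then show "alpha_star (sqnorm :: 'd zd \<Rightarrow> real) \<le> ereal (pi / ((1 + \<rho>0) powr (1 / real CARD('d)) - 1)^2)"
    by (intro alpha_star_sqnorm_le) auto
next
  fix \<alpha> :: real
  assume "alpha_star (sqnorm :: 'd zd \<Rightarrow> real) < ereal \<alpha>"
  \<comment> \<open>The strict inequality against an infimum supplies \<alpha>' below \<alpha>;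
    monotonicity of \<open>beta\<close> then gives subcriticality at \<alpha> itself.\<close>
  then obtain \<alpha>' where \<alpha>': "\<alpha>' < \<alpha>" "beta (sqnorm :: 'd zd \<Rightarrow> real) \<alpha>' < 1"
    unfolding alpha_star_def by (auto simp: Inf_less_iff)
  have "beta (sqnorm :: 'd zd \<Rightarrow> real) \<alpha> < 1"
    using beta_antimono[of "sqnorm :: 'd zd \<Rightarrow> real" \<alpha>' \<alpha>] \<alpha>' by (auto simp: sqnorm_nonneg)
  then interpret s: subcritical "sqnorm :: 'd zd \<Rightarrow> real" \<alpha>
    by unfold_locales (auto simp: sqnorm_zero sqnorm_nonneg)
  obtain P :: "('d zd set \<Rightarrow> 'd zd \<Rightarrow> 'd zd) measure"
    and \<zeta> :: "'d zd set \<Rightarrow> ('d zd set \<Rightarrow> 'd zd \<Rightarrow> 'd zd) \<Rightarrow> 'd zd \<Rightarrow> 'd zd" where "prob_space P \<and>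
    (\<forall>\<Lambda>. \<zeta> \<Lambda> \<in> P \<rightarrow>\<^sub>M Sspace) \<and> (\<forall>\<Lambda> \<omega>. \<omega> \<in> space P \<longrightarrow> \<zeta> \<Lambda> \<omega> \<in> Scond \<Lambda> id) \<and>
    (\<forall>\<Lambda>. finite \<Lambda> \<longrightarrow> distr P Sspace (\<zeta> \<Lambda>) = Gibbs_fin sqnorm \<alpha> \<Lambda> id) \<and>
    (AE \<omega> in P. \<forall>x. eventually (\<lambda>\<Lambda>. \<zeta> \<Lambda> \<omega> x = \<zeta> UNIV \<omega> x) (finite_subsets_at_top UNIV))"
    using s.coupling_exists by (elim exE)
  then have P: "prob_space P"
    and meas: "\<And>\<Lambda>. \<zeta> \<Lambda> \<in> P \<rightarrow>\<^sub>M Sspace"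
    and Sc: "\<And>\<Lambda> \<omega>. \<omega> \<in> space P \<Longrightarrow> \<zeta> \<Lambda> \<omega> \<in> Scond \<Lambda> id"
    and law: "\<And>\<Lambda>. finite \<Lambda> \<Longrightarrow> distr P Sspace (\<zeta> \<Lambda>) = Gibbs_fin sqnorm \<alpha> \<Lambda> id"
    and conv: "AE \<omega> in P. \<forall>x. eventually (\<lambda>\<Lambda>. \<zeta> \<Lambda> \<omega> x = \<zeta> UNIV \<omega> x) (finite_subsets_at_top UNIV)"
    by simp_all
  interpret prob_space P by (rule P)
  interpret square_gibbs_limit \<alpha> P \<zeta> \<alpha>'
    by unfold_locales (use meas law conv \<alpha>' in auto)
  have \<mu>: "distr P Sspace (\<zeta> UNIV) = \<mu>" by (simp add: \<mu>_def)
  have i: "distr P Sspace (\<lambda>\<omega>. tau v \<circ> \<zeta> \<Lambda> \<omega>) = Gibbs_fin sqnorm \<alpha> \<Lambda> (tau v)" if "finite \<Lambda>" for v \<Lambda>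
    unfolding rmul_Gibbs_fin[OF that, symmetric] law[OF that, symmetric] rmul_def
    by (subst distr_distr[OF measurable_comp_left[OF bij_tau] meas]) (simp add: comp_def)
  have ii: "AE \<omega> in P. \<forall>x. ((\<lambda>\<Lambda>. (tau v \<circ> \<zeta> \<Lambda> \<omega>) x) \<longlongrightarrow> (tau v \<circ> \<zeta> UNIV \<omega>) x) (finite_subsets_at_top UNIV)" for v
    unfolding tendsto_zd_iff using conv by (simp add: tau_def)
  show "?family \<alpha>"
  proof (rule exI[of _ P], rule exI[of _ \<zeta>], unfold \<mu> Let_def, intro conjI allI impI)
    show "AE \<omega> in P. \<forall>x. ((\<lambda>\<Lambda>. \<zeta> \<Lambda> \<omega> x) \<longlongrightarrow> \<zeta> UNIV \<omega> x) (finite_subsets_at_top UNIV)"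
      unfolding tendsto_zd_iff by (rule conv)
    show "is_Gibbs sqnorm \<alpha> \<mu>"
      by (rule is_Gibbs_if_quasi_invariant[OF prob_space_\<mu> sets_\<mu> quasi_invariant])
    fix v
    show "((\<lambda>\<Lambda>. \<integral>\<sigma>. f \<sigma> \<partial>Gibbs_fin sqnorm \<alpha> \<Lambda> (tau v)) \<longlongrightarrow> (\<integral>\<sigma>. f \<sigma> \<partial>rmul \<mu> (tau v))) (finite_subsets_at_top UNIV)"
      if "continuous_on {\<sigma>. bij \<sigma>} f \<and> bounded (f ` {\<sigma>. bij \<sigma>}) \<and> f \<in> borel_measurable Sspace"
      for f :: "('d zd \<Rightarrow> 'd zd) \<Rightarrow> real"
      using that by (intro weak_convergence) auto
  qed (use P meas Sc law i ii rmul_Gibbs_fin ergodic_\<mu> ergodic_rmul_tau[OF ergodic_\<mu>] is_Gibbs_rmul mean_jump_rmul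
      in \<open>simp_all\<close>)
qed

end
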